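(* Let $0<\alpha<\pi$, let $L_n(u)=\sup\{|P(u)|:P\in\mathcal{P}_{n,\alpha}\}$ be the upper envelope of $\mathcal{P}_{n,\alpha}$, and, with $\lambda=\lambda(u)$, $\lambda_0=\lambda(u_0)$, define the reproducing kernel $$k_{\Omega_\alpha}(u,u_0)=k_{\mathbb{H}_+}(\lambda,\lambda_0):=\frac{2\lambda\overline{\lambda_0}}{(\lambda+\overline{\lambda_0})^2}.$$ Then for every $u\in\mathbb{C}\setminus A_\alpha$, as $n\to\infty$, $$L_n(u)\sim e^{n g_{\Omega_\alpha}(u,\infty)}\,k_{\Omega_\alpha}(u,u).$$
   Context: $A_\alpha=\{u\in\mathbb{C}: |u|=1,\ -\alpha\le\arg u\le\alpha\}$ and $\Omega_\alpha=\overline{\mathbb{C}}\setminus A_\alpha$. $\mathcal{P}_{n,\alpha}$ is the set of complex polynomials $P$ of degree at most $n$ with $\sup_{u\in A_\alpha}|P(u)|\le1$. $g_{\Omega_\alpha}(u,\infty)$ is the Green's function of $\Omega_\alpha$ with pole at $\infty$. $\lambda:\Omega_\alpha\to\{\lambda\in\mathbb{C}:-\pi/4\le\arg\lambda\le\pi/4\}$ is the function $\lambda(u)=\left(\frac{ue^{i\alpha}-1}{u-e^{i\alpha}}\right)^{1/4}$, the branch of the fourth root being the one with values in this sector. $\mathbb{H}_+=\{z\in\mathbb{C}:\operatorname{Re}z>0\}$; the kernel $1/(\lambda+\overline{\lambda_0})^2$ is, up to normalization, the Bergman kernel of $\mathbb{H}_+$, so that $k_{\mathbb{H}_+}$ is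 (up to normalization) the reproducing kernel of the weighted Bergman space $\lambda A^2(\mathbb{H}_+)$. For sequences, $f_n\sim g_n$ means $\lim_{n\to\infty}f_n/g_n=1$. *)

theory Defs
  imports "HOL-Analysis.Analysis" "HOL-Computational_Algebra.Polynomial"
begin

definition circ_arc :: "real \<Rightarrow> complex set" where
  "circ_arc \<alpha> = {u. cmod u = 1 \<and> - \<alpha> \<le> Arg u \<and> Arg u \<le> \<alpha>}"

definition poly_class :: "nat \<Rightarrow> real \<Rightarrow> complex poly set" where
  "poly_class n \<alpha> = {P. degree P \<le> n \<and> (SUP u\<in>circ_arc \<alpha>. cmod (poly P u)) \<le> 1}"

text \<open>For \<open>0 < \<alpha> < \<pi>\<close> the suprema in \<open>poly_class\<close> and \<open>upper_envelope\<close> are suprema of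
  nonempty sets of reals that are bounded above (continuity on a compact set, and finite
  dimension together with infinitely many points on the arc).\<close>

definition upper_envelope :: "nat \<Rightarrow> real \<Rightarrow> complex \<Rightarrow> real" where
  "upper_envelope n \<alpha> u = (SUP P\<in>poly_class n \<alpha>. cmod (poly P u))"

text \<open>A harmonic function: twice continuously differentiable, with vanishing Laplacian.
  \<open>hx\<close>, \<open>hy\<close> are the first and \<open>hxx\<close>, \<open>hxy\<close>, \<open>hyx\<close>, \<open>hyy\<close> the second partial derivatives.\<close>

definition harmonic_on :: "(complex \<Rightarrow> real) \<Rightarrow> complex set \<Rightarrow> bool" where
  "harmonic_on h S \<longleftrightarrow> open S \<and>
    (\<exists>hx hy hxx hxy hyx hyy.
      (\<forall>z\<in>S. (h has_derivative (\<lambda>w. hx z * Re w + hy z * Im w)) (at z) \<and>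
             (hx has_derivative (\<lambda>w. hxx z * Re w + hxy z * Im w)) (at z) \<and>
             (hy has_derivative (\<lambda>w. hyx z * Re w + hyy z * Im w)) (at z)) \<and>
      continuous_on S hxx \<and> continuous_on S hxy \<and> continuous_on S hyx \<and> continuous_on S hyy \<and>
      (\<forall>z\<in>S. hxx z + hyy z = 0))"

text \<open>\<open>g\<close> is the Green's function with pole at infinity of the domain \<open>D \<union> {\<infinity>}\<close> of the Riemann
  sphere, where \<open>D\<close> is the complement of a compact set and all boundary points are regular (as
  is the case for the complement of an arc): harmonic in \<open>D\<close>, logarithmic pole at infinity,
  boundary values zero. The extension by zero off \<open>D\<close> makes \<open>g\<close> unique as a total function.\<close>

definition is_green_at_infinity :: "complex set \<Rightarrow> (complex \<Rightarrow> real) \<Rightarrow> bool" where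
  "is_green_at_infinity D g \<longleftrightarrow>
     harmonic_on g D \<and>
     Bfun (\<lambda>u. g u - ln (cmod u)) at_infinity \<and>
     (\<forall>\<zeta>\<in>frontier D. (g \<longlongrightarrow> 0) (at \<zeta> within D)) \<and>
     (\<forall>u. u \<notin> D \<longrightarrow> g u = 0)"

definition green_at_infinity :: "complex set \<Rightarrow> complex \<Rightarrow> real" where
  "green_at_infinity D = (THE g. is_green_at_infinity D g)"

text \<open>The library's \<open>powr\<close> is the principal power: \<open>z powr (1/4)\<close> has argument \<open>Arg z / 4\<close>, and
  \<open>-\<pi> < Arg z \<le> \<pi>\<close>. The lemma below confirms that this is the branch with values in the sector
  \<open>-\<pi>/4 \<le> arg \<le> \<pi>/4\<close>.\<close>

definition lam :: "real \<Rightarrow> complex \<Rightarrow> complex" where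
  "lam \<alpha> u = ((u * cis \<alpha> - 1) / (u - cis \<alpha>)) powr (1/4)"

lemma lam_branch:
  assumes "0 < \<alpha>" "\<alpha> < pi" "u \<notin> circ_arc \<alpha>"
  shows "lam \<alpha> u ^ 4 = (u * cis \<alpha> - 1) / (u - cis \<alpha>)"
    and "lam \<alpha> u \<noteq> 0" "- pi / 4 \<le> Arg (lam \<alpha> u)" "Arg (lam \<alpha> u) \<le> pi / 4"
proof -
  define m where "m = (u * cis \<alpha> - 1) / (u - cis \<alpha>)"
  have 1: "u \<noteq> cis \<alpha>"
    using assms by (auto simp: circ_arc_def Arg_cis)
  have 2: "u * cis \<alpha> \<noteq> 1"
  proof
    assume "u * cis \<alpha> = 1"
    then have "u = cis (- \<alpha>)"
      by (metis cis_inverse inverse_unique mult.commute)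
    then show False
      using assms by (auto simp: circ_arc_def Arg_cis)
  qed
  have m: "m \<noteq> 0" using 1 2 by (simp add: m_def)
  have l: "lam \<alpha> u = exp (Ln m / 4)"
    using m by (simp add: lam_def powr_def flip: m_def)
  show "lam \<alpha> u ^ 4 = (u * cis \<alpha> - 1) / (u - cis \<alpha>)"
    using m by (simp add: l flip: exp_of_nat_mult m_def)
  show "lam \<alpha> u \<noteq> 0" by (simp add: l)
  have "Arg (lam \<alpha> u) = Im (Ln m) / 4"
    using m mpi_less_Im_Ln[of m] Im_Ln_le_pi[of m] unfolding l
    by (subst Arg_exp) auto
  then show "- pi / 4 \<le> Arg (lam \<alpha> u)" "Arg (lam \<alpha> u) \<le> pi / 4"
    using m mpi_less_Im_Ln[of m] Im_Ln_le_pi[of m] by auto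
qed

definition k_half_plane :: "complex \<Rightarrow> complex \<Rightarrow> complex" where
  "k_half_plane l l0 = 2 * l * cnj l0 / (l + cnj l0)\<^sup>2"

definition k_Omega :: "real \<Rightarrow> complex \<Rightarrow> complex \<Rightarrow> complex" where
  "k_Omega \<alpha> u u0 = k_half_plane (lam \<alpha> u) (lam \<alpha> u0)"

end

theory Submission
  imports Defs "HOL-Complex_Analysis.Complex_Analysis"
begin

text \<open>With \<open>\<zeta> = \<lambda>\<^sup>2\<close> rescaled so that \<open>\<bar>\<zeta> u\<bar> = 1\<close>, the variable \<open>z = (\<zeta> - 1) / (\<zeta> + 1)\<close> maps the
  complement of the arc onto the unit disc, the two sides of the arc being exchanged by \<open>z \<mapsto> 1/z\<close>;
  \<open>u\<close> goes to a purely imaginary point \<open>w = \<i> t\<close> and \<open>\<infinity>\<close> to a point \<open>a \<noteq> 0\<close>. The Green function is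
  \<open>- ln \<bar>B\<bar>\<close> for the Blaschke factor \<open>B\<close> at \<open>a\<close>, and the kernel at \<open>u\<close> equals \<open>(1 + t\<^sup>2) / 2\<close>.

  Lower bound: with \<open>f z = (1 - w z)\<^sup>2 / (2 (1 + t\<^sup>2))\<close> one has \<open>\<bar>f z\<bar> + \<bar>f (1/z)\<bar> = 1\<close> on the circle, and
  \<open>f B\<^sup>-\<^sup>n\<close> plus its mirror image is, up to an exponentially small correction at \<open>0\<close> and \<open>\<infinity>\<close>, a
  polynomial of degree \<open>n\<close> in the original variable.

  Upper bound: for a polynomial \<open>P\<close> bounded by \<open>1\<close> on the arc, \<open>F = P B\<^sup>n\<close> is bounded by \<open>1\<close> in the disc and
  its values at \<open>z\<close> and \<open>1/z\<close> differ by a rapidly oscillating unimodular factor. Integrating \<open>F\<close> against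
  a kernel dual to \<open>f\<close>, multiplied by a Fejer kernel in that factor, recovers almost \<open>2 F w\<close>, all
  other harmonics being exponentially small.\<close>

section \<open>Harmonic functions and uniqueness of the Green function\<close>

text \<open>The maximum principle for \<open>F\<close> alone gives only e^(n g). The factor (1 +
  t^2) / 2 < 1 appears because u(1/z) = u(z) ties the values of \<open>F\<close> at z and 1/z
  together. Rescaling makes w imaginary, and this is what makes the problem explicitly solvable: on
  the circle |1 - w z|^2 and |1 - w / z|^2 = |z - w|^2 have opposite terms in Im z, so their sum is
  the constant 2 (1 + t^2), while f(w) = (1 + t^2) / 2. In the upper bound a Fejer kernel of fixed
  order N retains two harmonics of the dual integral, those of index 0 and -1. Their means agree by
  the mirror symmetry, and they weigh N and N - 1, against N for the total mass; hence |F(w)| (2 -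
  1/N) is at most 1 + t^2 plus an error. The constant in that error grows exponentially in N, so n
  tends to infinity first and N afterwards.\<close>

lemma no_local_max_if_second_deriv_pos:
  fixes f f' :: "real \<Rightarrow> real"
  assumes e: "e > 0"
    and f: "\<And>s. \<bar>s\<bar> < e \<Longrightarrow> (f has_real_derivative f' s) (at s)"
    and f': "(f' has_real_derivative c) (at 0)" and c: "c > 0"
    and max: "\<And>s. \<bar>s\<bar> < e \<Longrightarrow> f s \<le> f 0"
  shows False
proof -
  have f0: "f' 0 = 0"
    using DERIV_local_max[OF f[of 0] e] max e by simp
  \<comment> \<open>A zero of \<open>f'\<close> with positive slope makes \<open>f'\<close> positive
    just to its right, so the mean value theorem pushes \<open>f\<close> above
    \<open>f 0\<close>.\<close>
  obtain d where d: "d > 0" "\<And>h. h > 0 \<Longrightarrow> h < d \<Longrightarrow> f' 0 < f' (0 + h)"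
    using DERIV_pos_inc_right[OF f' c] by blast
  define h where "h = min d e / 2"
  have h: "0 < h" "h < d" "h < e" using d(1) e by (auto simp: h_def)
  obtain z where z: "0 < z" "z < h" "f h - f 0 = (h - 0) * f' z"
    using MVT2[of 0 h f f'] h f by force
  have "f' z > 0" using d(2)[of z] z h f0 by simp
  then have "f h > f 0" using z h by (metis diff_0_right diff_gt_0_iff_gt mult_pos_pos)
  then show False using max[of h] h by simp
qed

lemma harmonic_on_lincomb:
  assumes "harmonic_on f S" "harmonic_on g S"
  shows "harmonic_on (\<lambda>z. a * f z + b * g z) S"
proof -
  obtain fx fy fxx fxy fyx fyy where f: "open S"
    "\<And>z. z\<in>S \<Longrightarrow> (f has_derivative (\<lambda>w. fx z * Re w + fy z * Im w)) (at z)"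
    "\<And>z. z\<in>S \<Longrightarrow> (fx has_derivative (\<lambda>w. fxx z * Re w + fxy z * Im w)) (at z)"
    "\<And>z. z\<in>S \<Longrightarrow> (fy has_derivative (\<lambda>w. fyx z * Re w + fyy z * Im w)) (at z)"
    "continuous_on S fxx" "continuous_on S fxy" "continuous_on S fyx" "continuous_on S fyy"
    "\<And>z. z\<in>S \<Longrightarrow> fxx z + fyy z = 0"
    using assms(1) unfolding harmonic_on_def by blast
  obtain gx gy gxx gxy gyx gyy where g:
    "\<And>z. z\<in>S \<Longrightarrow> (g has_derivative (\<lambda>w. gx z * Re w + gy z * Im w)) (at z)"
    "\<And>z. z\<in>S \<Longrightarrow> (gx has_derivative (\<lambda>w. gxx z * Re w + gxy z * Im w)) (at z)"
    "\<And>z. z\<in>S \<Longrightarrow> (gy has_derivative (\<lambda>w. gyx z * Re w + gyy z * Im w)) (at z)"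
    "continuous_on S gxx" "continuous_on S gxy" "continuous_on S gyx" "continuous_on S gyy"
    "\<And>z. z\<in>S \<Longrightarrow> gxx z + gyy z = 0"
    using assms(2) unfolding harmonic_on_def by blast
  have L: "((\<lambda>z. a * h z + b * k z) has_derivative
      (\<lambda>w. (a * hx z + b * kx z) * Re w + (a * hy z + b * ky z) * Im w)) (at z)"
    if "(h has_derivative (\<lambda>w. hx z * Re w + hy z * Im w)) (at z)"
       "(k has_derivative (\<lambda>w. kx z * Re w + ky z * Im w)) (at z)"
    for h k hx hy kx ky :: "complex \<Rightarrow> real" and z
    using has_derivative_add[OF has_derivative_mult_right[OF that(1), of a]
        has_derivative_mult_right[OF that(2), of b]]
    by (simp add: algebra_simps)
  show ?thesis
    unfolding harmonic_on_def
    apply (intro conjI f(1))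
    apply (rule exI[of _ "\<lambda>z. a * fx z + b * gx z"])
    apply (rule exI[of _ "\<lambda>z. a * fy z + b * gy z"])
    apply (rule exI[of _ "\<lambda>z. a * fxx z + b * gxx z"])
    apply (rule exI[of _ "\<lambda>z. a * fxy z + b * gxy z"])
    apply (rule exI[of _ "\<lambda>z. a * fyx z + b * gyx z"])
    apply (rule exI[of _ "\<lambda>z. a * fyy z + b * gyy z"])
    apply (intro conjI ballI L f g continuous_intros; assumption?)
    subgoal for z using f(9)[of z] g(8)[of z]
      by (metis (no_types, opaque_lifting) add.commute add.left_commute distrib_left mult_zero_right add_0)
    done
qed

text \<open>Subharmonic perturbation: at a maximum of \<open>V + \<delta> \<bar>z\<bar>\<^sup>2\<close> the Laplacian \<open>4\<delta>\<close> would have to be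
  nonpositive.\<close>

lemma harmonic_le_zero:
  assumes harm: "harmonic_on V D" and cont: "continuous_on UNIV V"
    and off: "\<And>z. z \<notin> D \<Longrightarrow> V z = 0"
    and inf: "\<And>z. cmod z \<ge> R \<Longrightarrow> V z \<le> 0"
  shows "V p \<le> 0"
proof (rule ccontr)
  assume "\<not> V p \<le> 0"
  then have Vp: "V p > 0" by simp
  then have pR: "cmod p < R" using inf[of p] by force
  then have R: "R > 0" using norm_ge_zero[of p] by linarith
  obtain vx vy vxx vxy vyx vyy where v: "open D"
    "\<And>z. z\<in>D \<Longrightarrow> (V has_derivative (\<lambda>w. vx z * Re w + vy z * Im w)) (at z)"
    "\<And>z. z\<in>D \<Longrightarrow> (vx has_derivative (\<lambda>w. vxx z * Re w + vxy z * Im w)) (at z)"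
    "\<And>z. z\<in>D \<Longrightarrow> (vy has_derivative (\<lambda>w. vyx z * Re w + vyy z * Im w)) (at z)"
    "\<And>z. z\<in>D \<Longrightarrow> vxx z + vyy z = 0"
    using harm unfolding harmonic_on_def by blast
  \<comment> \<open>The perturbation stays below half of \<open>V p\<close> on the ball, so the
    maximum point of \<open>W\<close> still has V > 0; hence it lies in \<open>D\<close> and
    strictly inside the ball.\<close>
  define d where "d = V p / (2 * R\<^sup>2)"
  have d: "d > 0" "d * R\<^sup>2 < V p" using Vp R by (auto simp: d_def)
  define W where "W z = V z + d * (cmod z)\<^sup>2" for z
  have "continuous_on (cball 0 R) W"
    unfolding W_def by (intro continuous_intros continuous_on_subset[OF cont]) auto
  then obtain q where q: "q \<in> cball 0 R" "\<And>z. z \<in> cball 0 R \<Longrightarrow> W z \<le> W q"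
    using continuous_attains_sup[of "cball (0::complex) R" W] R by auto
  have Wq: "W q > d * R\<^sup>2"
  proof -
    have "W p \<le> W q" using pR by (intro q) auto
    moreover have "W p \<ge> V p" using d by (simp add: W_def)
    ultimately show ?thesis using d by linarith
  qed
  have "V q > 0"
  proof -
    have "(cmod q)\<^sup>2 \<le> R\<^sup>2" using q(1) by (intro power_mono) auto
    then have "d * (cmod q)\<^sup>2 \<le> d * R\<^sup>2" using d(1) by simp
    then show ?thesis using Wq unfolding W_def by linarith
  qed
  then have qD: "q \<in> D" and qR: "cmod q < R" using off[of q] inf[of q] by force+
  have "open (D \<inter> ball 0 R)" using v(1) by auto
  then obtain e where e: "e > 0" "ball q e \<subseteq> D \<inter> ball 0 R"
    using qD qR by (metis IntI dist_0_norm mem_ball openE)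
  have mx: "W (q + z) \<le> W q" if "cmod z < e" for z
  proof -
    have "q + z \<in> ball q e" using that by (simp add: dist_norm)
    then show ?thesis using q(2)[of "q + z"] e(2) by auto
  qed
  have inD: "q + z \<in> D" if "cmod z < e" for z
    using e(2) that by (auto simp: subset_iff dist_norm)
  have W_line: "W (q + of_real s * b) = V (q + of_real s * b) + d * ((cmod q)\<^sup>2 + 2 * s * (q \<bullet> b) + s\<^sup>2)"
    if "cmod b = 1" for s b
  proof -
    have "(cmod (q + of_real s * b))\<^sup>2 = (cmod q)\<^sup>2 + 2 * s * (q \<bullet> b) + s\<^sup>2 * (cmod b)\<^sup>2"
      unfolding cmod_power2 by (simp add: inner_complex_def power2_eq_square algebra_simps)
    then show ?thesis using that by (simp add: W_def)
  qed
  have line: "((\<lambda>s. h (q + of_real s * b)) has_real_derivative (hx * Re b + hy * Im b)) (at s)"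
    if "(h has_derivative (\<lambda>w. hx * Re w + hy * Im w)) (at (q + of_real s * b))"
    for h :: "complex \<Rightarrow> real" and hx hy s b
  proof -
    have "((\<lambda>s. q + of_real s * b) has_derivative (\<lambda>t. of_real t * b)) (at s)"
      by (auto intro!: derivative_eq_intros)
    from diff_chain_at[OF this that]
    show ?thesis
      unfolding has_field_derivative_def o_def by (auto elim!: has_derivative_eq_rhs simp: algebra_simps)
  qed
  have key: "vxx q * (Re b)\<^sup>2 + (vxy q + vyx q) * (Re b * Im b) + vyy q * (Im b)\<^sup>2 + 2 * d \<le> 0"
    if b: "cmod b = 1" for b
  proof (rule ccontr)
    assume neg: "\<not> ?thesis"
    define f where "f s = V (q + of_real s * b) + d * ((cmod q)\<^sup>2 + 2 * s * (q \<bullet> b) + s\<^sup>2)" for s :: real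
    define f' where "f' s = (vx (q + of_real s * b) * Re b + vy (q + of_real s * b) * Im b) + d * (2 * (q \<bullet> b) + 2 * s)" for s :: real
    show False
    proof (rule no_local_max_if_second_deriv_pos[OF e(1), of f f'])
      fix s :: real assume s: "\<bar>s\<bar> < e"
      have D: "q + of_real s * b \<in> D" using s b by (intro inD) (simp add: norm_mult)
      show "(f has_real_derivative f' s) (at s)"
        unfolding f_def f'_def
        by (rule derivative_eq_intros line[OF v(2)[OF D]] refl | simp)+
      show "f s \<le> f 0"
        using mx[of "of_real s * b"] s b W_line[OF b, of s] W_line[OF b, of 0]
        by (simp add: f_def norm_mult)
    next
      have D: "q + of_real 0 * b \<in> D" using qD by simp
      show "(f' has_real_derivative (vxx q * Re b + vxy q * Im b) * Re b + (vyx q * Re b + vyy q * Im b) * Im b + d * 2) (at 0)"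
        unfolding f'_def
        using line[OF v(3)[OF D]] line[OF v(4)[OF D]]
        by (auto intro!: derivative_eq_intros)
      show "(vxx q * Re b + vxy q * Im b) * Re b + (vyx q * Re b + vyy q * Im b) * Im b + d * 2 > 0"
        using neg by (simp add: algebra_simps power2_eq_square)
    qed
  qed
  \<comment> \<open>In the two coordinate directions the mixed terms vanish. Adding both
    inequalities gives Laplacian + 4 d \<le> 0, although the Laplacian of \<open>V\<close> is
    0.\<close>
  from key[of 1] key[of \<i>] v(5)[OF qD] d(1) show False by simp
qed

text \<open>This is what gives the definite description in \<open>green_at_infinity\<close> a value.
  Two Green functions are only known to differ by a bounded amount near infinity, so one of them is
  multiplied by 1 + \<epsilon>: the surplus \<epsilon> ln |u| makes the difference negative far out,
  the maximum principle applies, and \<epsilon> tends to 0.\<close>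

lemma green_unique:
  assumes D: "bounded (- D)" and cl: "open D"
    and g1: "is_green_at_infinity D g1" and g2: "is_green_at_infinity D g2"
  shows "g1 = g2"
proof -
  \<comment> \<open>The boundary values 0 fit the extension by 0, so a Green function is continuous
    on the whole plane, as \<open>harmonic_le_zero\<close> requires.\<close>
  have cont: "continuous_on UNIV g" if g: "is_green_at_infinity D g" for g
  proof -
    have harm: "harmonic_on g D" and fr: "\<And>z. z \<in> frontier D \<Longrightarrow> (g \<longlongrightarrow> 0) (at z within D)"
      and off: "\<And>z. z \<notin> D \<Longrightarrow> g z = 0"
      using g unfolding is_green_at_infinity_def by auto
    have "isCont g z" for z
    proof (cases "z \<in> D")
      case True
      then show ?thesis
        using harm unfolding harmonic_on_def by (meson has_derivative_continuous)
    next
      case False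
      have 1: "(g \<longlongrightarrow> 0) (at z within D)"
      proof (cases "z \<in> frontier D")
        case False
        with \<open>z \<notin> D\<close> have "z \<notin> closure D"
          using cl by (auto simp: frontier_def interior_open)
        then have "at z within D = bot"
          by (metis Diff_iff Diff_subset closure_mono in_mono trivial_limit_within not_in_closure_trivial_limitI)
        then show ?thesis by simp
      qed (rule fr)
      have 2: "(g \<longlongrightarrow> 0) (at z within - D)"
        by (rule tendsto_eventually) (auto simp: eventually_at_filter off)
      have "(g \<longlongrightarrow> 0) (at z within D \<union> - D)"
        using 1 2 by (rule Lim_Un)
      then show ?thesis using off[OF \<open>z \<notin> D\<close>] by (simp add: isCont_def)
    qed
    then show ?thesis by (simp add: continuous_at_imp_continuous_on)
  qed
  have le: "g p \<le> h p" if g: "is_green_at_infinity D g" and h: "is_green_at_infinity D h" for g h p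
  proof -
    have "Bfun (\<lambda>u. g u - ln (cmod u)) at_infinity" "Bfun (\<lambda>u. h u - ln (cmod u)) at_infinity"
      using g h by (auto simp: is_green_at_infinity_def)
    then obtain K1 K2 where K: "\<forall>\<^sub>F u in at_infinity. \<bar>g u - ln (cmod u)\<bar> \<le> K1"
        "\<forall>\<^sub>F u in at_infinity. \<bar>h u - ln (cmod u)\<bar> \<le> K2"
      unfolding Bfun_def by auto
    have *: "g p \<le> (1 + \<epsilon>) * h p" if eps: "\<epsilon> > 0" for \<epsilon>
    proof -
      define V where "V z = 1 * g z + (- (1 + \<epsilon>)) * h z" for z
      \<comment> \<open>Beyond this radius \<epsilon> ln |u| outweighs the two bounded errors
        \<open>K1\<close> and \<open>(1 + \<epsilon>) * K2\<close> together.\<close>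
      have "\<forall>\<^sub>F u in at_infinity. cmod u \<ge> exp ((K1 + (1 + \<epsilon>) * K2) / \<epsilon>)"
        unfolding eventually_at_infinity by auto
      with K have "\<forall>\<^sub>F u in at_infinity. V u \<le> 0"
      proof eventually_elim
        case (elim u)
        have u: "cmod u > 0" using elim(3) exp_gt_zero less_le_trans by blast
        then have "ln (cmod u) \<ge> (K1 + (1 + \<epsilon>) * K2) / \<epsilon>"
          using elim(3) by (simp add: ln_ge_iff)
        then have "\<epsilon> * ln (cmod u) \<ge> K1 + (1 + \<epsilon>) * K2"
          using eps by (simp add: pos_divide_le_eq mult.commute)
        moreover have "(1 + \<epsilon>) * h u \<ge> (1 + \<epsilon>) * (ln (cmod u) - K2)"
          using elim(2) eps by (intro mult_left_mono) auto
        moreover have "g u \<le> ln (cmod u) + K1" using elim(1) by auto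
        ultimately show ?case by (simp add: V_def algebra_simps)
      qed
      then obtain R where R: "\<And>z. cmod z \<ge> R \<Longrightarrow> V z \<le> 0"
        unfolding eventually_at_infinity by auto
      have "V p \<le> 0"
      proof (rule harmonic_le_zero)
        show "harmonic_on V D" unfolding V_def
          using g h by (intro harmonic_on_lincomb) (auto simp: is_green_at_infinity_def)
        show "continuous_on UNIV V" unfolding V_def
          by (intro continuous_intros cont g h)
        show "V z = 0" if "z \<notin> D" for z
          using that g h by (auto simp: V_def is_green_at_infinity_def)
      qed (rule R)
      then show ?thesis by (simp add: V_def algebra_simps)
    qed
    show ?thesis
    proof (rule tendsto_lowerbound)
      show "((\<lambda>\<epsilon>. (1 + \<epsilon>) * h p) \<longlongrightarrow> h p) (at_right 0)"
        by (auto intro!: tendsto_eq_intros)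
      show "\<forall>\<^sub>F \<epsilon> in at_right 0. g p \<le> (1 + \<epsilon>) * h p"
        by (rule eventually_mono[OF eventually_at_right_less]) (rule *)
    qed simp
  qed
  show ?thesis using le[OF g1 g2] le[OF g2 g1] by (intro ext antisym)
qed

text \<open>Locally this is the real part of log h; the logarithmic derivative \<open>\<phi>\<close>
  avoids the choice of a branch. The gradient is (Re \<phi>, - Im \<phi>) and the second partial
  derivatives are read off the derivative of \<phi>, so the two terms of the Laplacian are
  opposite.\<close>

lemma harmonic_on_ln_cmod:
  assumes h: "h holomorphic_on S" and S: "open S" and nz: "\<And>z. z \<in> S \<Longrightarrow> h z \<noteq> 0"
  shows "harmonic_on (\<lambda>z. ln (cmod (h z))) S"
proof -
  define \<phi> where "\<phi> z = deriv h z / h z" for z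
  have hol: "\<phi> holomorphic_on S"
    unfolding \<phi>_def using h S nz by (intro holomorphic_intros holomorphic_deriv) auto
  have d\<phi>: "(\<phi> has_field_derivative deriv \<phi> z) (at z)" if "z \<in> S" for z
    using holomorphic_derivI[OF hol S that] .
  have cont: "continuous_on S (deriv \<phi>)"
    by (intro holomorphic_on_imp_continuous_on holomorphic_deriv hol S)
  have d1: "((\<lambda>z. ln (cmod (h z))) has_derivative (\<lambda>w. Re (\<phi> z) * Re w + - Im (\<phi> z) * Im w)) (at z)"
    if z: "z \<in> S" for z
  proof -
    have D: "(h has_derivative (\<lambda>w. deriv h z * w)) (at z)"
      using holomorphic_derivI[OF h S z] by (simp add: has_field_derivative_def)
    have "((\<lambda>z. ln (cmod (h z))) has_derivative
        (\<lambda>w. (1 / cmod (h z)) * ((deriv h z * w) \<bullet> sgn (h z)))) (at z)"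
      using nz[OF z]
      by (auto intro!: derivative_eq_intros D has_derivative_compose[OF D has_derivative_norm, unfolded o_def]
               simp: divide_simps)
    moreover have "(1 / cmod (h z)) * ((deriv h z * w) \<bullet> sgn (h z)) =
        Re (\<phi> z) * Re w + - Im (\<phi> z) * Im w" for w
    proof -
      have "\<phi> z * w = (deriv h z * w) * cnj (h z) / (cmod (h z))\<^sup>2"
        unfolding \<phi>_def times_divide_eq_left by (subst complex_div_cnj) simp
      then have "Re (\<phi> z * w) = Re ((deriv h z * w) * cnj (h z)) / (cmod (h z))\<^sup>2"
        by (metis Re_divide_of_real of_real_power)
      moreover have "(deriv h z * w) \<bullet> sgn (h z) = Re ((deriv h z * w) * cnj (h z)) / cmod (h z)"
        by (simp add: inner_complex_def sgn_div_norm algebra_simps divide_simps)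
      ultimately show ?thesis by (simp add: power2_eq_square)
    qed
    ultimately show ?thesis by simp
  qed
  have d2: "((\<lambda>z. Re (\<phi> z)) has_derivative (\<lambda>w. Re (deriv \<phi> z) * Re w + - Im (deriv \<phi> z) * Im w)) (at z)"
    and d3: "((\<lambda>z. - Im (\<phi> z)) has_derivative (\<lambda>w. - Im (deriv \<phi> z) * Re w + - Re (deriv \<phi> z) * Im w)) (at z)"
    if z: "z \<in> S" for z
    using d\<phi>[OF z] unfolding has_field_derivative_def
    by (auto intro!: derivative_eq_intros simp: algebra_simps)
  show ?thesis
    unfolding harmonic_on_def
    apply (intro conjI S)
    apply (rule exI[of _ "\<lambda>z. Re (\<phi> z)"], rule exI[of _ "\<lambda>z. - Im (\<phi> z)"])
    apply (rule exI[of _ "\<lambda>z. Re (deriv \<phi> z)"], rule exI[of _ "\<lambda>z. - Im (deriv \<phi> z)"])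
    apply (rule exI[of _ "\<lambda>z. - Im (deriv \<phi> z)"], rule exI[of _ "\<lambda>z. - Re (deriv \<phi> z)"])
    by (intro conjI ballI d1 d2 d3 continuous_intros cont; simp)
qed

section \<open>The arc as Moebius image of the extended negative axis\<close>

lemma circ_arc_iff:
  assumes "0 < \<alpha>" "\<alpha> < pi"
  shows "u \<in> circ_arc \<alpha> \<longleftrightarrow> cmod u = 1 \<and> cos \<alpha> \<le> Re u"
proof -
  have "- \<alpha> \<le> Arg u \<and> Arg u \<le> \<alpha> \<longleftrightarrow> cos \<alpha> \<le> Re u" if "cmod u = 1"
  proof -
    have Re: "Re u = cos \<bar>Arg u\<bar>"
      using arg_cong[OF rcis_cmod_Arg[of u], of Re] that by simp
    have "\<bar>Arg u\<bar> \<le> pi" using mpi_less_Arg[of u] Arg_le_pi[of u] by linarith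
    then have "cos \<alpha> \<le> cos \<bar>Arg u\<bar> \<longleftrightarrow> \<bar>Arg u\<bar> \<le> \<alpha>"
      using assms by (intro cos_mono_le_eq) auto
    then show ?thesis unfolding Re by linarith
  qed
  then show ?thesis by (auto simp: circ_arc_def)
qed

lemma compact_circ_arc:
  assumes "0 < \<alpha>" "\<alpha> < pi"
  shows "compact (circ_arc \<alpha>)"
proof -
  have "circ_arc \<alpha> = sphere 0 1 \<inter> {u. cos \<alpha> \<le> Re u}"
    by (simp add: circ_arc_iff[OF assms] set_eq_iff)
  moreover have "closed {u. cos \<alpha> \<le> Re u}"
    by (intro closed_Collect_le continuous_intros)
  ultimately show ?thesis by (simp add: compact_Int_closed)
qed

text \<open>With m = - p / q this is the inverse of m = (u cis \<alpha> - 1) / (u - cis \<alpha>),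
  so the extended negative axis lands on the arc. The homogeneous pair (p, q) covers the endpoint
  \<open>cis \<alpha>\<close>, where q = 0 and m is infinite, without a separate case.\<close>

lemma quotient_in_circ_arc:
  assumes a: "0 < \<alpha>" "\<alpha> < pi" and pq: "p \<ge> 0" "q \<ge> 0" "p + q > 0"
  defines "d \<equiv> of_real p + of_real q * cis \<alpha>"
  shows "d \<noteq> 0" "(of_real p * cis \<alpha> + of_real q) / d \<in> circ_arc \<alpha>"
proof -
  have s: "sin \<alpha> > 0" using a by (simp add: sin_gt_zero)
  have sq: "(cmod d)\<^sup>2 = p\<^sup>2 + q\<^sup>2 + 2 * p * q * cos \<alpha>"
    unfolding d_def cmod_power2 by (simp add: power2_sum power_mult_distrib sin_squared_eq algebra_simps)
  show d0: "d \<noteq> 0"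
  proof
    assume "d = 0"
    then have "q * sin \<alpha> = 0" "p + q * cos \<alpha> = 0" unfolding d_def complex_eq_iff by auto
    then show False using s pq by auto
  qed
  have cq: "cmod (of_real p * cis \<alpha> + of_real q) = cmod d"
  proof -
    have "of_real p * cis \<alpha> + of_real q = cis \<alpha> * cnj d"
      by (simp add: d_def algebra_simps cis_cnj cis_mult)
    then show ?thesis by (simp add: norm_mult)
  qed
  have Re: "Re ((of_real p * cis \<alpha> + of_real q) * cnj d) = (p\<^sup>2 + q\<^sup>2) * cos \<alpha> + 2 * p * q"
  proof -
    have "Re ((of_real p * cis \<alpha> + of_real q) * cnj d) =
        (p * cos \<alpha> + q) * (p + q * cos \<alpha>) + (p * sin \<alpha>) * (q * sin \<alpha>)"
      by (simp add: d_def)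
    also have "\<dots> = (p\<^sup>2 + q\<^sup>2) * cos \<alpha> + 2 * p * q"
      using sin_cos_squared_add[of \<alpha>] by algebra
    finally show ?thesis .
  qed
  have "(of_real p * cis \<alpha> + of_real q) / d = (of_real p * cis \<alpha> + of_real q) * cnj d / of_real ((cmod d)\<^sup>2)"
    by (subst complex_div_cnj) simp
  then have "Re ((of_real p * cis \<alpha> + of_real q) / d) = ((p\<^sup>2 + q\<^sup>2) * cos \<alpha> + 2 * p * q) / (cmod d)\<^sup>2"
    using Re by (metis Re_divide_of_real)
  moreover have "cos \<alpha> * (cmod d)\<^sup>2 \<le> (p\<^sup>2 + q\<^sup>2) * cos \<alpha> + 2 * p * q"
  proof -
    have "2 * p * q * (cos \<alpha>)\<^sup>2 \<le> 2 * p * q * 1"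
      using pq abs_square_le_1[of "cos \<alpha>"] by (intro mult_left_mono) auto
    then show ?thesis unfolding sq by (simp add: algebra_simps power2_eq_square)
  qed
  moreover have "(cmod d)\<^sup>2 > 0" using d0 by simp
  ultimately have "cos \<alpha> \<le> Re ((of_real p * cis \<alpha> + of_real q) / d)"
    by (metis pos_le_divide_eq)
  moreover have "cmod ((of_real p * cis \<alpha> + of_real q) / d) = 1"
    unfolding norm_divide cq using d0 by simp
  ultimately show "(of_real p * cis \<alpha> + of_real q) / d \<in> circ_arc \<alpha>"
    unfolding circ_arc_iff[OF a] by simp
qed

lemma circ_arc_conv_quotient:
  assumes a: "0 < \<alpha>" "\<alpha> < pi" and u: "u \<in> circ_arc \<alpha>"
  obtains p q where "p \<ge> 0" "q \<ge> 0" "p + q > 0"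
    "u = (of_real p * cis \<alpha> + of_real q) / (of_real p + of_real q * cis \<alpha>)"
proof -
  define \<phi> where "\<phi> = Arg u"
  have \<phi>: "-\<alpha> \<le> \<phi>" "\<phi> \<le> \<alpha>" and uc: "u = cis \<phi>"
    using u rcis_cmod_Arg[of u] by (auto simp: circ_arc_def \<phi>_def rcis_def)
  \<comment> \<open>Half the chords from \<open>u\<close> to the endpoints
    \<open>cis (- \<alpha>)\<close> and \<open>cis \<alpha>\<close>; away from
    \<open>cis \<alpha>\<close> their ratio is the modulus of the Moebius value at
    \<open>u\<close>.\<close>
  define p q where "p = sin ((\<alpha> + \<phi>) / 2)" and "q = sin ((\<alpha> - \<phi>) / 2)"
  have pq: "p \<ge> 0" "q \<ge> 0"
    unfolding p_def q_def using a \<phi> by (auto intro!: sin_ge_zero)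
  have "p + q > 0"
  proof (cases "\<phi> = \<alpha>")
    case True
    then have "p > 0" unfolding p_def using a by (intro sin_gt_zero) auto
    then show ?thesis using pq by simp
  next
    case False
    then have "q > 0" unfolding q_def using a \<phi> by (intro sin_gt_zero) auto
    then show ?thesis using pq by simp
  qed
  note pq = pq this
  have "u * (of_real p + of_real q * cis \<alpha>) = of_real p * cis \<alpha> + of_real q"
  proof -
    define x y where "x = (\<alpha> + \<phi>) / 2" and "y = (\<alpha> - \<phi>) / 2"
    have xy: "x + y = \<alpha>" "x - y = \<phi>" by (auto simp: x_def y_def field_simps)
    have "cis (x - y) * (of_real (sin x) + of_real (sin y) * cis (x + y)) =
      of_real (sin x) * cis (x + y) + of_real (sin y)"
    proof -
      have "\<i> * of_real (sin z) * 2 = cis z - inverse (cis z)" for z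
        by (simp add: complex_eq_iff)
      then have sn: "of_real (sin z) = (cis z - inverse (cis z)) / (2 * \<i>)" for z
        by (simp add: field_simps)
      have cxy: "cis (x - y) = cis x / cis y" "cis (x + y) = cis x * cis y"
        by (simp_all add: cis_divide cis_mult)
      have alg: "X / Y * ((X - inverse X) / (2 * \<i>) + (Y - inverse Y) / (2 * \<i>) * (X * Y)) =
          (X - inverse X) / (2 * \<i>) * (X * Y) + (Y - inverse Y) / (2 * \<i>)"
        if "X \<noteq> 0" "Y \<noteq> 0" for X Y :: complex
        using that by (simp add: field_simps)
      show ?thesis unfolding sn cxy by (rule alg) simp_all
    qed
    then show ?thesis unfolding xy unfolding uc p_def q_def x_def y_def .
  qed
  then have "u = (of_real p * cis \<alpha> + of_real q) / (of_real p + of_real q * cis \<alpha>)"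
    using quotient_in_circ_arc(1)[OF a pq] by (metis nonzero_eq_divide_eq)
  then show thesis using that pq by blast
qed

section \<open>The Green function of the complement of an arc\<close>

text \<open>The fourth power of \<open>lam\<close>. It sends \<open>cis (- \<alpha>)\<close> to 0,
  \<open>cis \<alpha>\<close> to infinity, the arc to the negative axis and infinity to
  \<open>cis \<alpha>\<close>. Its principal square root therefore maps the complement of the arc
  into the right half-plane, and infinity to \<open>cis (\<alpha>/2)\<close>.\<close>

definition arc_moebius :: "real \<Rightarrow> complex \<Rightarrow> complex" where
  "arc_moebius \<alpha> u = (u * cis \<alpha> - 1) / (u - cis \<alpha>)"

text \<open>The Green function of the right half-plane with pole at \<open>cis (\<alpha>/2)\<close>,
  pulled back by that square root; \<open>- cnj (cis (\<alpha>/2))\<close> is the pole reflected in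
  the imaginary axis.\<close>

definition arc_green :: "real \<Rightarrow> complex \<Rightarrow> real" where
  "arc_green \<alpha> u = (if u \<in> circ_arc \<alpha> then 0 else
     ln (cmod ((csqrt (arc_moebius \<alpha> u) + cnj (cis (\<alpha>/2))) / (csqrt (arc_moebius \<alpha> u) - cis (\<alpha>/2)))))"

lemma Re_csqrt_pos:
  assumes "z \<notin> \<real>\<^sub>\<le>\<^sub>0"
  shows "Re (csqrt z) > 0"
proof (rule ccontr)
  assume "\<not> ?thesis"
  then have "Re (csqrt z) = 0" using Re_csqrt[of z] by linarith
  then have "csqrt z = \<i> * of_real (Im (csqrt z))" by (simp add: complex_eq_iff del: csqrt.sel)
  then have "z = (\<i> * of_real (Im (csqrt z)))\<^sup>2" by (metis power2_csqrt)
  then have "z = of_real (- (Im (csqrt z))\<^sup>2)" by (simp add: power_mult_distrib del: csqrt.sel)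
  moreover have "of_real (- (Im (csqrt z))\<^sup>2) \<in> (\<real>\<^sub>\<le>\<^sub>0 :: complex set)"
    by (subst nonpos_Reals_of_real_iff) simp
  ultimately show False using assms by metis
qed

context
  fixes \<alpha> :: real
  assumes a: "0 < \<alpha>" "\<alpha> < pi"
begin

lemma cis_square_neq_1: "(cis \<alpha>)\<^sup>2 \<noteq> 1"
proof
  assume "(cis \<alpha>)\<^sup>2 = 1"
  then have "cis \<alpha> = 1 \<or> cis \<alpha> = -1" by (simp add: power2_eq_1_iff)
  then have "sin \<alpha> = 0" by (auto simp: complex_eq_iff)
  then show False using sin_gt_zero[OF a] by simp
qed

lemma cis_in_circ_arc: "cis \<alpha> \<in> circ_arc \<alpha>"
  using quotient_in_circ_arc(2)[OF a, of 1 0] by simp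

text \<open>If the value were r \<le> 0, solving for \<open>u\<close> would give the quotient with p
  = - r and q = 1, a point of the arc.\<close>

lemma arc_moebius_notin_nonpos_Reals:
  assumes u: "u \<notin> circ_arc \<alpha>"
  shows "arc_moebius \<alpha> u \<notin> \<real>\<^sub>\<le>\<^sub>0"
proof
  assume "arc_moebius \<alpha> u \<in> \<real>\<^sub>\<le>\<^sub>0"
  then obtain r where r: "r \<le> 0" "arc_moebius \<alpha> u = of_real r" by (elim nonpos_Reals_cases)
  have ne: "u - cis \<alpha> \<noteq> 0" using u cis_in_circ_arc by auto
  have "u * cis \<alpha> - 1 = of_real r * (u - cis \<alpha>)"
    using r(2) ne unfolding arc_moebius_def by (metis nonzero_eq_divide_eq)
  then have "u * (of_real (-r) + of_real 1 * cis \<alpha>) = of_real (-r) * cis \<alpha> + of_real 1"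
    by (simp add: algebra_simps)
  moreover have "-r \<ge> 0" "(1::real) \<ge> 0" "-r + 1 > 0" using r(1) by auto
  note q = quotient_in_circ_arc[OF a this]
  ultimately have "u = (of_real (-r) * cis \<alpha> + of_real 1) / (of_real (-r) + of_real 1 * cis \<alpha>)"
    by (subst nonzero_eq_divide_eq[OF q(1)])
  with q(2) u show False by simp
qed

lemma Re_cis_half_pos: "Re (cis (\<alpha>/2)) > 0"
  using a by (simp add: cos_gt_zero)

lemma cis_half_square: "(cis (\<alpha>/2))\<^sup>2 = cis \<alpha>"
  by (simp add: Complex.DeMoivre)

lemma csqrt_cis: "csqrt (cis \<alpha>) = cis (\<alpha>/2)"
  by (rule csqrt_unique) (use Re_cis_half_pos cis_half_square in auto)

lemma csqrt_arc_moebius_neq: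
  assumes u: "u \<notin> circ_arc \<alpha>"
  shows "csqrt (arc_moebius \<alpha> u) \<noteq> cis (\<alpha>/2)"
proof
  assume "csqrt (arc_moebius \<alpha> u) = cis (\<alpha>/2)"
  then have "arc_moebius \<alpha> u = cis \<alpha>" by (metis power2_csqrt cis_half_square)
  moreover have "u - cis \<alpha> \<noteq> 0" using u cis_in_circ_arc by auto
  ultimately have "u * cis \<alpha> - 1 = cis \<alpha> * (u - cis \<alpha>)"
    unfolding arc_moebius_def by (metis nonzero_eq_divide_eq)
  then show False using cis_square_neq_1 by (simp add: algebra_simps power2_eq_square)
qed

lemma harmonic_arc_green: "harmonic_on (arc_green \<alpha>) (- circ_arc \<alpha>)"
proof -
  define h where "h u = (csqrt (arc_moebius \<alpha> u) + cnj (cis (\<alpha>/2))) / (csqrt (arc_moebius \<alpha> u) - cis (\<alpha>/2))" for u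
  have op: "open (- circ_arc \<alpha>)"
    using compact_circ_arc[OF a] by (simp add: compact_imp_closed open_Compl)
  have m: "arc_moebius \<alpha> holomorphic_on (- circ_arc \<alpha>)"
    unfolding arc_moebius_def using cis_in_circ_arc by (intro holomorphic_intros) auto
  have hol: "h holomorphic_on (- circ_arc \<alpha>)"
    unfolding h_def using csqrt_arc_moebius_neq arc_moebius_notin_nonpos_Reals
    by (intro holomorphic_intros m) auto
  have nz: "h u \<noteq> 0" if "u \<in> - circ_arc \<alpha>" for u
  proof -
    have "Re (csqrt (arc_moebius \<alpha> u) + cnj (cis (\<alpha>/2))) > 0"
      using Re_csqrt_pos[OF arc_moebius_notin_nonpos_Reals[of u]] Re_cis_half_pos that
      by (simp del: csqrt.sel)
    then have "csqrt (arc_moebius \<alpha> u) + cnj (cis (\<alpha>/2)) \<noteq> 0" by force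
    then show ?thesis using csqrt_arc_moebius_neq[of u] that by (simp add: h_def)
  qed
  have "harmonic_on (\<lambda>u. ln (cmod (h u))) (- circ_arc \<alpha>)"
    by (rule harmonic_on_ln_cmod[OF hol op nz])
  then obtain hx hy hxx hxy hyx hyy where H:
     "\<forall>z\<in>- circ_arc \<alpha>. ((\<lambda>u. ln (cmod (h u))) has_derivative (\<lambda>w. hx z * Re w + hy z * Im w)) (at z) \<and>
             (hx has_derivative (\<lambda>w. hxx z * Re w + hxy z * Im w)) (at z) \<and>
             (hy has_derivative (\<lambda>w. hyx z * Re w + hyy z * Im w)) (at z)"
     "continuous_on (- circ_arc \<alpha>) hxx" "continuous_on (- circ_arc \<alpha>) hxy" "continuous_on (- circ_arc \<alpha>) hyx"
     "continuous_on (- circ_arc \<alpha>) hyy" "\<forall>z\<in>- circ_arc \<alpha>. hxx z + hyy z = 0"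
    unfolding harmonic_on_def by blast
  have "(arc_green \<alpha> has_derivative (\<lambda>w. hx z * Re w + hy z * Im w)) (at z)" if z: "z \<in> - circ_arc \<alpha>" for z
  proof (rule has_derivative_transform_within_open)
    show "((\<lambda>u. ln (cmod (h u))) has_derivative (\<lambda>w. hx z * Re w + hy z * Im w)) (at z)"
      using H(1) z by blast
    show "ln (cmod (h u)) = arc_green \<alpha> u" if "u \<in> - circ_arc \<alpha>" for u
      using that by (simp add: arc_green_def h_def)
  qed (use op z in auto)
  then have all: "\<forall>z\<in>- circ_arc \<alpha>. (arc_green \<alpha> has_derivative (\<lambda>w. hx z * Re w + hy z * Im w)) (at z) \<and>
             (hx has_derivative (\<lambda>w. hxx z * Re w + hxy z * Im w)) (at z) \<and>
             (hy has_derivative (\<lambda>w. hyx z * Re w + hyy z * Im w)) (at z)"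
    using H(1) by simp
  show ?thesis
    unfolding harmonic_on_def
    by (rule conjI[OF op], rule exI[of _ hx], rule exI[of _ hy], rule exI[of _ hxx], rule exI[of _ hxy],
        rule exI[of _ hyx], rule exI[of _ hyy]) (intro conjI all H(2-6))
qed

lemma arc_green_boundary:
  assumes b: "b \<in> circ_arc \<alpha>"
  shows "(arc_green \<alpha> \<longlongrightarrow> 0) (at b within - circ_arc \<alpha>)"
proof -
  define c where "c = Re (cis (\<alpha>/2))"
  have c: "c > 0" using Re_cis_half_pos by (simp add: c_def)
  define \<zeta> where "\<zeta> u = csqrt (arc_moebius \<alpha> u)" for u
  define q where "q u = 4 * Re (\<zeta> u) * c / (cmod (\<zeta> u - cis (\<alpha>/2)))\<^sup>2" for u
  have q0: "q u \<ge> 0" for u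
    using c Re_csqrt[of "arc_moebius \<alpha> u"] by (simp add: q_def \<zeta>_def del: csqrt.sel)
  have green: "arc_green \<alpha> u = ln (1 + q u) / 2" if u: "u \<in> - circ_arc \<alpha>" for u
  proof -
    have ne: "cmod (\<zeta> u - cis (\<alpha>/2)) > 0"
      using csqrt_arc_moebius_neq[of u] u by (simp add: \<zeta>_def)
    have "(cmod (\<zeta> u + cnj (cis (\<alpha>/2))))\<^sup>2 = (cmod (\<zeta> u - cis (\<alpha>/2)))\<^sup>2 + 4 * Re (\<zeta> u) * c"
      unfolding cmod_power2 c_def by (simp add: power2_eq_square algebra_simps)
    then have eq: "(cmod ((\<zeta> u + cnj (cis (\<alpha>/2))) / (\<zeta> u - cis (\<alpha>/2))))\<^sup>2 = 1 + q u"
      using ne unfolding q_def norm_divide power_divide by (simp add: add_divide_distrib)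
    define X where "X = cmod ((\<zeta> u + cnj (cis (\<alpha>/2))) / (\<zeta> u - cis (\<alpha>/2)))"
    have X2: "X\<^sup>2 = 1 + q u" using eq by (simp add: X_def)
    have "X \<noteq> 0" using X2 q0[of u] by auto
    then have "X > 0" by (simp add: X_def)
    then have "ln (1 + q u) = 2 * ln X"
      unfolding X2[symmetric] by (simp add: ln_realpow)
    then have "ln (1 + q u) = 2 * ln (cmod ((\<zeta> u + cnj (cis (\<alpha>/2))) / (\<zeta> u - cis (\<alpha>/2))))"
      by (simp add: X_def)
    then show ?thesis using u by (simp add: arc_green_def \<zeta>_def)
  qed
  have "(q \<longlongrightarrow> 0) (at b within - circ_arc \<alpha>)"
  proof (cases "b = cis \<alpha>")
    case False
    obtain p r where pr: "p \<ge> 0" "r \<ge> 0" "p + r > 0"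
      and bq: "b = (of_real p * cis \<alpha> + of_real r) / (of_real p + of_real r * cis \<alpha>)"
      using circ_arc_conv_quotient[OF a b] .
    define d where "d = of_real p + of_real r * cis \<alpha>"
    have d: "d \<noteq> 0" "b * d = of_real p * cis \<alpha> + of_real r"
      using quotient_in_circ_arc(1)[OF a pr] bq by (auto simp: d_def)
    have r: "r \<noteq> 0" using False d by (auto simp: d_def)
    have "arc_moebius \<alpha> b = of_real (- p / r)"
    proof -
      have "(b * cis \<alpha> - 1) * d = (b * d) * cis \<alpha> - d" "(b - cis \<alpha>) * d = b * d - cis \<alpha> * d"
        by (simp_all add: algebra_simps)
      then have e: "(b * cis \<alpha> - 1) * d = of_real (- p) * (1 - (cis \<alpha>)\<^sup>2)"
          "(b - cis \<alpha>) * d = of_real r * (1 - (cis \<alpha>)\<^sup>2)"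
        unfolding d(2) by (simp_all add: d_def algebra_simps power2_eq_square)
      have "arc_moebius \<alpha> b = ((b * cis \<alpha> - 1) * d) / ((b - cis \<alpha>) * d)"
        using d(1) by (simp add: arc_moebius_def)
      also have "\<dots> = of_real (- p) / of_real r"
        unfolding e using cis_square_neq_1 by simp
      finally show ?thesis by simp
    qed
    then have mb: "cmod (arc_moebius \<alpha> b) + Re (arc_moebius \<alpha> b) = 0"
      using pr by (simp add: norm_divide)
    have cm: "(arc_moebius \<alpha> \<longlongrightarrow> arc_moebius \<alpha> b) (at b within - circ_arc \<alpha>)"
      unfolding arc_moebius_def using False by (intro tendsto_intros) auto
    have "((\<lambda>u. sqrt ((cmod (arc_moebius \<alpha> u) + Re (arc_moebius \<alpha> u)) / 2)) \<longlongrightarrow>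
        sqrt ((cmod (arc_moebius \<alpha> b) + Re (arc_moebius \<alpha> b)) / 2)) (at b within - circ_arc \<alpha>)"
      by (intro tendsto_intros cm) auto
    then have R: "((\<lambda>u. Re (\<zeta> u)) \<longlongrightarrow> 0) (at b within - circ_arc \<alpha>)"
      unfolding mb by (simp add: \<zeta>_def)
    have "((\<lambda>u. 4 * Re (\<zeta> u) * c / (c - Re (\<zeta> u))\<^sup>2) \<longlongrightarrow> 4 * 0 * c / (c - 0)\<^sup>2) (at b within - circ_arc \<alpha>)"
      using c by (intro tendsto_intros R) auto
    then have lim: "((\<lambda>u. 4 * Re (\<zeta> u) * c / (c - Re (\<zeta> u))\<^sup>2) \<longlongrightarrow> 0) (at b within - circ_arc \<alpha>)" by simp
    have "\<forall>\<^sub>F u in at b within - circ_arc \<alpha>. Re (\<zeta> u) < c"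
      using order_tendstoD(2)[OF R c] .
    then have "\<forall>\<^sub>F u in at b within - circ_arc \<alpha>. q u \<le> 4 * Re (\<zeta> u) * c / (c - Re (\<zeta> u))\<^sup>2"
    proof eventually_elim
      case (elim u)
      \<comment> \<open>The real parts alone keep \<open>\<zeta> u\<close> away from
        \<open>cis (\<alpha>/2)\<close>; the imaginary part, which jumps across the arc, does not
        enter.\<close>
      have "(c - Re (\<zeta> u))\<^sup>2 = (Re (\<zeta> u - cis (\<alpha>/2)))\<^sup>2" by (simp add: c_def power2_commute)
      also have "\<dots> \<le> (cmod (\<zeta> u - cis (\<alpha>/2)))\<^sup>2"
        by (metis abs_Re_le_cmod abs_le_square_iff abs_norm_cancel)
      finally have le: "(c - Re (\<zeta> u))\<^sup>2 \<le> (cmod (\<zeta> u - cis (\<alpha>/2)))\<^sup>2" .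
      have pos: "(c - Re (\<zeta> u))\<^sup>2 > 0" using elim by simp
      have "4 * Re (\<zeta> u) * c \<ge> 0"
        using c Re_csqrt[of "arc_moebius \<alpha> u"] unfolding \<zeta>_def by (intro mult_nonneg_nonneg) auto
      then show ?case unfolding q_def
        by (rule divide_left_mono[OF le _ mult_pos_pos[OF less_le_trans[OF pos le] pos]])
    qed
    then show ?thesis
      by (rule tendsto_sandwich[OF _ _ tendsto_const lim, rotated]) (simp add: q0)
  next
    case True
    \<comment> \<open>Since |\<zeta>| = sqrt |m| and \<open>cis (\<alpha>/2)\<close> is a unit
      vector, \<open>x u\<close> bounds their distance from below. Thus \<open>q\<close> is at most
      of order 1 / x near the endpoint.\<close>
    define x where "x u = sqrt (cmod (arc_moebius \<alpha> u)) - 1" for u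
    have "filterlim (\<lambda>u. arc_moebius \<alpha> u) at_infinity (at b within - circ_arc \<alpha>)"
      unfolding arc_moebius_def True
    proof (rule filterlim_divide_at_infinity)
      show "((\<lambda>u. u * cis \<alpha> - 1) \<longlongrightarrow> cis \<alpha> * cis \<alpha> - 1) (at (cis \<alpha>) within - circ_arc \<alpha>)"
        by (intro tendsto_intros)
      show "filterlim (\<lambda>u. u - cis \<alpha>) (at 0) (at (cis \<alpha>) within - circ_arc \<alpha>)"
        by (rule filterlim_atI) (auto intro!: tendsto_eq_intros simp: eventually_at_filter)
      show "cis \<alpha> * cis \<alpha> - 1 \<noteq> 0" using cis_square_neq_1 by (simp add: power2_eq_square)
    qed
    then have "filterlim (\<lambda>u. cmod (arc_moebius \<alpha> u)) at_top (at b within - circ_arc \<alpha>)"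
      by (simp add: filterlim_at_infinity_conv_norm_at_top)
    then have X: "filterlim x at_top (at b within - circ_arc \<alpha>)"
      unfolding x_def
      by (intro filterlim_tendsto_add_at_top[of "\<lambda>_. -1" "-1", simplified, unfolded uminus_add_conv_diff]
          filterlim_compose[OF sqrt_at_top])
    have I: "((\<lambda>u. inverse (x u)) \<longlongrightarrow> 0) (at b within - circ_arc \<alpha>)"
      by (rule tendsto_inverse_0_at_top[OF X])
    have "((\<lambda>u. 4 * c * (inverse (x u) * (1 + inverse (x u)))) \<longlongrightarrow> 4 * c * (0 * (1 + 0))) (at b within - circ_arc \<alpha>)"
      by (intro tendsto_intros I)
    then have lim: "((\<lambda>u. 4 * c * (inverse (x u) * (1 + inverse (x u)))) \<longlongrightarrow> 0) (at b within - circ_arc \<alpha>)" by simp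
    have "\<forall>\<^sub>F u in at b within - circ_arc \<alpha>. x u > 0"
      using X by (simp add: filterlim_at_top_dense)
    then have "\<forall>\<^sub>F u in at b within - circ_arc \<alpha>. q u \<le> 4 * c * (inverse (x u) * (1 + inverse (x u)))"
    proof eventually_elim
      case (elim u)
      have z: "cmod (\<zeta> u) = x u + 1" by (simp add: \<zeta>_def x_def del: csqrt.sel)
      have "x u \<le> cmod (\<zeta> u - cis (\<alpha>/2))"
        using norm_triangle_ineq2[of "\<zeta> u" "cis (\<alpha>/2)"] z by simp
      then have 1: "(x u)\<^sup>2 \<le> (cmod (\<zeta> u - cis (\<alpha>/2)))\<^sup>2" using elim by (intro power_mono) auto
      have "q u \<le> 4 * (x u + 1) * c / (x u)\<^sup>2"
        unfolding q_def using complex_Re_le_cmod[of "\<zeta> u"] z elim c 1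
        by (intro frac_le) auto
      also have "\<dots> = 4 * c * (inverse (x u) * (1 + inverse (x u)))"
        using elim by (simp add: field_simps power2_eq_square)
      finally show ?case .
    qed
    then show ?thesis
      by (rule tendsto_sandwich[OF _ _ tendsto_const lim, rotated]) (simp add: q0)
  qed
  then have "((\<lambda>u. ln (1 + q u) / 2) \<longlongrightarrow> ln (1 + 0) / 2) (at b within - circ_arc \<alpha>)"
    by (intro tendsto_intros) auto
  then have "((\<lambda>u. ln (1 + q u) / 2) \<longlongrightarrow> 0) (at b within - circ_arc \<alpha>)" by simp
  then show ?thesis
    by (rule Lim_transform_eventually) (simp add: eventually_at_filter green)
qed

text \<open>With \<xi> = \<open>cis (\<alpha>/2)\<close>, the product (\<zeta> - \<xi>) (\<zeta> +
  \<xi>) equals m - cis \<alpha> = ((cis \<alpha>)^2 - 1) / (u - cis \<alpha>), a simple zero at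
  infinity. So the quotient inside the logarithm is u times a factor \<open>Q\<close> with the
  nonzero limit \<open>L\<close>.\<close>

lemma arc_green_at_infinity: "Bfun (\<lambda>u. arc_green \<alpha> u - ln (cmod u)) at_infinity"
proof -
  define L where "L = (cis (\<alpha>/2) + cnj (cis (\<alpha>/2))) * (cis (\<alpha>/2) + cis (\<alpha>/2)) * 1 / ((cis \<alpha>)\<^sup>2 - 1)"
  define \<zeta> where "\<zeta> u = csqrt (arc_moebius \<alpha> u)" for u
  define Q where "Q u = (\<zeta> u + cnj (cis (\<alpha>/2))) * (\<zeta> u + cis (\<alpha>/2)) * (1 - cis \<alpha> * inverse u) / ((cis \<alpha>)\<^sup>2 - 1)" for u
  have inv: "(inverse \<longlongrightarrow> (0::complex)) at_infinity" by (rule tendsto_inverse_0)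
  have nA: "\<forall>\<^sub>F u in at_infinity. u \<notin> circ_arc \<alpha>" "\<forall>\<^sub>F u in at_infinity. u \<noteq> (0::complex)"
    unfolding eventually_at_infinity by (auto intro!: exI[of _ 2] simp: circ_arc_def)
  have m: "(arc_moebius \<alpha> \<longlongrightarrow> cis \<alpha>) at_infinity"
  proof (rule Lim_transform_eventually)
    have "((\<lambda>u. (cis \<alpha> - inverse u) / (1 - cis \<alpha> * inverse u)) \<longlongrightarrow> (cis \<alpha> - 0) / (1 - cis \<alpha> * 0)) at_infinity"
      by (intro tendsto_intros inv) auto
    then show "((\<lambda>u. (cis \<alpha> - inverse u) / (1 - cis \<alpha> * inverse u)) \<longlongrightarrow> cis \<alpha>) at_infinity" by simp
    show "\<forall>\<^sub>F u in at_infinity. (cis \<alpha> - inverse u) / (1 - cis \<alpha> * inverse u) = arc_moebius \<alpha> u"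
      using nA
    proof eventually_elim
      case (elim u)
      have "(cis \<alpha> - inverse u) * u / ((1 - cis \<alpha> * inverse u) * u) = (cis \<alpha> - inverse u) / (1 - cis \<alpha> * inverse u)"
        using elim(2) by simp
      moreover have "(cis \<alpha> - inverse u) * u = u * cis \<alpha> - 1" "(1 - cis \<alpha> * inverse u) * u = u - cis \<alpha>"
        using elim(2) by (simp_all add: algebra_simps)
      ultimately show ?case unfolding arc_moebius_def by metis
    qed
  qed
  have "cis \<alpha> \<notin> \<real>\<^sub>\<le>\<^sub>0"
    using sin_gt_zero[OF a] by (auto simp: complex_nonpos_Reals_iff)
  then have \<zeta>: "(\<zeta> \<longlongrightarrow> cis (\<alpha>/2)) at_infinity"
    unfolding \<zeta>_def csqrt_cis[symmetric] by (intro isCont_tendsto_compose[OF continuous_at_csqrt] m)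
  have "(Q \<longlongrightarrow> (cis (\<alpha>/2) + cnj (cis (\<alpha>/2))) * (cis (\<alpha>/2) + cis (\<alpha>/2)) * (1 - cis \<alpha> * 0) / ((cis \<alpha>)\<^sup>2 - 1)) at_infinity"
    unfolding Q_def using cis_square_neq_1 by (intro tendsto_intros \<zeta> inv) auto
  then have QL: "(Q \<longlongrightarrow> L) at_infinity" by (simp add: L_def)
  have "Re (cis (\<alpha>/2) + cnj (cis (\<alpha>/2))) \<noteq> 0" using Re_cis_half_pos by simp
  then have "cis (\<alpha>/2) + cnj (cis (\<alpha>/2)) \<noteq> 0" by force
  then have L: "L \<noteq> 0" using cis_square_neq_1 by (simp add: L_def)
  have "((\<lambda>u. ln (cmod (Q u))) \<longlongrightarrow> ln (cmod L)) at_infinity"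
    using L by (intro tendsto_intros QL) auto
  moreover have "\<forall>\<^sub>F u in at_infinity. ln (cmod (Q u)) = arc_green \<alpha> u - ln (cmod u)"
    using nA tendsto_imp_eventually_ne[OF QL L]
  proof eventually_elim
    case (elim u)
    have ne: "u - cis \<alpha> \<noteq> 0" using elim(1) cis_in_circ_arc by auto
    have zn: "\<zeta> u - cis (\<alpha>/2) \<noteq> 0" using csqrt_arc_moebius_neq[OF elim(1)] by (simp add: \<zeta>_def)
    have "(\<zeta> u - cis (\<alpha>/2)) * (\<zeta> u + cis (\<alpha>/2)) = arc_moebius \<alpha> u - cis \<alpha>"
    proof -
      have "(\<zeta> u - cis (\<alpha>/2)) * (\<zeta> u + cis (\<alpha>/2)) = (\<zeta> u)\<^sup>2 - (cis (\<alpha>/2))\<^sup>2"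
        by (simp add: algebra_simps power2_eq_square)
      then show ?thesis unfolding cis_half_square unfolding \<zeta>_def power2_csqrt .
    qed
    also have "\<dots> * (u - cis \<alpha>) = (cis \<alpha>)\<^sup>2 - 1"
    proof -
      have "arc_moebius \<alpha> u * (u - cis \<alpha>) = u * cis \<alpha> - 1"
        using ne by (simp add: arc_moebius_def)
      then show ?thesis unfolding left_diff_distrib by (simp add: algebra_simps power2_eq_square)
    qed
    finally have e1: "(\<zeta> u - cis (\<alpha>/2)) * (\<zeta> u + cis (\<alpha>/2)) * (u - cis \<alpha>) = (cis \<alpha>)\<^sup>2 - 1" .
    have e2: "(1 - cis \<alpha> * inverse u) * u = u - cis \<alpha>" using elim(2) by (simp add: algebra_simps)
    have "Q u * u * ((cis \<alpha>)\<^sup>2 - 1) = (\<zeta> u + cnj (cis (\<alpha>/2))) * (\<zeta> u + cis (\<alpha>/2)) * (u - cis \<alpha>)"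
      using cis_square_neq_1 unfolding Q_def e2[symmetric] by simp
    then have "(Q u * u * ((cis \<alpha>)\<^sup>2 - 1)) * (\<zeta> u - cis (\<alpha>/2)) =
        (\<zeta> u + cnj (cis (\<alpha>/2))) * ((\<zeta> u - cis (\<alpha>/2)) * (\<zeta> u + cis (\<alpha>/2)) * (u - cis \<alpha>))"
      by (simp only: mult_ac)
    then have "(Q u * u) * (\<zeta> u - cis (\<alpha>/2)) * ((cis \<alpha>)\<^sup>2 - 1) = (\<zeta> u + cnj (cis (\<alpha>/2))) * ((cis \<alpha>)\<^sup>2 - 1)"
      unfolding e1 by (simp only: mult_ac)
    then have "(Q u * u) * (\<zeta> u - cis (\<alpha>/2)) = \<zeta> u + cnj (cis (\<alpha>/2))"
      using cis_square_neq_1 by simp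
    then have "Q u * u = (\<zeta> u + cnj (cis (\<alpha>/2))) / (\<zeta> u - cis (\<alpha>/2))"
      using zn by (simp add: nonzero_eq_divide_eq)
    then have "arc_green \<alpha> u = ln (cmod (Q u * u))"
      using elim(1) by (simp add: arc_green_def \<zeta>_def)
    then show ?case using elim(2,3) by (simp add: norm_mult ln_mult)
  qed
  ultimately have "((\<lambda>u. arc_green \<alpha> u - ln (cmod u)) \<longlongrightarrow> ln (cmod L)) at_infinity"
    by (rule Lim_transform_eventually)
  then have "\<forall>\<^sub>F u in at_infinity. dist (arc_green \<alpha> u - ln (cmod u)) (ln (cmod L)) < 1"
    by (rule tendstoD) simp
  then show ?thesis
    unfolding Bfun_metric_def
    by (intro exI[of _ "ln (cmod L)"] exI[of _ 1]) (auto elim: eventually_mono)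
qed

lemma green_at_infinity_arc: "green_at_infinity (- circ_arc \<alpha>) = arc_green \<alpha>"
proof -
  have op: "open (- circ_arc \<alpha>)" and cl: "closed (circ_arc \<alpha>)" and bd: "bounded (- (- circ_arc \<alpha>))"
    using compact_circ_arc[OF a] by (auto simp: compact_imp_closed compact_imp_bounded)
  have "frontier (- circ_arc \<alpha>) \<subseteq> circ_arc \<alpha>"
    using cl by (simp add: frontier_complement frontier_subset_closed)
  then have g: "is_green_at_infinity (- circ_arc \<alpha>) (arc_green \<alpha>)"
    unfolding is_green_at_infinity_def
    using harmonic_arc_green arc_green_at_infinity arc_green_boundary
    by (auto simp: arc_green_def)
  show ?thesis unfolding green_at_infinity_def
    using g green_unique[OF bd op _ g] by (rule the_equality)
qed

end

section \<open>Means over the unit circle\<close>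

definition circle_mean :: "(complex \<Rightarrow> complex) \<Rightarrow> complex" where
  "circle_mean g = integral {0..2*pi} (\<lambda>x. g (cis x)) / (2 * pi)"

lemma circle_mean_integrable:
  fixes g :: "complex \<Rightarrow> 'a::banach"
  assumes "continuous_on (sphere 0 1) g"
  shows "(\<lambda>x. g (cis x)) integrable_on {0..2*pi}"
proof (rule integrable_continuous_real)
  show "continuous_on {0..2*pi} (\<lambda>x. g (cis x))"
    by (rule continuous_on_compose2[OF assms]) (auto intro!: continuous_intros)
qed

lemma circle_mean_cong:
  assumes "\<And>z. cmod z = 1 \<Longrightarrow> f z = g z"
  shows "circle_mean f = circle_mean g"
  unfolding circle_mean_def using assms by simp

lemma circle_mean_cmult: "circle_mean (\<lambda>z. c * g z) = c * circle_mean g"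
  by (simp add: circle_mean_def)

lemma circle_mean_add:
  assumes "continuous_on (sphere 0 1) f" "continuous_on (sphere 0 1) g"
  shows "circle_mean (\<lambda>z. f z + g z) = circle_mean f + circle_mean g"
  using circle_mean_integrable[OF assms(1)] circle_mean_integrable[OF assms(2)]
  by (simp add: circle_mean_def integral_add add_divide_distrib)

lemma circle_mean_sum:
  assumes "finite I" "\<And>i. i \<in> I \<Longrightarrow> continuous_on (sphere 0 1) (f i)"
  shows "circle_mean (\<lambda>z. \<Sum>i\<in>I. f i z) = (\<Sum>i\<in>I. circle_mean (f i))"
  using assms circle_mean_integrable[OF assms(2)]
  by (simp add: circle_mean_def integral_sum sum_divide_distrib)

text \<open>Reflection and periodicity. On the circle \<open>cnj z\<close> is 1/z, so this change of
  variable exchanges the two sides of the arc.\<close>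

lemma circle_mean_of_cnj: "circle_mean (\<lambda>z. g (cnj z)) = circle_mean g"
proof -
  have "integral {0..2*pi} (\<lambda>x. g (cis (- x))) = integral {- (2*pi)..- 0} (\<lambda>x. g (cis x))"
    using Henstock_Kurzweil_Integration.integral_reflect_real[of "2*pi" 0 "\<lambda>x. g (cis x)"]
      Henstock_Kurzweil_Integration.integral_reflect_real[of 0 "- (2*pi)" "\<lambda>x. g (cis x)"] by simp
  also have "\<dots> = integral {0..2*pi} (\<lambda>x. g (cis x))"
  proof -
    have "integral {0 - 2*pi..2*pi - 2*pi} (\<lambda>x. g (cis (x + 2*pi))) = integral {0..2*pi} (\<lambda>x. g (cis x))"
      by (rule integral_shift_real_ivl)
    moreover have "cis (x + 2*pi) = cis x" for x by (simp add: complex_eq_iff)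
    ultimately show ?thesis by simp
  qed
  finally show ?thesis by (simp add: circle_mean_def cis_cnj)
qed

lemma cnj_circle_mean:
  assumes "continuous_on (sphere 0 1) f"
  shows "circle_mean (\<lambda>z. cnj (f z)) = cnj (circle_mean f)"
  using integral_linear[OF circle_mean_integrable[OF assms] bounded_linear_cnj]
  by (simp add: circle_mean_def o_def)

lemma norm_circle_mean_le:
  assumes f: "continuous_on (sphere 0 1) f" and p: "continuous_on (sphere 0 1) p"
    and le: "\<And>z. cmod z = 1 \<Longrightarrow> cmod (f z) \<le> p z"
  shows "cmod (circle_mean f) \<le> Re (circle_mean (\<lambda>z. of_real (p z)))"
proof -
  have 1: "(\<lambda>x. f (cis x)) integrable_on {0..2*pi}" by (rule circle_mean_integrable[OF f])
  have 2: "(\<lambda>x. p (cis x)) integrable_on {0..2*pi}" by (rule circle_mean_integrable[OF p])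
  have "cmod (integral {0..2*pi} (\<lambda>x. f (cis x))) \<le> integral {0..2*pi} (\<lambda>x. p (cis x))"
    by (rule integral_norm_bound_integral[OF 1 2]) (simp add: le)
  moreover have "integral {0..2*pi} (\<lambda>x. complex_of_real (p (cis x))) = of_real (integral {0..2*pi} (\<lambda>x. p (cis x)))"
    using integral_linear[OF 2 bounded_linear_of_real] by (simp add: o_def)
  moreover from this have "circle_mean (\<lambda>z. of_real (p z)) = of_real (integral {0..2*pi} (\<lambda>x. p (cis x)) / (2*pi))"
    by (simp add: circle_mean_def)
  moreover have "cmod (circle_mean f) = cmod (integral {0..2*pi} (\<lambda>x. f (cis x))) / (2*pi)"
    by (simp add: circle_mean_def norm_divide norm_mult)
  ultimately show ?thesis by (simp only: Re_complex_of_real) (simp add: divide_right_mono)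
qed

lemma circle_mean_Cauchy:
  assumes "continuous_on (cball 0 1) f" "f holomorphic_on ball 0 1" "cmod w < 1"
  shows "circle_mean (\<lambda>z. f z * z / (z - w)) = f w"
proof -
  have "((\<lambda>u. f u / (u-w)) has_contour_integral (2 * of_real pi * \<i> * f w)) (part_circlepath 0 1 0 (2*pi))"
    using Cauchy_integral_circlepath[OF assms(1,2), of w] assms(3) by (simp add: circlepath_def)
  then have "((\<lambda>t. f (cis t) / (cis t - w) * \<i> * cis t) has_integral (2 * of_real pi * \<i> * f w)) {0..2*pi}"
    by (subst (asm) has_contour_integral_part_circlepath_iff) simp_all
  from has_integral_mult_right[OF this, of "-\<i>"]
  have "((\<lambda>t. f (cis t) * cis t / (cis t - w)) has_integral (2 * of_real pi * f w)) {0..2*pi}"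
    by (simp add: mult_ac)
  then show ?thesis by (simp add: circle_mean_def integral_unique)
qed

text \<open>The mean is the k-th Taylor coefficient at 0. It is estimated on the radius 1/2 because
  powers of \<beta> have modulus 1 on the unit circle but are exponentially small there; the price
  is 2 ^ k.\<close>

lemma circle_mean_coeff_le:
  assumes f: "continuous_on (cball 0 1) f" "f holomorphic_on ball 0 1"
    and K: "\<And>z. cmod z = 1/2 \<Longrightarrow> cmod (f z) \<le> K"
  shows "cmod (circle_mean (\<lambda>z. f z / z ^ k)) \<le> K * 2 ^ k"
proof -
  have "((\<lambda>u. f u / (u-0)^Suc k) has_contour_integral (2 * pi * \<i> / fact k * (deriv ^^ k) f 0)) (part_circlepath 0 1 0 (2*pi))"
    using Cauchy_has_contour_integral_higher_derivative_circlepath[OF f, of 0 k]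
    by (simp add: circlepath_def)
  then have "((\<lambda>t. f (cis t) / (cis t)^Suc k * \<i> * cis t) has_integral (2 * pi * \<i> / fact k * (deriv ^^ k) f 0)) {0..2*pi}"
    by (subst (asm) has_contour_integral_part_circlepath_iff) simp_all
  from has_integral_mult_right[OF this, of "-\<i>"]
  have "((\<lambda>t. f (cis t) / (cis t)^k) has_integral (2 * pi * (deriv ^^ k) f 0 / fact k)) {0..2*pi}"
    by (simp add: mult_ac)
  then have eq: "circle_mean (\<lambda>z. f z / z ^ k) = (deriv ^^ k) f 0 / fact k"
    by (simp add: circle_mean_def integral_unique)
  have "cmod ((deriv ^^ k) f 0) \<le> fact k * K / (1/2) ^ k"
  proof (rule Cauchy_inequality)
    show "f holomorphic_on ball 0 (1/2)" by (rule holomorphic_on_subset[OF f(2)]) auto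
    show "continuous_on (cball 0 (1/2)) f" by (rule continuous_on_subset[OF f(1)]) auto
  qed (use K in auto)
  then have "cmod ((deriv ^^ k) f 0) / fact k \<le> (fact k * K / (1/2) ^ k) / fact k"
    by (rule divide_right_mono) simp
  then show ?thesis unfolding eq norm_divide by (simp add: power_divide)
qed

text \<open>The shape of an expanded Fejer sum: entry (i, j) carries the harmonic i - j, and only
  the indices 0 and -1 contribute main terms.\<close>

lemma sum_norm_near_two_diagonals:
  fixes A :: "nat \<Rightarrow> nat \<Rightarrow> complex"
  assumes diag: "\<And>i. A i i = X" "\<And>i. A i (Suc i) = Y"
    and rest: "\<And>i j. i < N \<Longrightarrow> j < N \<Longrightarrow> i \<noteq> j \<Longrightarrow> j \<noteq> Suc i \<Longrightarrow> cmod (A i j) \<le> e"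
    and e: "e \<ge> 0"
  shows "cmod ((\<Sum>i<N. \<Sum>j<N. A i j) - (of_nat N * X + of_nat (N - 1) * Y)) \<le> (real N)\<^sup>2 * e"
proof -
  have "(\<Sum>i<N. \<Sum>j<N. if j = Suc i then Y else 0) = of_nat (N - 1) * Y"
  proof (cases N)
    case (Suc M)
    \<comment> \<open>The last row has its superdiagonal entry outside the square, hence N - 1 and
      not N.\<close>
    have "(\<Sum>j<N. if j = Suc i then Y else 0) = (if Suc i < N then Y else 0)" for i
      by (simp add: sum.delta)
    then have "(\<Sum>i<N. \<Sum>j<N. if j = Suc i then Y else 0) = (\<Sum>i<N. if Suc i < N then Y else 0)"
      by simp
    also have "\<dots> = (\<Sum>i<M. Y)"
      unfolding Suc sum.lessThan_Suc by (simp add: sum.If_cases)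
    finally show ?thesis by (simp add: Suc)
  qed simp
  moreover have "(\<Sum>i<N. \<Sum>j<N. if j = i then X else 0) = of_nat N * X"
    by (simp add: sum.delta)
  ultimately have "(\<Sum>i<N. \<Sum>j<N. A i j) - (of_nat N * X + of_nat (N - 1) * Y) =
      (\<Sum>i<N. \<Sum>j<N. A i j - (if j = i then X else 0) - (if j = Suc i then Y else 0))"
    by (simp only: sum_subtractf) simp
  also have "cmod \<dots> \<le> (\<Sum>i<N. \<Sum>j<N. e)"
    by (intro sum_norm_le) (use diag rest e in auto)
  also have "\<dots> = (real N)\<^sup>2 * e" by (simp add: power2_eq_square)
  finally show ?thesis .
qed

lemma fejer_expansion:
  fixes S :: complex
  assumes "cmod S = 1"
  shows "of_real ((cmod (\<Sum>i<N. S ^ i))\<^sup>2) = (\<Sum>i<N. \<Sum>j<N. S ^ i * cnj S ^ j)"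
  unfolding complex_norm_square by (simp add: sum_product)

lemma power_mult_cnj_power:
  fixes S :: complex
  assumes "cmod S = 1"
  shows "S ^ i * cnj S ^ j = (if j \<le> i then S ^ (i - j) else cnj S ^ (j - i))"
proof -
  have 1: "S * cnj S = 1" using assms by (simp add: complex_mult_cnj cmod_def power2_eq_square flip: of_real_mult of_real_add)
  show ?thesis
  proof (cases "j \<le> i")
    case True
    then obtain k where k: "i = j + k" using le_Suc_ex by blast
    have "S ^ i * cnj S ^ j = S ^ k * (S * cnj S) ^ j"
      by (simp add: k power_add power_mult_distrib)
    then show ?thesis using 1 k by simp
  next
    case False
    then obtain k where k: "j = i + k" using le_Suc_ex nat_le_linear by blast
    have "S ^ i * cnj S ^ j = cnj S ^ k * (S * cnj S) ^ i"
      by (simp add: k power_add power_mult_distrib)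
    then show ?thesis using 1 k False by simp
  qed
qed

text \<open>Dual extremal argument: \<open>F v\<close> and its mirror image carry the phases \<open>S\<^sup>0\<close> and
  \<open>S\<^sup>-\<^sup>1\<close>. Pairing with the Fejer kernel in \<open>S\<close>, which imitates the evenly spaced atoms of the exact
  extremal measure, leaves only coefficients of functions divisible by high powers of \<open>\<beta>\<close>.\<close>

lemma symmetric_point_evaluation_bound:
  fixes t :: real and \<beta> :: "complex \<Rightarrow> complex"
  assumes t: "\<bar>t\<bar> < 1"
    and \<beta>c: "continuous_on (cball 0 1) \<beta>" and \<beta>h: "\<beta> holomorphic_on ball 0 1"
    and \<beta>1: "\<And>z. cmod z = 1 \<Longrightarrow> cmod (\<beta> z) = 1" and \<beta>s: "\<And>z. cmod z = 1 \<Longrightarrow> \<beta> (cnj z) = cnj (\<beta> z)"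
    and \<rho>: "\<rho> \<le> 1" "\<And>z. cmod z = 1/2 \<Longrightarrow> cmod (\<beta> z) \<le> \<rho>"
    and Fc: "continuous_on (cball 0 1) F" and Fh: "F holomorphic_on ball 0 1"
    and F1: "\<And>z. cmod z = 1 \<Longrightarrow> cmod (F z) \<le> 1"
    and Fs: "\<And>z. cmod z = 1 \<Longrightarrow> F (cnj z) * \<beta> z ^ n = F z"
    and N: "N \<ge> 1"
  shows "cmod (F (\<i> * t)) * (2 - 1 / N) \<le> (1 + t\<^sup>2) + 6 * N * (4 ^ N * (2 / (1 - \<bar>t\<bar>)) ^ (N + 3)) * \<rho> ^ n"
proof -
  define w where "w = \<i> * complex_of_real t"
  define \<tau> where "\<tau> = 2 / (1 - \<bar>t\<bar>)"
  have \<tau>: "\<tau> \<ge> 2" using t by (simp add: \<tau>_def field_simps)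
  have cw: "cnj w = - w" "w\<^sup>2 = - of_real (t\<^sup>2)" "cmod w = \<bar>t\<bar>"
    by (auto simp: w_def power_mult_distrib norm_mult)
  have \<rho>0: "0 \<le> \<rho>" using \<rho>(2)[of "1/2"] norm_ge_zero[of "\<beta> (1/2)"] by (simp del: norm_ge_zero)
  \<comment> \<open>On the circle \<open>cnj (d z) = q z / z\<^sup>2\<close> because
    \<open>cnj w = - w\<close>, so \<open>S\<close> is \<beta>^n times the unimodular factor cnj d /
    d. The simple pole of \<open>v\<close> at w serves for point evaluation, and v(z) (1 - w z)^2 =
    1 / |z - w|^2 on the circle, so \<open>v\<close> cancels the phase of the limiting extremal
    function. The modulus of \<open>v\<close> there is \<open>p\<close>.\<close>
  define d where "d z = (1 - w * z) * (1 + w * z)" for z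
  define q where "q z = (z - w) * (z + w)" for z
  define v where "v z = z / ((z - w) * (1 - w * z)\<^sup>2 * (1 + w * z))" for z
  define S where "S z = \<beta> z ^ n * q z / (z\<^sup>2 * d z)" for z
  define p where "p z = 1 / (cmod (d z))\<^sup>2" for z
  define G where "G z = F z * v z" for z
  have lin: "cmod (1 - w * z) \<ge> 1 - \<bar>t\<bar>" "cmod (1 + w * z) \<ge> 1 - \<bar>t\<bar>" if "cmod z \<le> 1" for z
  proof -
    have "cmod (w * z) \<le> \<bar>t\<bar> * 1" unfolding norm_mult cw using that by (intro mult_left_mono) auto
    then show "cmod (1 - w * z) \<ge> 1 - \<bar>t\<bar>" "cmod (1 + w * z) \<ge> 1 - \<bar>t\<bar>"
      using norm_triangle_ineq2[of 1 "w * z"] norm_triangle_ineq2[of 1 "- (w * z)"] by auto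
  qed
  have lin0: "1 - w * z \<noteq> 0" "1 + w * z \<noteq> 0" if "cmod z \<le> 1" for z
    using lin[OF that] t by auto
  have d0: "d z \<noteq> 0" if "cmod z \<le> 1" for z using lin0[OF that] by (simp add: d_def)
  have zw: "z - w \<noteq> 0" "z + w \<noteq> 0" if "cmod z = 1" for z
    using that cw(3) t by (auto simp: add_eq_0_iff)
  have q0: "q z \<noteq> 0" if "cmod z = 1" for z using zw[OF that] by (simp add: q_def)
  have z0: "z \<noteq> 0" if "cmod z = 1" for z :: complex using that by auto
  have zc: "cnj z = 1 / z" if "cmod z = 1" for z
  proof -
    have "z * cnj z = 1" using that by (metis complex_norm_square of_real_1 one_power2)
    then show ?thesis using z0[OF that] by (simp add: field_simps)
  qed
  have cnjd: "cnj (d z) = q z / z\<^sup>2" if "cmod z = 1" for z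
    using z0[OF that] by (simp add: d_def q_def cw zc[OF that] field_simps power2_eq_square)
  have dcnj: "d (cnj z) = q z / z\<^sup>2" if "cmod z = 1" for z
    using z0[OF that] by (simp add: d_def q_def zc[OF that] field_simps power2_eq_square)
  have cnjq: "cnj (q z) = d z / z\<^sup>2" "q (cnj z) = d z / z\<^sup>2" if "cmod z = 1" for z
    using z0[OF that] by (simp_all add: d_def q_def cw zc[OF that] field_simps power2_eq_square)
  have S1: "cmod (S z) = 1" if "cmod z = 1" for z
  proof -
    have "cmod (q z / z\<^sup>2) = cmod (d z)" using cnjd[OF that] by (metis complex_mod_cnj)
    then have "cmod (q z) = cmod (d z)" using that by (simp add: norm_divide norm_power)
    then show ?thesis using that d0[of z] \<beta>1[OF that] by (simp add: S_def norm_mult norm_divide norm_power)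
  qed
  have Scnj: "S (cnj z) = cnj (S z)" if "cmod z = 1" for z
    unfolding S_def by (simp add: \<beta>s[OF that] cnjq[OF that] cnjd[OF that] dcnj[OF that])
  have S_inv: "S z * cnj (S z) = 1" if "cmod z = 1" for z
    using S1[OF that] by (metis complex_norm_square of_real_1 one_power2)
  \<comment> \<open>The mirror law: \<open>v\<close> is built so that its own change under z to 1/z
    combines with the phase of \<open>F\<close> into exactly one factor
    \<open>cnj (S z)\<close>.\<close>
  have Gcnj: "G (cnj z) = G z * cnj (S z)" if z: "cmod z = 1" for z
  proof -
    have "v (cnj z) * q z = v z * (z\<^sup>2 * d z)"
    proof -
      have cz: "cmod (cnj z) = 1" using z by simp
      have n: "cnj z - w \<noteq> 0" "1 - w * cnj z \<noteq> 0" "1 + w * cnj z \<noteq> 0"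
        using zw[OF cz] lin0[of "cnj z"] cz by auto
      have n': "1 - w * z \<noteq> 0" "z - w \<noteq> 0" "z + w \<noteq> 0" "1 + w * z \<noteq> 0" "z \<noteq> 0"
        using zw[OF z] lin0[of z] z by auto
      have e: "cnj z - w = (1 - w * z) / z" "1 - w * cnj z = (z - w) / z" "1 + w * cnj z = (z + w) / z"
        using n'(5) by (simp_all add: zc[OF z] field_simps)
      have "v (cnj z) = z ^ 3 / ((1 - w * z) * (z - w)\<^sup>2 * (z + w))"
        unfolding v_def e using n' by (simp add: zc[OF z] power_divide) (simp add: eval_nat_numeral)
      then have "v (cnj z) * q z = z ^ 3 / ((1 - w * z) * (z - w))"
        unfolding q_def using n' by (simp add: power2_eq_square)
      also have "\<dots> = v z * (z\<^sup>2 * d z)"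
        unfolding v_def d_def using n' by (simp add: power2_eq_square power3_eq_cube mult_ac)
      finally show ?thesis .
    qed
    then have "G (cnj z) * (\<beta> z ^ n * q z) = G z * (z\<^sup>2 * d z)"
      unfolding G_def Fs[OF z, symmetric] by (simp add: mult_ac)
    then have "G (cnj z) * S z = G z"
      unfolding S_def using z0[OF z] d0[of z] z by (simp add: nonzero_divide_eq_eq)
    then have "G (cnj z) * (S z * cnj (S z)) = G z * cnj (S z)"
      by (metis mult.assoc)
    then show ?thesis using S_inv[OF z] by simp
  qed
  have sub: "sphere 0 1 \<subseteq> cball 0 (1::real)" "sphere (0::complex) 1 \<subseteq> cball 0 1" by auto
  have \<beta>cs: "continuous_on (sphere 0 1) \<beta>" and Fcs: "continuous_on (sphere 0 1) F"
    using \<beta>c Fc continuous_on_subset sub by blast+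
  have Sc: "continuous_on (sphere 0 1) S"
    unfolding S_def q_def d_def
    using z0 lin0 by (intro continuous_intros \<beta>cs) auto
  have vc: "continuous_on (sphere 0 1) v"
    unfolding v_def using zw lin0 by (intro continuous_intros) auto
  have Gc: "continuous_on (sphere 0 1) G"
    unfolding G_def by (intro continuous_intros Fcs vc)
  have pc: "continuous_on (sphere 0 1) p"
    unfolding p_def d_def using lin0 by (intro continuous_intros) auto
  have vp: "cmod (v z) = p z" if z: "cmod z = 1" for z
  proof -
    have "cmod (z - w) = cmod (1 + w * z)"
    proof -
      have "cnj (z - w) * z = 1 + w * z" using z0[OF z] by (simp add: zc[OF z] cw algebra_simps)
      then show ?thesis using z by (metis complex_mod_cnj mult.right_neutral norm_mult)
    qed
    then show ?thesis
      unfolding v_def p_def d_def using z by (simp add: norm_divide norm_mult power_mult_distrib norm_power power2_eq_square)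
  qed
  have p_eq: "of_real (p z) = z\<^sup>2 / (d z * q z)" if z: "cmod z = 1" for z
    unfolding p_def of_real_divide complex_norm_square cnjd[OF z] using z0[OF z] by simp
  have F_half: "cmod (F z) \<le> 1" if "cmod z = 1/2" for z
  proof (rule maximum_modulus_frontier[of F "cball 0 1"])
    show "F holomorphic_on interior (cball 0 1)" using Fh by simp
    show "z \<in> cball 0 1" using that by simp
  qed (use Fc F1 in auto)
  \<comment> \<open>A crude bound common to all harmonics of index at most N:
    \<open>\<tau> ^ (N + 3)\<close> for the analytic factors on |z| = 1/2, and 4 ^ N for at most 2 N
    - 1 powers of 1/z at that radius.\<close>
  define C where "C = 4 ^ N * \<tau> ^ (N + 3)"
  have C0: "C \<ge> 0" using \<tau> by (simp add: C_def)
  define e where "e = C * \<rho> ^ n"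
  have e0: "e \<ge> 0" using C0 \<rho>0 by (simp add: e_def)
  have pow_rho: "\<rho> ^ (n * j) \<le> \<rho> ^ n" if "j \<ge> 1" for j
    using that \<rho>0 \<rho>(1) by (intro power_decreasing) auto
  have \<tau>2: "\<tau> / 2 = 1 / (1 - \<bar>t\<bar>)" using t by (simp add: \<tau>_def field_simps)
  have inv_le: "1 / cmod (1 - w * z) \<le> \<tau> / 2" "1 / cmod (1 + w * z) \<le> \<tau> / 2" if "cmod z \<le> 1" for z
    using lin[OF that] t unfolding \<tau>2 by (auto intro!: frac_le)
  have zw_le: "cmod (z - w) \<le> 2" "cmod (z + w) \<le> 2" if "cmod z \<le> 1" for z
    using norm_triangle_ineq4[of z w] norm_triangle_ineq[of z w] that t cw(3) by auto
  have d_eq: "d z = 1 + of_real (t\<^sup>2) * z\<^sup>2" and q_eq: "q z = z\<^sup>2 + of_real (t\<^sup>2)" for z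
  proof -
    have "d z = 1 - w\<^sup>2 * z\<^sup>2" "q z = z\<^sup>2 - w\<^sup>2"
      by (simp_all add: d_def q_def algebra_simps power2_eq_square)
    then show "d z = 1 + of_real (t\<^sup>2) * z\<^sup>2" "q z = z\<^sup>2 + of_real (t\<^sup>2)"
      unfolding cw(2) by simp_all
  qed
  have t2: "t\<^sup>2 \<le> \<bar>t\<bar>" "t\<^sup>2 < 1"
  proof -
    have "\<bar>t\<bar> * \<bar>t\<bar> \<le> \<bar>t\<bar> * 1" using t by (intro mult_left_mono) auto
    then show "t\<^sup>2 \<le> \<bar>t\<bar>" by (simp add: power2_eq_square)
    show "t\<^sup>2 < 1" using t by (simp add: abs_square_less_1)
  qed
  have dinv_le: "1 / cmod (d z) \<le> \<tau> / 2" if z: "cmod z \<le> 1" for z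
  proof -
    have "cmod (of_real (t\<^sup>2) * z\<^sup>2) = t\<^sup>2 * (cmod z)\<^sup>2" by (simp add: norm_mult norm_power)
    also have "\<dots> \<le> t\<^sup>2 * 1" using z by (intro mult_left_mono) (auto simp: abs_square_le_1)
    finally have "cmod (d z) \<ge> 1 - t\<^sup>2"
      unfolding d_eq using norm_triangle_ineq2[of 1 "- (of_real (t\<^sup>2) * z\<^sup>2)"] by simp
    then have "cmod (d z) \<ge> 1 - \<bar>t\<bar>" using t2 by linarith
    then have "1 / cmod (d z) \<le> 1 / (1 - \<bar>t\<bar>)" using t by (auto intro!: frac_le)
    then show ?thesis unfolding \<tau>2 .
  qed
  have q_le: "cmod (q z) \<le> 2" if z: "cmod z \<le> 1" for z
  proof -
    have "cmod (q z) \<le> (cmod z)\<^sup>2 + t\<^sup>2"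
      unfolding q_eq using norm_triangle_ineq[of "z\<^sup>2" "of_real (t\<^sup>2)"] by (simp add: norm_power)
    moreover have "(cmod z)\<^sup>2 \<le> 1" using z by (simp add: abs_square_le_1)
    ultimately show ?thesis using t2 by linarith
  qed
  have A_small: "cmod (circle_mean (\<lambda>z. G z * S z ^ j)) \<le> e" if j: "1 \<le> j" "j \<le> N" for j
  proof -
    obtain k where k: "j = Suc k" using j by (cases j) auto
    \<comment> \<open>One factor \<open>q\<close> of S^j cancels the pole of \<open>v\<close> at w,
      and the numerator of \<open>v\<close> cancels one power of z. What remains is holomorphic in
      the disc, divisible by \<beta>^(n j), over z^(2k+1).\<close>
    define a where "a z = F z * (z + w) * q z ^ k * (\<beta> z ^ n) ^ Suc k / ((1 - w * z)\<^sup>2 * (1 + w * z) * d z ^ Suc k)" for z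
    have alg: "(f * (z / (A * L * M))) * (B * (Q * (A * P)) / ((z * Z) * D)) = f * P * Q * B / (L * M * D) / Z"
      if "z \<noteq> 0" "A \<noteq> 0" for f z A L M B Q P Z D :: complex
      using that by (simp add: divide_simps)
    have "circle_mean (\<lambda>z. G z * S z ^ j) = circle_mean (\<lambda>z. a z / z ^ (2 * k + 1))"
    proof (rule circle_mean_cong)
      fix z :: complex assume z: "cmod z = 1"
      have "(z\<^sup>2) ^ Suc k = z * z ^ (2 * k + 1)" by (simp add: power_mult power2_eq_square)
      then have Sj: "S z ^ j = (\<beta> z ^ n) ^ Suc k * (q z ^ k * ((z - w) * (z + w))) / ((z * z ^ (2 * k + 1)) * d z ^ Suc k)"
        unfolding k S_def power_divide power_mult_distrib by (simp add: q_def)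
      show "G z * S z ^ j = a z / z ^ (2 * k + 1)"
        unfolding Sj G_def v_def a_def by (rule alg) (use z0[OF z] zw[OF z] in auto)
    qed
    also have "cmod \<dots> \<le> (\<tau> ^ (N + 3) * \<rho> ^ n) * 2 ^ (2 * k + 1)"
    proof (rule circle_mean_coeff_le)
      show "continuous_on (cball 0 1) a"
        unfolding a_def q_def d_def using lin0 by (intro continuous_intros \<beta>c Fc) auto
      show "a holomorphic_on ball 0 1"
        unfolding a_def q_def d_def using lin0 by (intro holomorphic_intros \<beta>h Fh) auto
      fix z :: complex assume z: "cmod z = 1/2"
      then have z1: "cmod z \<le> 1" by simp
      have "cmod (a z) = cmod (F z) * cmod (z + w) * cmod (q z) ^ k * cmod (\<beta> z) ^ (n * Suc k) *
          ((1 / cmod (1 - w * z))\<^sup>2 * (1 / cmod (1 + w * z)) * (1 / cmod (d z)) ^ Suc k)"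
        unfolding a_def by (simp add: norm_mult norm_divide norm_power power_divide power_mult power_add)
      also have "\<dots> \<le> 1 * 2 * 2 ^ k * \<rho> ^ (n * Suc k) * ((\<tau> / 2)\<^sup>2 * (\<tau> / 2) * (\<tau> / 2) ^ Suc k)"
        using \<tau> \<rho>0 by (intro mult_mono power_mono F_half zw_le q_le \<rho>(2) inv_le dinv_le z z1
            mult_nonneg_nonneg zero_le_power norm_ge_zero divide_nonneg_nonneg) auto
      also have "\<dots> \<le> 1 * 2 * 2 ^ k * \<rho> ^ n * ((\<tau> / 2)\<^sup>2 * (\<tau> / 2) * (\<tau> / 2) ^ Suc k)"
        using \<tau> \<rho>0 pow_rho[of "Suc k"] by (intro mult_mono) auto
      also have "\<dots> = \<tau> ^ (k + 4) / 8 * \<rho> ^ n"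
        by (simp add: power_divide power_add eval_nat_numeral)
      also have "\<dots> \<le> \<tau> ^ (N + 3) * \<rho> ^ n"
      proof (rule mult_right_mono)
        have "\<tau> ^ (k + 4) \<le> \<tau> ^ (N + 3)" using \<tau> j k by (intro power_increasing) auto
        moreover have "\<tau> ^ (k + 4) / 8 \<le> \<tau> ^ (k + 4)" using \<tau> by simp
        ultimately show "\<tau> ^ (k + 4) / 8 \<le> \<tau> ^ (N + 3)" by linarith
      qed (use \<rho>0 in simp)
      finally show "cmod (a z) \<le> \<tau> ^ (N + 3) * \<rho> ^ n" .
    qed
    also have "\<dots> \<le> (\<tau> ^ (N + 3) * \<rho> ^ n) * 4 ^ N"
    proof (rule mult_left_mono)
      have "(2::real) ^ (2 * k + 1) \<le> 2 ^ (2 * N)" using j k by (intro power_increasing) auto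
      then show "(2::real) ^ (2 * k + 1) \<le> 4 ^ N" by (simp add: power_mult)
    qed (use \<tau> \<rho>0 in simp)
    finally show ?thesis by (simp add: e_def C_def mult_ac)
  qed
  have B_small: "cmod (circle_mean (\<lambda>z. of_real (p z) * S z ^ j)) \<le> e" if j: "1 \<le> j" "j \<le> N" for j
  proof -
    obtain k where k: "j = Suc k" using j by (cases j) auto
    \<comment> \<open>On the circle \<open>p\<close> is z^2 / (d q). Again one \<open>q\<close> of
      S^j removes the poles in the disc, and z^2 lowers the order at 0 to 2k.\<close>
    define a where "a z = q z ^ k * (\<beta> z ^ n) ^ Suc k / d z ^ (k + 2)" for z
    have alg: "(x / (D * A)) * (B * (Q * A) / ((x * Z) * E)) = Q * B / (D * E) / Z"
      if "x \<noteq> 0" "A \<noteq> 0" for x A B Q Z D E :: complex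
      using that by (simp add: divide_simps)
    have "circle_mean (\<lambda>z. of_real (p z) * S z ^ j) = circle_mean (\<lambda>z. a z / z ^ (2 * k))"
    proof (rule circle_mean_cong)
      fix z :: complex assume z: "cmod z = 1"
      have zz: "(z\<^sup>2) ^ Suc k = z\<^sup>2 * z ^ (2 * k)" by (simp add: power_mult)
      have Sj: "S z ^ j = (\<beta> z ^ n) ^ Suc k * (q z ^ k * q z) / ((z\<^sup>2 * z ^ (2 * k)) * d z ^ Suc k)"
        unfolding k S_def power_divide power_mult_distrib zz by (simp add: mult_ac)
      have dd: "d z ^ (k + 2) = d z * d z ^ Suc k" by simp
      show "of_real (p z) * S z ^ j = a z / z ^ (2 * k)"
        unfolding Sj p_eq[OF z] a_def dd by (rule alg) (use z0[OF z] q0[OF z] in auto)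
    qed
    also have "cmod \<dots> \<le> (\<tau> ^ (N + 3) * \<rho> ^ n) * 2 ^ (2 * k)"
    proof (rule circle_mean_coeff_le)
      show "continuous_on (cball 0 1) a"
        unfolding a_def q_def d_def using lin0 by (intro continuous_intros \<beta>c) auto
      show "a holomorphic_on ball 0 1"
        unfolding a_def q_def d_def using lin0 by (intro holomorphic_intros \<beta>h) auto
      fix z :: complex assume z: "cmod z = 1/2"
      then have z1: "cmod z \<le> 1" by simp
      have "cmod (a z) = cmod (q z) ^ k * cmod (\<beta> z) ^ (n * Suc k) * (1 / cmod (d z)) ^ (k + 2)"
        unfolding a_def by (simp add: norm_mult norm_divide norm_power power_divide power_mult power_add)
      also have "\<dots> \<le> 2 ^ k * \<rho> ^ (n * Suc k) * (\<tau> / 2) ^ (k + 2)"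
        using \<tau> \<rho>0 by (intro mult_mono power_mono q_le \<rho>(2) dinv_le z z1
            mult_nonneg_nonneg zero_le_power norm_ge_zero divide_nonneg_nonneg) auto
      also have "\<dots> \<le> 2 ^ k * \<rho> ^ n * (\<tau> / 2) ^ (k + 2)"
        using \<tau> \<rho>0 pow_rho[of "Suc k"] by (intro mult_mono) auto
      also have "\<dots> = \<tau> ^ (k + 2) / 4 * \<rho> ^ n"
        by (simp add: power_divide power_add eval_nat_numeral)
      also have "\<dots> \<le> \<tau> ^ (N + 3) * \<rho> ^ n"
      proof (rule mult_right_mono)
        have "\<tau> ^ (k + 2) \<le> \<tau> ^ (N + 3)" using \<tau> j k by (intro power_increasing) auto
        moreover have "\<tau> ^ (k + 2) / 4 \<le> \<tau> ^ (k + 2)" using \<tau> by simp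
        ultimately show "\<tau> ^ (k + 2) / 4 \<le> \<tau> ^ (N + 3)" by linarith
      qed (use \<rho>0 in simp)
      finally show "cmod (a z) \<le> \<tau> ^ (N + 3) * \<rho> ^ n" .
    qed
    also have "\<dots> \<le> (\<tau> ^ (N + 3) * \<rho> ^ n) * 4 ^ N"
    proof (rule mult_left_mono)
      have "(2::real) ^ (2 * k) \<le> 2 ^ (2 * N)" using j k by (intro power_increasing) auto
      then show "(2::real) ^ (2 * k) \<le> 4 ^ N" by (simp add: power_mult)
    qed (use \<tau> \<rho>0 in simp)
    finally show ?thesis by (simp add: e_def C_def mult_ac)
  qed
  define X where "X = circle_mean G"
  define A where "A i j = circle_mean (\<lambda>z. G z * (S z ^ i * cnj (S z) ^ j))" for i j
  define B where "B i j = circle_mean (\<lambda>z. of_real (p z) * (S z ^ i * cnj (S z) ^ j))" for i j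
  have A1: "A i i = X" for i
    unfolding A_def X_def by (rule circle_mean_cong) (simp add: power_mult_cnj_power S1)
  \<comment> \<open>The mirror law turns the harmonic -m of \<open>G\<close>, with m = j - i, into
    the harmonic m - 1. So the superdiagonal reproduces \<open>X\<close>, which is the source of the
    factor 2 - 1/N, and entries further up fall under \<open>A_small\<close>.\<close>
  have A_up: "A i j = circle_mean (\<lambda>z. G z * S z ^ (j - Suc i))" if "i < j" for i j
  proof -
    have "A i j = circle_mean (\<lambda>z. G (cnj z) * S (cnj z) ^ (j - Suc i))"
      unfolding A_def
    proof (rule circle_mean_cong)
      fix z :: complex assume z: "cmod z = 1"
      have "j - i = Suc (j - Suc i)" using that by simp
      then show "G z * (S z ^ i * cnj (S z) ^ j) = G (cnj z) * S (cnj z) ^ (j - Suc i)"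
        using that by (simp add: power_mult_cnj_power[OF S1[OF z]] Gcnj[OF z] Scnj[OF z])
    qed
    then show ?thesis using circle_mean_of_cnj[of "\<lambda>z. G z * S z ^ (j - Suc i)"] by simp
  qed
  have A2: "A i (Suc i) = X" for i by (simp add: A_up X_def)
  have A3: "cmod (A i j) \<le> e" if "i < N" "j < N" "i \<noteq> j" "j \<noteq> Suc i" for i j
  proof (cases "i < j")
    case True
    then show ?thesis unfolding A_up[OF True] using that by (intro A_small) auto
  next
    case False
    then have "A i j = circle_mean (\<lambda>z. G z * S z ^ (i - j))"
      unfolding A_def by (intro circle_mean_cong) (simp add: power_mult_cnj_power S1)
    then show ?thesis using A_small[of "i - j"] that False by simp
  qed
  have A: "cmod ((\<Sum>i<N. \<Sum>j<N. A i j) - (of_nat N * X + of_nat (N - 1) * X)) \<le> (real N)\<^sup>2 * e"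
    by (rule sum_norm_near_two_diagonals[of A X X N e, OF A1 A2 A3 e0])
  define P0 where "P0 = circle_mean (\<lambda>z. of_real (p z))"
  define Y where "Y = circle_mean (\<lambda>z. of_real (p z) * cnj (S z))"
  have B1: "B i i = P0" for i
    unfolding B_def P0_def by (rule circle_mean_cong) (simp add: power_mult_cnj_power S1)
  have B2: "B i (Suc i) = Y" for i
    unfolding B_def Y_def by (rule circle_mean_cong) (simp only: power_mult_cnj_power S1, simp)
  \<comment> \<open>As \<open>p\<close> is real, negative harmonics are conjugates of positive ones
    and equally small: there is no doubling on this side. The range reaches j = N so that the
    harmonic of index 1 is available even for N = 1.\<close>
  have B_up: "cmod (B i j) \<le> e" if "i < j" "j \<le> N" for i j
  proof -
    have "B i j = circle_mean (\<lambda>z. cnj (of_real (p z) * S z ^ (j - i)))"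
      unfolding B_def using that by (intro circle_mean_cong) (simp add: power_mult_cnj_power S1)
    also have "\<dots> = cnj (circle_mean (\<lambda>z. of_real (p z) * S z ^ (j - i)))"
      by (intro cnj_circle_mean continuous_intros pc Sc)
    finally show ?thesis using B_small[of "j - i"] that by simp
  qed
  have Y: "cmod Y \<le> e" using B_up[of 0 1] B2[of 0] N by simp
  have B3: "cmod (B i j) \<le> e" if "i < N" "j < N" "i \<noteq> j" "j \<noteq> Suc i" for i j
  proof (cases "i < j")
    case True
    then show ?thesis using that by (intro B_up) auto
  next
    case False
    then have "B i j = circle_mean (\<lambda>z. of_real (p z) * S z ^ (i - j))"
      unfolding B_def by (intro circle_mean_cong) (simp add: power_mult_cnj_power S1)
    then show ?thesis using B_small[of "i - j"] that False by simp
  qed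
  have B: "cmod ((\<Sum>i<N. \<Sum>j<N. B i j) - (of_nat N * P0 + of_nat (N - 1) * Y)) \<le> (real N)\<^sup>2 * e"
    by (rule sum_norm_near_two_diagonals[of B P0 Y N e, OF B1 B2 B3 e0])
  define K where "K z = (cmod (\<Sum>i<N. S z ^ i))\<^sup>2" for z
  have K: "of_real (K z) = (\<Sum>i<N. \<Sum>j<N. S z ^ i * cnj (S z) ^ j)" if "cmod z = 1" for z
    unfolding K_def by (rule fejer_expansion[OF S1[OF that]])
  have AK: "circle_mean (\<lambda>z. G z * of_real (K z)) = (\<Sum>i<N. \<Sum>j<N. A i j)"
  proof -
    have "circle_mean (\<lambda>z. G z * of_real (K z)) = circle_mean (\<lambda>z. \<Sum>i<N. \<Sum>j<N. G z * (S z ^ i * cnj (S z) ^ j))"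
      by (rule circle_mean_cong) (simp add: K sum_distrib_left)
    also have "\<dots> = (\<Sum>i<N. circle_mean (\<lambda>z. \<Sum>j<N. G z * (S z ^ i * cnj (S z) ^ j)))"
      by (intro circle_mean_sum continuous_intros Gc Sc) simp
    also have "\<dots> = (\<Sum>i<N. \<Sum>j<N. A i j)"
      unfolding A_def by (intro sum.cong refl circle_mean_sum continuous_intros Gc Sc) simp
    finally show ?thesis .
  qed
  have BK: "circle_mean (\<lambda>z. of_real (p z * K z)) = (\<Sum>i<N. \<Sum>j<N. B i j)"
  proof -
    have "circle_mean (\<lambda>z. of_real (p z * K z)) = circle_mean (\<lambda>z. \<Sum>i<N. \<Sum>j<N. of_real (p z) * (S z ^ i * cnj (S z) ^ j))"
      by (rule circle_mean_cong) (simp add: K sum_distrib_left)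
    also have "\<dots> = (\<Sum>i<N. circle_mean (\<lambda>z. \<Sum>j<N. of_real (p z) * (S z ^ i * cnj (S z) ^ j)))"
      by (intro circle_mean_sum continuous_intros pc Sc) simp
    also have "\<dots> = (\<Sum>i<N. \<Sum>j<N. B i j)"
      unfolding B_def by (intro sum.cong refl circle_mean_sum continuous_intros pc Sc) simp
    finally show ?thesis .
  qed
  have Kc: "continuous_on (sphere 0 1) K"
    unfolding K_def by (intro continuous_intros Sc)
  \<comment> \<open>Positivity of the Fejer kernel matters here: it preserves the pointwise
    domination of \<open>G\<close> by \<open>p\<close>.\<close>
  have GK: "cmod (circle_mean (\<lambda>z. G z * of_real (K z))) \<le> Re (circle_mean (\<lambda>z. of_real (p z * K z)))"
  proof (rule norm_circle_mean_le)
    fix z :: complex assume z: "cmod z = 1"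
    have "cmod (G z) \<le> 1 * p z" unfolding G_def norm_mult vp[OF z]
      using F1[OF z] by (intro mult_right_mono) (auto simp: p_def)
    moreover have "K z \<ge> 0" by (simp add: K_def)
    ultimately show "cmod (G z * of_real (K z)) \<le> p z * K z"
      by (simp add: norm_mult mult_right_mono)
  qed (intro continuous_intros Gc pc Kc)+
  \<comment> \<open>On the circle d + cnj d - |d|^2 = 1 - |1 - d|^2 = 1 - t^4. Hence (1 - t^4) p = 2
    Re (1/d) - 1, and the mean of 1/d is its value 1 at the centre.\<close>
  have P0: "P0 = of_real (1 / (1 - t ^ 4))"
  proof -
    have h: "(\<lambda>z. 1 / d z) holomorphic_on ball 0 1" "continuous_on (cball 0 1) (\<lambda>z. 1 / d z)"
      unfolding d_def using lin0 by (auto intro!: holomorphic_intros continuous_intros)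
    then have hs: "continuous_on (sphere 0 1) (\<lambda>z. 1 / d z)" using continuous_on_subset sub by blast
    have "circle_mean (\<lambda>z. 1 / d z * z / (z - 0)) = 1 / d 0"
      by (rule circle_mean_Cauchy) (use h in auto)
    moreover have "circle_mean (\<lambda>z. 1 / d z * z / (z - 0)) = circle_mean (\<lambda>z. 1 / d z)"
      by (rule circle_mean_cong) auto
    ultimately have m: "circle_mean (\<lambda>z. 1 / d z) = 1" by (simp add: d_def)
    have one: "circle_mean (\<lambda>z. 1) = 1" by (simp add: circle_mean_def scaleR_conv_of_real)
    have "of_real (1 - t ^ 4) * P0 = circle_mean (\<lambda>z. of_real (1 - t ^ 4) * of_real (p z))"
      unfolding P0_def by (rule circle_mean_cmult[symmetric])
    also have "\<dots> = circle_mean (\<lambda>z. (1 / d z + cnj (1 / d z)) + (-1) * 1)"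
    proof (rule circle_mean_cong)
      fix z :: complex assume z: "cmod z = 1"
      have "d z \<noteq> 0" using d0[of z] z by simp
      moreover have "d z + cnj (d z) - d z * cnj (d z) = of_real (1 - t ^ 4)"
        using z0[OF z] unfolding cnjd[OF z] d_eq q_eq
        by (simp add: field_simps power2_eq_square eval_nat_numeral zc[OF z])
      ultimately show "of_real (1 - t ^ 4) * of_real (p z) = (1 / d z + cnj (1 / d z)) + (-1) * 1"
        unfolding p_def of_real_divide complex_norm_square by (simp add: field_simps)
    qed
    also have "\<dots> = (1 + cnj 1) + (-1) * 1"
      using m one hs by (simp only: circle_mean_add circle_mean_cmult cnj_circle_mean continuous_on_cnj continuous_on_add continuous_on_const)
    finally have "of_real (1 - t ^ 4) * P0 = 1" by simp
    moreover have ne: "1 - t ^ 4 \<noteq> 0"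
      using t2(2) power_strict_mono[of "t\<^sup>2" 1 2] by (simp flip: power_mult)
    ultimately have "P0 = 1 / of_real (1 - t ^ 4)"
      by (metis mult.commute nonzero_eq_divide_eq of_real_eq_0_iff)
    then show ?thesis by (simp only: of_real_divide of_real_1)
  qed
  \<comment> \<open>Cauchy's formula at the pole w of \<open>v\<close>, with w^2 = - t^2.\<close>
  have X: "X * of_real ((1 + t\<^sup>2)\<^sup>2 * (1 - t\<^sup>2)) = F w"
  proof -
    have "circle_mean (\<lambda>z. F z / ((1 - w * z)\<^sup>2 * (1 + w * z)) * z / (z - w)) = F w / ((1 - w * w)\<^sup>2 * (1 + w * w))"
    proof (rule circle_mean_Cauchy)
      show "continuous_on (cball 0 1) (\<lambda>z. F z / ((1 - w * z)\<^sup>2 * (1 + w * z)))"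
        using lin0 by (intro continuous_intros Fc) auto
      show "(\<lambda>z. F z / ((1 - w * z)\<^sup>2 * (1 + w * z))) holomorphic_on ball 0 1"
        using lin0 by (intro holomorphic_intros Fh) auto
    qed (use cw t in auto)
    moreover have xx: "circle_mean (\<lambda>z. F z / ((1 - w * z)\<^sup>2 * (1 + w * z)) * z / (z - w)) = X"
      unfolding X_def G_def v_def by (rule circle_mean_cong) (simp add: mult_ac)
    moreover have ww: "(1 - w * w)\<^sup>2 * (1 + w * w) = of_real ((1 + t\<^sup>2)\<^sup>2 * (1 - t\<^sup>2))"
      using cw(2) by (simp add: power2_eq_square)
    ultimately have Xq: "X = F w / of_real ((1 + t\<^sup>2)\<^sup>2 * (1 - t\<^sup>2))"
      unfolding xx ww by blast
    have "(1 + t\<^sup>2)\<^sup>2 * (1 - t\<^sup>2) \<noteq> 0" using t2 by (auto simp: add_nonneg_eq_0_iff)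
    then have ne: "complex_of_real ((1 + t\<^sup>2)\<^sup>2 * (1 - t\<^sup>2)) \<noteq> 0" by (simp only: of_real_eq_0_iff not_False_eq_True)
    from Xq show ?thesis by (rule nonzero_eq_divide_eq[OF ne, THEN iffD1])
  qed
  define s where "s = (1 + t\<^sup>2)\<^sup>2 * (1 - t\<^sup>2)"
  have s: "s > 0" "s \<le> 2"
  proof -
    show "s > 0" unfolding s_def using t2 by (intro mult_pos_pos zero_less_power add_pos_nonneg) auto
    have "s = (1 + t\<^sup>2) * (1 - t ^ 4)" by (simp add: s_def power2_eq_square eval_nat_numeral algebra_simps)
    also have "\<dots> \<le> 2 * 1"
      using t2 power_le_one[of "t\<^sup>2" 2] by (intro mult_mono) (auto simp flip: power_mult)
    finally show "s \<le> 2" by simp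
  qed
  \<comment> \<open>N from the diagonal and N - 1 from the superdiagonal. Three errors of size N^2 e
    follow: from the sum over \<open>A\<close>, from the sum over \<open>B\<close> and from
    \<open>Y\<close>.\<close>
  have "(2 * real N - 1) * cmod X = cmod (of_nat N * X + of_nat (N - 1) * X)"
  proof -
    have "of_nat N * X + of_nat (N - 1) * X = of_real (2 * real N - 1) * X"
      using N by (simp add: of_nat_diff algebra_simps)
    then have "cmod (of_nat N * X + of_nat (N - 1) * X) = \<bar>2 * real N - 1\<bar> * cmod X"
      by (simp only: norm_mult norm_of_real)
    then show ?thesis using N by simp
  qed
  also have "\<dots> \<le> cmod (\<Sum>i<N. \<Sum>j<N. A i j) + (real N)\<^sup>2 * e"
    using A norm_triangle_ineq2[of "of_nat N * X + of_nat (N - 1) * X" "\<Sum>i<N. \<Sum>j<N. A i j"]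
    by (simp add: norm_minus_commute)
  also have "cmod (\<Sum>i<N. \<Sum>j<N. A i j) \<le> cmod (\<Sum>i<N. \<Sum>j<N. B i j)"
    using GK complex_Re_le_cmod[of "\<Sum>i<N. \<Sum>j<N. B i j"] unfolding AK BK by linarith
  also have "cmod (\<Sum>i<N. \<Sum>j<N. B i j) \<le> (real N / (1 - t ^ 4) + (real N)\<^sup>2 * e) + (real N)\<^sup>2 * e"
  proof -
    have "cmod (of_nat N * P0) = real N / (1 - t ^ 4)"
      using t2 power_le_one[of "t\<^sup>2" 2] unfolding P0 norm_mult norm_of_real by (simp flip: power_mult)
    moreover have "cmod (of_nat (N - 1) * Y) \<le> (real N)\<^sup>2 * e"
    proof -
      have "real (N - 1) \<le> real N * 1" by simp
      also have "\<dots> \<le> real N * real N" using N by (intro mult_left_mono) auto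
      finally have "real (N - 1) \<le> (real N)\<^sup>2" by (simp add: power2_eq_square)
      then show ?thesis unfolding norm_mult norm_of_nat using Y by (intro mult_mono) auto
    qed
    ultimately have "cmod (of_nat N * P0 + of_nat (N - 1) * Y) \<le> real N / (1 - t ^ 4) + (real N)\<^sup>2 * e"
      using norm_triangle_ineq[of "of_nat N * P0" "of_nat (N - 1) * Y"] by linarith
    then show ?thesis
      using B norm_triangle_ineq2[of "\<Sum>i<N. \<Sum>j<N. B i j" "of_nat N * P0 + of_nat (N - 1) * Y"] by linarith
  qed
  finally have main: "(2 * real N - 1) * cmod X \<le> real N / (1 - t ^ 4) + 3 * (real N)\<^sup>2 * e" by (simp add: algebra_simps)
  have Xs: "cmod X * s = cmod (F w)"
    using arg_cong[OF X, of cmod] s unfolding s_def[symmetric] norm_mult norm_of_real by simp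
  have t4: "s / (1 - t ^ 4) = 1 + t\<^sup>2"
  proof -
    have "s = (1 + t\<^sup>2) * (1 - t ^ 4)" by (simp add: s_def power2_eq_square eval_nat_numeral algebra_simps)
    then show ?thesis using s by auto
  qed
  have "cmod (F w) * (2 - 1 / N) = ((2 * real N - 1) * cmod X) * (s / N)"
    unfolding Xs[symmetric] using N by (simp add: field_simps)
  also have "\<dots> \<le> (real N / (1 - t ^ 4) + 3 * (real N)\<^sup>2 * e) * (s / N)"
    using main s N by (intro mult_right_mono) auto
  also have "\<dots> = s / (1 - t ^ 4) + 3 * N * e * s"
    using N by (simp add: field_simps power2_eq_square)
  also have "\<dots> \<le> (1 + t\<^sup>2) + 3 * N * e * 2"
    unfolding t4 using s e0 by (intro add_left_mono mult_left_mono) auto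
  finally show ?thesis by (simp add: e_def C_def \<tau>_def w_def mult_ac)
qed

section \<open>Near-extremal polynomials\<close>

text \<open>A form of degree n in (A, D): a polynomial of degree at most n in u = A / D, multiplied
  by D^n. Zeros of \<open>D\<close> are left free, being the preimages of u = infinity.\<close>

definition is_homogenization :: "(complex \<Rightarrow> complex) \<Rightarrow> (complex \<Rightarrow> complex) \<Rightarrow> nat \<Rightarrow> (complex \<Rightarrow> complex) \<Rightarrow> bool" where
  "is_homogenization A D n h \<longleftrightarrow>
     (\<exists>P. degree P \<le> n \<and> (\<forall>z. D z \<noteq> 0 \<longrightarrow> h z = D z ^ n * poly P (A z / D z)))"

lemma is_homogenization_add:
  assumes "is_homogenization A D n f" "is_homogenization A D n g"
  shows "is_homogenization A D n (\<lambda>z. f z + g z)"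
proof -
  obtain P Q where "degree P \<le> n" "\<forall>z. D z \<noteq> 0 \<longrightarrow> f z = D z ^ n * poly P (A z / D z)"
    "degree Q \<le> n" "\<forall>z. D z \<noteq> 0 \<longrightarrow> g z = D z ^ n * poly Q (A z / D z)"
    using assms unfolding is_homogenization_def by blast
  then show ?thesis unfolding is_homogenization_def
    by (intro exI[of _ "P + Q"]) (auto simp: degree_add_le algebra_simps)
qed

lemma is_homogenization_cmult:
  assumes "is_homogenization A D n f"
  shows "is_homogenization A D n (\<lambda>z. c * f z)"
proof -
  obtain P where "degree P \<le> n" "\<forall>z. D z \<noteq> 0 \<longrightarrow> f z = D z ^ n * poly P (A z / D z)"
    using assms unfolding is_homogenization_def by blast
  then show ?thesis unfolding is_homogenization_def
    by (intro exI[of _ "smult c P"]) (auto intro: order_trans[OF degree_smult_le])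
qed

lemma is_homogenization_mult:
  assumes "is_homogenization A D m f" "is_homogenization A D n g"
  shows "is_homogenization A D (m + n) (\<lambda>z. f z * g z)"
proof -
  obtain P Q where PQ: "degree P \<le> m" "\<forall>z. D z \<noteq> 0 \<longrightarrow> f z = D z ^ m * poly P (A z / D z)"
    "degree Q \<le> n" "\<forall>z. D z \<noteq> 0 \<longrightarrow> g z = D z ^ n * poly Q (A z / D z)"
    using assms unfolding is_homogenization_def by blast
  have "degree (P * Q) \<le> m + n"
    using degree_mult_le[of P Q] PQ(1,3) by linarith
  with PQ show ?thesis unfolding is_homogenization_def
    by (intro exI[of _ "P * Q"]) (auto simp: power_add)
qed

lemma is_homogenization_0: "is_homogenization A D n (\<lambda>z. 0)"
  unfolding is_homogenization_def by (intro exI[of _ 0]) simp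

lemma is_homogenization_const: "is_homogenization A D 0 (\<lambda>z. c)"
  unfolding is_homogenization_def by (intro exI[of _ "[:c:]"]) simp

lemma is_homogenization_power:
  assumes "is_homogenization A D m f"
  shows "is_homogenization A D (m * n) (\<lambda>z. f z ^ n)"
proof (induction n)
  case (Suc n)
  then show ?case using is_homogenization_mult[OF assms Suc] by simp
qed (use is_homogenization_const[of A D 1] in simp)

lemma is_homogenization_sum:
  assumes "finite I" "\<And>i. i \<in> I \<Longrightarrow> is_homogenization A D n (f i)"
  shows "is_homogenization A D n (\<lambda>z. \<Sum>i\<in>I. f i z)"
  using assms by (induction I) (auto intro: is_homogenization_0 is_homogenization_add)

text \<open>This is T(z) + z^(2n) T(1/z), written in monomials so that it keeps its meaning at z =
  0, the evaluation point when t = 0.\<close>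

definition palindromic_eval :: "nat \<Rightarrow> complex poly \<Rightarrow> complex \<Rightarrow> complex" where
  "palindromic_eval n T z = (\<Sum>j\<le>2*n. coeff T j * (z ^ j + z ^ (2 * n - j)))"

lemma palindromic_eval_nonzero:
  assumes "degree T \<le> 2 * n" "z \<noteq> 0"
  shows "palindromic_eval n T z = poly T z + z ^ (2 * n) * poly T (1 / z)"
proof -
  have P: "poly T x = (\<Sum>j\<le>2*n. coeff T j * x ^ j)" for x
    unfolding poly_altdef by (rule sum.mono_neutral_left) (use assms in \<open>auto simp: coeff_eq_0\<close>)
  have "z ^ (2 * n) * poly T (1 / z) = (\<Sum>j\<le>2*n. coeff T j * z ^ (2 * n - j))"
    unfolding P sum_distrib_left
  proof (rule sum.cong[OF refl])
    fix j assume "j \<in> {..2 * n}"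
    then show "z ^ (2 * n) * (coeff T j * (1 / z) ^ j) = coeff T j * z ^ (2 * n - j)"
      using assms(2) by (simp add: power_diff power_divide)
  qed
  then show ?thesis
    by (simp add: palindromic_eval_def distrib_left sum.distrib P)
qed

lemma palindromic_eval_0:
  assumes "n \<ge> 1"
  shows "palindromic_eval n T 0 = coeff T 0 + coeff T (2 * n)"
proof -
  have "(\<Sum>j\<le>2*n. coeff T j * ((0::complex) ^ j + 0 ^ (2 * n - j))) =
     (\<Sum>j\<le>2*n. (if j = 0 then coeff T 0 else 0) + (if j = 2 * n then coeff T (2 * n) else 0))"
    using assms by (intro sum.cong refl) (auto simp: power_0_left)
  also have "\<dots> = coeff T 0 + coeff T (2 * n)"
    by (simp add: sum.distrib sum.delta)
  finally show ?thesis by (simp add: palindromic_eval_def)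
qed

text \<open>As the determinant is nonzero, z and 1 + z^2 are linear combinations of \<open>A\<close>
  and \<open>D\<close>. The Chebyshev-type recurrence 1 + z^(2k) = (1 + z^2) (1 + z^(2k-2)) - z^2 (1
  + z^(2k-4)) and the factorisation z^j + z^(2n-j) = z^j (1 + z^(2(n-j))) then give every symmetric
  pair of monomials.\<close>

lemma is_homogenization_palindromic:
  fixes p q r s :: complex
  assumes A: "\<And>z. A z = p * (z\<^sup>2 + 1) + q * z" and D: "\<And>z. D z = r * (z\<^sup>2 + 1) + s * z"
    and det: "p * s - q * r \<noteq> 0"
  shows "is_homogenization A D n (palindromic_eval n T)"
proof -
  have H: "is_homogenization A D 1 (\<lambda>z. x * A z + y * D z)" for x y
    unfolding is_homogenization_def
    by (intro exI[of _ "[:y, x:]"]) (auto simp: algebra_simps)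
  have z: "is_homogenization A D 1 (\<lambda>z. z)"
  proof -
    have "(\<lambda>z. (- r / (p * s - q * r)) * A z + (p / (p * s - q * r)) * D z) = (\<lambda>z. z)"
    proof
      fix z
      have "- r * A z + p * D z = (p * s - q * r) * z"
        unfolding A D by (simp add: algebra_simps)
      then have "(- r * A z + p * D z) / (p * s - q * r) = z" using det by simp
      then show "(- r / (p * s - q * r)) * A z + (p / (p * s - q * r)) * D z = z"
        by (simp add: add_divide_distrib diff_divide_distrib)
    qed
    with H[of "- r / (p * s - q * r)" "p / (p * s - q * r)"] show ?thesis by simp
  qed
  have z2: "is_homogenization A D 1 (\<lambda>z. 1 + z\<^sup>2)"
  proof -
    have "(\<lambda>z. (s / (p * s - q * r)) * A z + (- q / (p * s - q * r)) * D z) = (\<lambda>z. 1 + z\<^sup>2)"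
    proof
      fix z
      have "s * A z + - q * D z = (p * s - q * r) * (1 + z\<^sup>2)"
        unfolding A D by (simp add: algebra_simps)
      then have "(s * A z + - q * D z) / (p * s - q * r) = 1 + z\<^sup>2" using det by simp
      then show "(s / (p * s - q * r)) * A z + (- q / (p * s - q * r)) * D z = 1 + z\<^sup>2"
        by (simp add: add_divide_distrib diff_divide_distrib)
    qed
    with H[of "s / (p * s - q * r)" "- q / (p * s - q * r)"] show ?thesis by simp
  qed
  have zk: "is_homogenization A D k (\<lambda>z. z ^ k)" for k
    using is_homogenization_power[OF z, of k] by simp
  have sk: "is_homogenization A D k (\<lambda>z. 1 + z ^ (2 * k))" for k
  proof (induction k rule: less_induct)
    case (less k)
    consider "k = 0" | "k = 1" | m where "k = Suc (Suc m)" by (metis One_nat_def not0_implies_Suc)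
    then show ?case
    proof cases
      case 1
      then show ?thesis using is_homogenization_const[of A D 2] by simp
    next
      case 2
      then show ?thesis using z2 by simp
    next
      case 3
      have "is_homogenization A D (1 + Suc m) (\<lambda>z. (1 + z\<^sup>2) * (1 + z ^ (2 * Suc m)))"
        by (rule is_homogenization_mult[OF z2 less]) (simp add: 3)
      moreover have "is_homogenization A D (2 + m) (\<lambda>z. z ^ 2 * (1 + z ^ (2 * m)))"
        by (rule is_homogenization_mult[OF zk less]) (simp add: 3)
      ultimately have "is_homogenization A D k (\<lambda>z. (1 + z\<^sup>2) * (1 + z ^ (2 * Suc m)) + (-1) * (z ^ 2 * (1 + z ^ (2 * m))))"
        unfolding 3 by (intro is_homogenization_add is_homogenization_cmult) simp_all
      moreover have "(1 + z\<^sup>2) * (1 + z ^ (2 * Suc m)) + (-1) * (z ^ 2 * (1 + z ^ (2 * m))) = 1 + z ^ (2 * k)" for z :: complex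
        unfolding 3 by (simp add: algebra_simps power2_eq_square)
      ultimately show ?thesis by simp
    qed
  qed
  have low: "is_homogenization A D n (\<lambda>z. z ^ j + z ^ (2 * n - j))" if "j \<le> n" for j
  proof -
    have "is_homogenization A D (j + (n - j)) (\<lambda>z. z ^ j * (1 + z ^ (2 * (n - j))))"
      by (rule is_homogenization_mult[OF zk sk])
    moreover have "j + 2 * (n - j) = 2 * n - j" using that by simp
    then have "z ^ j * (1 + z ^ (2 * (n - j))) = z ^ j + z ^ (2 * n - j)" for z :: complex
      by (simp add: distrib_left flip: power_add)
    ultimately show ?thesis using that by simp
  qed
  have "is_homogenization A D n (\<lambda>z. z ^ j + z ^ (2 * n - j))" if "j \<le> 2 * n" for j
  proof (cases "j \<le> n")
    case False
    then show ?thesis using low[of "2 * n - j"] that by (simp add: add.commute)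
  qed (rule low)
  then show ?thesis
    unfolding palindromic_eval_def[abs_def]
    by (intro is_homogenization_sum is_homogenization_cmult) auto
qed

text \<open>The limiting extremal function of the disc is \<open>f z = (1 - w z)\<^sup>2 / (2 (1 + t\<^sup>2))\<close> with
  \<open>w = \<i> t\<close>. The terms \<open>a1\<close>, \<open>b1\<close> remove the double pole at \<open>0\<close> of \<open>f (1/z) B (1/z)\<^sup>-\<^sup>n\<close>, where
  \<open>B z = (z - a) / (1 - cnj a * z)\<close>.\<close>

lemma near_extremal_palindromic:
  fixes t :: real and a :: complex and n :: nat
  assumes a: "a \<noteq> 0" "cmod a < 1" and n: "n \<ge> 1"
  defines "w \<equiv> \<i> * complex_of_real t" and "c \<equiv> complex_of_real (1 / (2 * (1 + t\<^sup>2)))"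
  defines "a1 \<equiv> c * w\<^sup>2 * (- cnj a) ^ n"
  defines "b1 \<equiv> - 2 * c * w * (- cnj a) ^ n + (c * w\<^sup>2 / (- cnj a) + c * w\<^sup>2 * a) * (of_nat n * (- cnj a) ^ n)"
  defines "\<delta> \<equiv> cmod a1 + cmod b1"
  obtains T where "degree T \<le> 2 * n"
    "\<And>z. cmod z = 1 \<Longrightarrow> cmod (palindromic_eval n T z) \<le> (1 + 2 * \<delta>) * cmod ((z - a) * (1 - a * z)) ^ n"
    "(1 + t\<^sup>2) / 2 * cmod ((1 - a * w) * (1 - cnj a * w)) ^ n \<le>
       cmod (palindromic_eval n T w) + (cmod a ^ n + \<delta> * (t\<^sup>2 + \<bar>t\<bar> + (1 + \<bar>t\<bar>) / t\<^sup>2)) * cmod ((w - a) * (1 - a * w)) ^ n"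
proof -
  have w2: "w\<^sup>2 = - of_real (t\<^sup>2)" and cw: "cmod w = \<bar>t\<bar>"
    by (auto simp: w_def power_mult_distrib norm_mult)
  have cpos: "1 + t\<^sup>2 > 0" by (rule add_pos_nonneg) auto
  have cc: "cmod c = 1 / (2 * (1 + t\<^sup>2))" unfolding c_def norm_of_real using cpos by simp
  \<comment> \<open>\<open>T\<close> is the mirror half f(1/z) B(1/z)^(-n) - (a1 + b1 z) / z^2,
    multiplied by ((z - a) (1 - a z))^n to clear the poles. For t = 0 the corrections vanish; the
    explicit \<open>T\<close> is kept because its value at w = 0 is later read off the
    coefficients.\<close>
  have "\<exists>T. degree T \<le> 2 * n \<and>
      (\<forall>z. z\<^sup>2 * poly T z = (z - a) ^ n * (c * (z - w)\<^sup>2 * (z - cnj a) ^ n - (a1 + b1 * z) * (1 - a * z) ^ n)) \<and>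
      (t = 0 \<longrightarrow> T = smult c (([:-a, 1:] * [:- cnj a, 1:]) ^ n))"
  proof (cases "t = 0")
    case True
    have "degree (([:-a, 1:] * [:- cnj a, 1:]) ^ n) \<le> degree ([:-a, 1:] * [:- cnj a, 1:]) * n"
      by (rule degree_power_le)
    also have "\<dots> \<le> 2 * n" by simp
    finally have "degree (smult c (([:-a, 1:] * [:- cnj a, 1:]) ^ n)) \<le> 2 * n"
      using degree_smult_le order_trans by blast
    moreover have "poly (([:-a, 1:] * [:- cnj a, 1:]) ^ n) z = (z - a) ^ n * (z - cnj a) ^ n" for z
      unfolding poly_power poly_mult power_mult_distrib by simp
    moreover have "w = 0" "a1 = 0" "b1 = 0" using True by (auto simp: w_def a1_def b1_def)
    ultimately show ?thesis
      by (intro exI[of _ "smult c (([:-a, 1:] * [:- cnj a, 1:]) ^ n)"]) (simp only: poly_smult, simp)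
  next
    case False
    \<comment> \<open>\<open>a1\<close> and \<open>b1\<close> solve G(0) = 0 and G'(0) = 0, which
      makes \<open>G\<close> divisible by z^2. The terms with \<open>of_nat n\<close> in
      \<open>b1\<close> come from differentiating n-th powers; dividing by - cnj a restores the
      exponent n from n - 1.\<close>
    define G where "G = smult c ([:-w, 1:]\<^sup>2 * [:- cnj a, 1:] ^ n) - [:a1, b1:] * [:1, -a:] ^ n"
    have G: "poly G z = c * (z - w)\<^sup>2 * (z - cnj a) ^ n - (a1 + b1 * z) * (1 - a * z) ^ n" for z
      by (simp add: G_def poly_power algebra_simps)
    have dG: "degree G \<le> n + 2"
    proof -
      have 1: "degree ([:x, y:] ^ k) \<le> k" for x y :: complex and k
        using degree_power_le[of "[:x, y:]" k] by (simp add: le_trans split: if_splits)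
      have "degree ([:-w, 1:]\<^sup>2 * [:- cnj a, 1:] ^ n) \<le> n + 2"
        using degree_mult_le[of "[:-w, 1:]\<^sup>2" "[:- cnj a, 1:] ^ n"] 1[of "-w" 1 2] 1[of "- cnj a" 1 n] by linarith
      moreover have "degree ([:a1, b1:] * [:1, -a:] ^ n) \<le> n + 2"
        using degree_mult_le[of "[:a1, b1:]" "[:1, -a:] ^ n"] 1[of a1 b1 1] 1[of 1 "-a" n] by simp
      ultimately show ?thesis unfolding G_def
        by (intro degree_diff_le) (auto intro: order_trans[OF degree_smult_le])
    qed
    have G0: "coeff G 0 = 0"
      unfolding poly_0_coeff_0[symmetric] G by (simp add: a1_def)
    obtain m where m: "n = Suc m" using n by (cases n) auto
    have "coeff G 1 = poly (pderiv G) 0"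
      by (simp add: poly_0_coeff_0 coeff_pderiv)
    also have "\<dots> = c * (- 2 * w) * (- cnj a) ^ n + c * w\<^sup>2 * (of_nat n * (- cnj a) ^ m) - (b1 - a1 * (of_nat n * a))"
    proof -
      have L: "poly (pderiv (p * q)) 0 = poly (pderiv p) 0 * poly q 0 + poly p 0 * poly (pderiv q) 0" for p q :: "complex poly"
        by (simp add: pderiv_mult algebra_simps)
      have P: "poly (pderiv ([:x, y:] ^ Suc m)) 0 = of_nat (Suc m) * x ^ m * y" for x y :: complex
        by (simp add: pderiv_power_Suc poly_power pderiv_pCons del: of_nat_Suc power_Suc)
      have W: "poly (pderiv ([:-w, 1:]\<^sup>2)) 0 = - 2 * w"
        by (simp add: power2_eq_square pderiv_mult pderiv_pCons)
      have V: "poly [:x, y:] 0 = x" "poly (pderiv [:x, y:]) 0 = y" for x y :: complex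
        by (simp_all add: pderiv_pCons)
      show ?thesis
        unfolding G_def m pderiv_diff pderiv_smult poly_diff poly_smult L P W V poly_power
        by (simp add: algebra_simps del: of_nat_Suc power_Suc)
    qed
    also have "\<dots> = 0"
      using a by (simp add: b1_def a1_def m field_simps)
    finally have G1: "coeff G 1 = 0" .
    obtain g0 G' where G': "G = pCons g0 G'" by (cases G)
    obtain g1 T1 where T1: "G' = pCons g1 T1" by (cases G')
    have GT: "G = pCons 0 (pCons 0 T1)" using G0 G1 G' T1 by simp
    have "degree T1 \<le> n"
    proof (rule degree_le, intro allI impI)
      fix i assume "n < i"
      then have "coeff G (Suc (Suc i)) = 0" using dG by (intro coeff_eq_0) simp
      then show "coeff T1 i = 0" by (simp add: GT)
    qed
    moreover have "degree ([:-a, 1:] ^ n) \<le> n" using degree_power_le[of "[:-a, 1:]" n] by simp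
    ultimately have "degree ([:-a, 1:] ^ n * T1) \<le> 2 * n"
      using degree_mult_le[of "[:-a, 1:] ^ n" T1] by linarith
    moreover have "z\<^sup>2 * poly ([:-a, 1:] ^ n * T1) z = (z - a) ^ n * poly G z" for z
      unfolding GT by (simp add: poly_power power2_eq_square)
    ultimately show ?thesis using False unfolding G by blast
  qed
  then obtain T where dT: "degree T \<le> 2 * n"
    and T: "\<And>z. z\<^sup>2 * poly T z = (z - a) ^ n * (c * (z - w)\<^sup>2 * (z - cnj a) ^ n - (a1 + b1 * z) * (1 - a * z) ^ n)"
    and T0: "t = 0 \<Longrightarrow> T = smult c (([:-a, 1:] * [:- cnj a, 1:]) ^ n)"
    by blast
  \<comment> \<open>The half that carries the value at w: f(z) B(z)^(-n) minus its correction, with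
    the same clearing factor.\<close>
  have T': "z ^ (2 * n) * poly T (1 / z) =
      (1 - a * z) ^ n * (c * (1 - w * z)\<^sup>2 * (1 - cnj a * z) ^ n - (a1 * z\<^sup>2 + b1 * z) * (z - a) ^ n)"
    if z: "z \<noteq> 0" for z
  proof -
    have l: "z * (1 / z - x) = 1 - x * z" "z * (1 - x * (1 / z)) = z - x" for x using z by (auto simp: field_simps)
    have "z ^ (2 * n) * poly T (1 / z) = z ^ (2 * n) * z\<^sup>2 * ((1 / z)\<^sup>2 * poly T (1 / z))"
      using z by (simp add: power_divide)
    also have "\<dots> = (z * (1 / z - a)) ^ n * (c * (z * (1 / z - w))\<^sup>2 * (z * (1 / z - cnj a)) ^ n
        - (a1 * z\<^sup>2 + b1 * (z * (z * (1 / z)))) * (z * (1 - a * (1 / z))) ^ n)"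
      unfolding T power_mult_distrib mult_2 power_add by (simp add: algebra_simps power2_eq_square)
    also have "\<dots> = (1 - a * z) ^ n * (c * (1 - w * z)\<^sup>2 * (1 - cnj a * z) ^ n - (a1 * z\<^sup>2 + b1 * z) * (z - a) ^ n)"
      unfolding l using z by simp
    finally show ?thesis .
  qed
  show thesis
  proof (rule that[OF dT])
    fix z :: complex assume z: "cmod z = 1"
    then have z0: "z \<noteq> 0" by auto
    have zz: "z * cnj z = 1" using z by (metis complex_norm_square of_real_1 one_power2)
    have e1: "cmod (z - cnj a) = cmod (1 - a * z)"
    proof -
      have "z * cnj (z - cnj a) = 1 - a * z" using zz by (simp add: algebra_simps)
      then show ?thesis using z by (metis complex_mod_cnj mult_1 norm_mult)
    qed
    have e2: "cmod (1 - cnj a * z) = cmod (z - a)"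
    proof -
      have "z * cnj (z - a) = 1 - cnj a * z" using zz by (simp add: algebra_simps)
      then show ?thesis using z by (metis complex_mod_cnj mult_1 norm_mult)
    qed
    define Y where "Y = cmod ((z - a) * (1 - a * z)) ^ n"
    have Y: "cmod (z - a) ^ n * cmod (1 - a * z) ^ n = Y" by (simp add: Y_def norm_mult power_mult_distrib)
    have "cmod (poly T z) = cmod (z\<^sup>2 * poly T z)" using z by (simp add: norm_mult norm_power)
    also have "\<dots> = cmod (z - a) ^ n * cmod (c * (z - w)\<^sup>2 * (z - cnj a) ^ n - (a1 + b1 * z) * (1 - a * z) ^ n)"
      unfolding T by (simp add: norm_mult norm_power)
    also have "\<dots> \<le> cmod (z - a) ^ n * (cmod c * (cmod (z - w))\<^sup>2 * cmod (1 - a * z) ^ n + \<delta> * cmod (1 - a * z) ^ n)"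
    proof (intro mult_left_mono order_trans[OF norm_triangle_ineq4] add_mono)
      have "cmod (a1 + b1 * z) \<le> \<delta>" using norm_triangle_ineq[of a1 "b1 * z"] z by (simp add: norm_mult \<delta>_def)
      then show "cmod ((a1 + b1 * z) * (1 - a * z) ^ n) \<le> \<delta> * cmod (1 - a * z) ^ n"
        by (simp add: norm_mult norm_power mult_right_mono)
    qed (auto simp: norm_mult norm_power e1)
    also have "\<dots> = (cmod c * (cmod (z - w))\<^sup>2 + \<delta>) * Y"
      unfolding Y[symmetric] by (simp add: algebra_simps)
    finally have p1: "cmod (poly T z) \<le> (cmod c * (cmod (z - w))\<^sup>2 + \<delta>) * Y" .
    have "cmod (z ^ (2 * n) * poly T (1 / z)) =
       cmod (1 - a * z) ^ n * cmod (c * (1 - w * z)\<^sup>2 * (1 - cnj a * z) ^ n - (a1 * z\<^sup>2 + b1 * z) * (z - a) ^ n)"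
      unfolding T'[OF z0] by (simp add: norm_mult norm_power)
    also have "\<dots> \<le> cmod (1 - a * z) ^ n * (cmod c * (cmod (1 - w * z))\<^sup>2 * cmod (z - a) ^ n + \<delta> * cmod (z - a) ^ n)"
    proof (intro mult_left_mono order_trans[OF norm_triangle_ineq4] add_mono)
      have "cmod (a1 * z\<^sup>2 + b1 * z) \<le> \<delta>"
        using norm_triangle_ineq[of "a1 * z\<^sup>2" "b1 * z"] z by (simp add: norm_mult norm_power \<delta>_def)
      then show "cmod ((a1 * z\<^sup>2 + b1 * z) * (z - a) ^ n) \<le> \<delta> * cmod (z - a) ^ n"
        by (simp add: norm_mult norm_power mult_right_mono)
    qed (auto simp: norm_mult norm_power e2)
    also have "\<dots> = (cmod c * (cmod (1 - w * z))\<^sup>2 + \<delta>) * Y"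
      unfolding Y[symmetric] by (simp add: algebra_simps)
    finally have p2: "cmod (z ^ (2 * n) * poly T (1 / z)) \<le> (cmod c * (cmod (1 - w * z))\<^sup>2 + \<delta>) * Y" .
    have sq: "(cmod (z - w))\<^sup>2 + (cmod (1 - w * z))\<^sup>2 = 2 * (1 + t\<^sup>2)"
    proof -
      have z2: "(Re z)\<^sup>2 + (Im z)\<^sup>2 = 1" using z by (metis cmod_power2 one_power2)
      have "(cmod (z - w))\<^sup>2 = (Re z)\<^sup>2 + (Im z)\<^sup>2 - 2 * t * Im z + t\<^sup>2"
        "(cmod (1 - w * z))\<^sup>2 = 1 + 2 * t * Im z + t\<^sup>2 * ((Re z)\<^sup>2 + (Im z)\<^sup>2)"
        unfolding cmod_power2 w_def by (simp_all add: power2_eq_square algebra_simps)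
      then show ?thesis unfolding z2 by simp
    qed
    have "cmod (palindromic_eval n T z) \<le> (cmod c * (cmod (z - w))\<^sup>2 + \<delta>) * Y + (cmod c * (cmod (1 - w * z))\<^sup>2 + \<delta>) * Y"
      unfolding palindromic_eval_nonzero[OF dT z0]
      by (rule order_trans[OF norm_triangle_ineq add_mono[OF p1 p2]])
    also have "\<dots> = (cmod c * ((cmod (z - w))\<^sup>2 + (cmod (1 - w * z))\<^sup>2) + 2 * \<delta>) * Y"
      by (simp add: algebra_simps)
    also have "cmod c * ((cmod (z - w))\<^sup>2 + (cmod (1 - w * z))\<^sup>2) = 1"
      unfolding sq cc using cpos by simp
    finally show "cmod (palindromic_eval n T z) \<le> (1 + 2 * \<delta>) * cmod ((z - a) * (1 - a * z)) ^ n"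
      unfolding Y_def .
  next
    show "(1 + t\<^sup>2) / 2 * cmod ((1 - a * w) * (1 - cnj a * w)) ^ n \<le>
       cmod (palindromic_eval n T w) + (cmod a ^ n + \<delta> * (t\<^sup>2 + \<bar>t\<bar> + (1 + \<bar>t\<bar>) / t\<^sup>2)) * cmod ((w - a) * (1 - a * w)) ^ n"
    proof (cases "t = 0")
      case True
      \<comment> \<open>Here w = 0 and the value is the sum of the two extreme coefficients: 1/2 on
        top and a term of modulus |a|^(2n) / 2 at the bottom. The latter is absorbed by the error
        term \<open>cmod a ^ n\<close>, since the factor behind it is |a|^n as well; the quotient by
        \<open>t\<^sup>2\<close> is 0 by convention.\<close>
      define q where "q = [:-a, 1:] * [:- cnj a, 1:]"
      have Tq: "T = smult c (q ^ n)" using T0[OF True] by (simp add: q_def)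
      have "degree q = 2" "lead_coeff q = 1" by (simp_all add: q_def)
      then have "q \<noteq> 0" "lead_coeff q = 1" "degree q = 2" by auto
      then have "degree (q ^ n) = 2 * n" "lead_coeff (q ^ n) = 1"
        unfolding lead_coeff_power by (simp_all add: degree_power_eq)
      then have top: "coeff T (2 * n) = c" by (simp add: Tq)
      have "coeff T 0 = c * (a * cnj a) ^ n"
        by (simp add: Tq q_def poly_power mult.commute flip: poly_0_coeff_0)
      then have bot: "cmod (coeff T 0) = (cmod a ^ n * cmod a ^ n) / 2"
        using True cc by (simp add: norm_mult norm_power power_mult_distrib)
      have c2: "cmod c = 1 / 2" using True cc by simp
      have "0 \<le> cmod a ^ n * cmod a ^ n" by simp
      then have "1 / 2 \<le> cmod (coeff T 0 + coeff T (2 * n)) + cmod a ^ n * cmod a ^ n"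
        using norm_diff_ineq[of "coeff T (2 * n)" "coeff T 0"]
        unfolding bot unfolding top c2 add.commute[of c] by linarith
      then show ?thesis
        using True a(1) by (simp add: palindromic_eval_0[OF n] w_def)
    next
      case False
      have w0: "w \<noteq> 0" using False by (simp add: w_def)
      define Y where "Y = cmod ((w - a) * (1 - a * w)) ^ n"
      have Y: "cmod (w - a) ^ n * cmod (1 - a * w) ^ n = Y" by (simp add: Y_def norm_mult power_mult_distrib)
      have Y0: "Y \<ge> 0" by (simp add: Y_def)
      \<comment> \<open>The factor (z - w)^2 kills the main term of the mirror half at w, so only
        its correction survives.\<close>
      have "t\<^sup>2 * cmod (poly T w) = cmod (w\<^sup>2 * poly T w)" by (simp add: norm_mult norm_power cw)
      also have "\<dots> = cmod (a1 + b1 * w) * Y"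
        unfolding T Y[symmetric] by (simp add: norm_mult norm_power)
      also have "\<dots> \<le> (\<delta> * (1 + \<bar>t\<bar>)) * Y"
      proof (rule mult_right_mono[OF _ Y0])
        have "cmod (a1 + b1 * w) \<le> cmod a1 + cmod b1 * \<bar>t\<bar>"
          using norm_triangle_ineq[of a1 "b1 * w"] by (simp add: norm_mult cw)
        also have "\<dots> \<le> \<delta> * (1 + \<bar>t\<bar>)" by (simp add: \<delta>_def algebra_simps)
        finally show "cmod (a1 + b1 * w) \<le> \<delta> * (1 + \<bar>t\<bar>)" .
      qed
      finally have p1: "cmod (poly T w) \<le> \<delta> * ((1 + \<bar>t\<bar>) / t\<^sup>2) * Y"
        using False by (simp add: field_simps)
      define M where "M = (1 - a * w) ^ n * (c * (1 - w * w)\<^sup>2 * (1 - cnj a * w) ^ n)"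
      define E where "E = (1 - a * w) ^ n * ((a1 * w\<^sup>2 + b1 * w) * (w - a) ^ n)"
      have R: "palindromic_eval n T w = poly T w + (M - E)"
        unfolding palindromic_eval_nonzero[OF dT w0] T'[OF w0] M_def E_def by (simp add: algebra_simps)
      have M: "cmod M = (1 + t\<^sup>2) / 2 * cmod ((1 - a * w) * (1 - cnj a * w)) ^ n"
      proof -
        have "1 - w * w = of_real (1 + t\<^sup>2)" using w2 by (simp add: power2_eq_square)
        then have "cmod (1 - w * w) = 1 + t\<^sup>2" using cpos by (metis abs_of_pos norm_of_real)
        then have "cmod M = (cmod c * (1 + t\<^sup>2)\<^sup>2) * cmod ((1 - a * w) * (1 - cnj a * w)) ^ n"
          by (simp add: M_def norm_mult norm_power power_mult_distrib)
        also have "cmod c * (1 + t\<^sup>2)\<^sup>2 = (1 + t\<^sup>2) / 2"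
        proof -
          have "1 / (2 * s) * s\<^sup>2 = s / 2" if "s > 0" for s :: real
            using that by (simp add: power2_eq_square)
          then show ?thesis unfolding cc using cpos by blast
        qed
        finally show ?thesis .
      qed
      have "cmod E = cmod (a1 * w\<^sup>2 + b1 * w) * Y"
        unfolding E_def Y[symmetric] by (simp add: norm_mult norm_power)
      also have "\<dots> \<le> (\<delta> * (t\<^sup>2 + \<bar>t\<bar>)) * Y"
      proof (rule mult_right_mono[OF _ Y0])
        have "cmod (a1 * w\<^sup>2 + b1 * w) \<le> cmod a1 * t\<^sup>2 + cmod b1 * \<bar>t\<bar>"
          using norm_triangle_ineq[of "a1 * w\<^sup>2" "b1 * w"] by (simp add: norm_mult norm_power cw)
        also have "\<dots> \<le> \<delta> * (t\<^sup>2 + \<bar>t\<bar>)" by (simp add: \<delta>_def algebra_simps)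
        finally show "cmod (a1 * w\<^sup>2 + b1 * w) \<le> \<delta> * (t\<^sup>2 + \<bar>t\<bar>)" .
      qed
      finally have E: "cmod E \<le> (\<delta> * (t\<^sup>2 + \<bar>t\<bar>)) * Y" .
      have "cmod M \<le> cmod (palindromic_eval n T w) + cmod (poly T w) + cmod E"
      proof -
        have "M = palindromic_eval n T w - poly T w + E" by (simp add: R)
        then show ?thesis
          using norm_triangle_ineq[of "palindromic_eval n T w - poly T w" E]
            norm_triangle_ineq4[of "palindromic_eval n T w" "poly T w"] by simp
      qed
      also have "\<dots> \<le> cmod (palindromic_eval n T w) + \<delta> * ((1 + \<bar>t\<bar>) / t\<^sup>2) * Y + (\<delta> * (t\<^sup>2 + \<bar>t\<bar>)) * Y"
        using p1 E by linarith
      also have "\<dots> = cmod (palindromic_eval n T w) + (\<delta> * (t\<^sup>2 + \<bar>t\<bar> + (1 + \<bar>t\<bar>) / t\<^sup>2)) * Y"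
        by (simp add: algebra_simps)
      also have "\<dots> \<le> cmod (palindromic_eval n T w) + (cmod a ^ n + \<delta> * (t\<^sup>2 + \<bar>t\<bar> + (1 + \<bar>t\<bar>) / t\<^sup>2)) * Y"
        using Y0 by (intro add_left_mono mult_right_mono) auto
      finally show ?thesis unfolding M Y_def .
    qed
  qed
qed

text \<open>The corrections are of order n |a|^n with a and t fixed, hence vanish in the limit.
  \<epsilon> measures the excess over 1 on the circle, \<eta> the loss at w.\<close>

lemma near_extremal_sequence:
  fixes t :: real and a :: complex
  assumes a: "a \<noteq> 0" "cmod a < 1"
  obtains \<epsilon> \<eta> :: "nat \<Rightarrow> real" and T :: "nat \<Rightarrow> complex poly" where
    "\<epsilon> \<longlonglongrightarrow> 0" "\<eta> \<longlonglongrightarrow> 0" "\<And>n. \<epsilon> n \<ge> 0"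
    "\<And>n z. n \<ge> 1 \<Longrightarrow> cmod z = 1 \<Longrightarrow>
      cmod (palindromic_eval n (T n) z) \<le> (1 + \<epsilon> n) * cmod ((z - a) * (1 - a * z)) ^ n"
    "\<And>n. n \<ge> 1 \<Longrightarrow> (1 + t\<^sup>2) / 2 * cmod ((1 - a * (\<i> * t)) * (1 - cnj a * (\<i> * t))) ^ n \<le>
       cmod (palindromic_eval n (T n) (\<i> * t)) + \<eta> n * cmod ((\<i> * t - a) * (1 - a * (\<i> * t))) ^ n"
proof -
  define w where "w = \<i> * complex_of_real t"
  define c where "c = complex_of_real (1 / (2 * (1 + t\<^sup>2)))"
  define a1 where "a1 n = c * w\<^sup>2 * (- cnj a) ^ n" for n
  define b1 where "b1 n = - 2 * c * w * (- cnj a) ^ n + (c * w\<^sup>2 / (- cnj a) + c * w\<^sup>2 * a) * (of_nat n * (- cnj a) ^ n)" for n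
  define \<delta> where "\<delta> n = cmod (a1 n) + cmod (b1 n)" for n
  define \<epsilon> where "\<epsilon> n = 2 * \<delta> n" for n
  define \<eta> where "\<eta> n = cmod a ^ n + \<delta> n * (t\<^sup>2 + \<bar>t\<bar> + (1 + \<bar>t\<bar>) / t\<^sup>2)" for n
  have "\<exists>T. n \<ge> 1 \<longrightarrow> (\<forall>z. cmod z = 1 \<longrightarrow> cmod (palindromic_eval n T z) \<le> (1 + \<epsilon> n) * cmod ((z - a) * (1 - a * z)) ^ n) \<and>
    (1 + t\<^sup>2) / 2 * cmod ((1 - a * w) * (1 - cnj a * w)) ^ n \<le>
       cmod (palindromic_eval n T w) + \<eta> n * cmod ((w - a) * (1 - a * w)) ^ n" for n
  proof (cases "n \<ge> 1")
    case True
    show ?thesis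
      using near_extremal_palindromic[OF a True, of t] unfolding \<epsilon>_def \<eta>_def \<delta>_def a1_def b1_def c_def w_def
      by metis
  qed simp
  then obtain T where T: "\<And>n. n \<ge> 1 \<longrightarrow> (\<forall>z. cmod z = 1 \<longrightarrow> cmod (palindromic_eval n (T n) z) \<le> (1 + \<epsilon> n) * cmod ((z - a) * (1 - a * z)) ^ n) \<and>
    (1 + t\<^sup>2) / 2 * cmod ((1 - a * w) * (1 - cnj a * w)) ^ n \<le>
       cmod (palindromic_eval n (T n) w) + \<eta> n * cmod ((w - a) * (1 - a * w)) ^ n"
    by metis
  have na: "norm (- cnj a) < 1" using a by simp
  have l1: "(\<lambda>n. (- cnj a) ^ n) \<longlonglongrightarrow> 0" by (rule LIMSEQ_power_zero[OF na])
  have l2: "(\<lambda>n. of_nat n * (- cnj a) ^ n) \<longlonglongrightarrow> 0" by (rule powser_times_n_limit_0[OF na])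
  have l3: "(\<lambda>n. cmod a ^ n) \<longlonglongrightarrow> 0" by (rule LIMSEQ_power_zero) (use a in simp)
  have "\<delta> \<longlonglongrightarrow> cmod (c * w\<^sup>2 * 0) + cmod (- 2 * c * w * 0 + (c * w\<^sup>2 / (- cnj a) + c * w\<^sup>2 * a) * 0)"
    unfolding \<delta>_def[abs_def] a1_def b1_def by (intro tendsto_intros l1 l2)
  then have d: "\<delta> \<longlonglongrightarrow> 0" by simp
  have "\<epsilon> \<longlonglongrightarrow> 2 * 0" unfolding \<epsilon>_def[abs_def] by (intro tendsto_intros d)
  moreover have "\<eta> \<longlonglongrightarrow> 0 + 0 * (t\<^sup>2 + \<bar>t\<bar> + (1 + \<bar>t\<bar>) / t\<^sup>2)"
    unfolding \<eta>_def[abs_def] by (intro tendsto_add tendsto_mult d l3 tendsto_const)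
  moreover have "\<epsilon> n \<ge> 0" for n by (simp add: \<epsilon>_def \<delta>_def)
  ultimately show thesis
    using that[of \<epsilon> \<eta> T] T unfolding w_def by simp
qed

section \<open>Transplantation to the disc\<close>

lemma cmod_blaschke_identity:
  "(cmod (1 - cnj a * z))\<^sup>2 - (cmod (z - a))\<^sup>2 = (1 - (cmod z)\<^sup>2) * (1 - (cmod a)\<^sup>2)"
  unfolding cmod_power2 by (simp add: power2_eq_square algebra_simps)

lemma cmod_blaschke_less:
  assumes "cmod a < 1" "cmod z < 1"
  shows "cmod (z - a) < cmod (1 - cnj a * z)"
proof -
  have "(1 - (cmod z)\<^sup>2) * (1 - (cmod a)\<^sup>2) > 0"
    using assms by (intro mult_pos_pos) (auto simp: abs_square_less_1)
  then have "(cmod (z - a))\<^sup>2 < (cmod (1 - cnj a * z))\<^sup>2"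
    unfolding cmod_blaschke_identity[symmetric] by simp
  then show ?thesis by (rule power2_less_imp_less) simp
qed

lemma cmod_blaschke_eq:
  assumes "cmod z = 1"
  shows "cmod (z - a) = cmod (1 - cnj a * z)"
proof -
  have "(cmod (1 - cnj a * z))\<^sup>2 = (cmod (z - a))\<^sup>2"
    using cmod_blaschke_identity[of a z] assms by simp
  then show ?thesis by (simp add: power2_eq_iff_nonneg)
qed

lemma poly_class_le:
  assumes a: "0 < \<alpha>" "\<alpha> < pi" and P: "P \<in> poly_class n \<alpha>" and u: "u \<in> circ_arc \<alpha>"
  shows "cmod (poly P u) \<le> 1"
proof -
  have "bdd_above ((\<lambda>u. cmod (poly P u)) ` circ_arc \<alpha>)"
    by (intro bounded_imp_bdd_above compact_imp_bounded compact_continuous_image compact_circ_arc a continuous_intros)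
  then have "cmod (poly P u) \<le> (SUP u\<in>circ_arc \<alpha>. cmod (poly P u))"
    by (intro cSUP_upper u)
  then show ?thesis using P by (simp add: poly_class_def)
qed

lemma poly_classI:
  assumes a: "0 < \<alpha>" "\<alpha> < pi" and "degree P \<le> n" "\<And>u. u \<in> circ_arc \<alpha> \<Longrightarrow> cmod (poly P u) \<le> 1"
  shows "P \<in> poly_class n \<alpha>"
  using assms cis_in_circ_arc[OF a] unfolding poly_class_def by (auto intro!: cSUP_least)

text \<open>On the circle (1 + z)^2 / z and - (1 - z)^2 / z are nonnegative reals; they supply the
  parameters p and q of \<open>quotient_in_circ_arc\<close>, so the circle goes to the arc.\<close>

lemma sym_square_identity:
  fixes z :: complex
  assumes "cmod z = 1"
  shows "(1 + z)\<^sup>2 = z * of_real (2 + 2 * Re z)" "(1 - z)\<^sup>2 = - z * of_real (2 - 2 * Re z)"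
proof -
  have "z * (z + cnj z) = z\<^sup>2 + 1"
    using assms by (simp add: distrib_left power2_eq_square) (metis complex_norm_square of_real_1 one_power2)
  moreover have "z + cnj z = of_real (2 * Re z)" by (simp add: complex_add_cnj)
  ultimately have "z * of_real (2 * Re z) = z\<^sup>2 + 1" by simp
  then show "(1 + z)\<^sup>2 = z * of_real (2 + 2 * Re z)" "(1 - z)\<^sup>2 = - z * of_real (2 - 2 * Re z)"
    by (simp_all add: power2_eq_square algebra_simps)
qed

lemma cmod_one_Re:
  assumes "-1 \<le> x" "x \<le> 1"
  obtains z where "cmod z = 1" "Re z = x"
proof -
  have "x\<^sup>2 \<le> 1" using assms by (simp add: abs_square_le_1 abs_le_iff)
  then have "cmod (Complex x (sqrt (1 - x\<^sup>2))) = 1" by (simp add: cmod_def)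
  then show thesis using that[of "Complex x (sqrt (1 - x\<^sup>2))"] by simp
qed

lemma poly_homogenization:
  fixes P :: "complex poly"
  assumes "degree P \<le> n" "y \<noteq> 0"
  shows "(\<Sum>k\<le>n. coeff P k * x ^ k * y ^ (n - k)) = y ^ n * poly P (x / y)"
proof -
  have "poly P (x / y) = (\<Sum>k\<le>n. coeff P k * (x / y) ^ k)"
    unfolding poly_altdef by (rule sum.mono_neutral_left) (use assms in \<open>auto simp: coeff_eq_0\<close>)
  then show ?thesis
    unfolding sum_distrib_left
    by (auto intro!: sum.cong simp: assms power_divide power_diff sum_distrib_left)
qed

section \<open>The map between the disc and the complement of the arc, normalised at a point\<close>

locale arc_point =
  fixes \<alpha> :: real and u \<zeta> :: complex
  assumes al: "0 < \<alpha>" "\<alpha> < pi" and u: "u \<notin> circ_arc \<alpha>"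
    and zeta: "\<zeta> = csqrt (arc_moebius \<alpha> u)"
begin

abbreviation (input) "\<xi> \<equiv> cis (\<alpha> / 2)"
abbreviation (input) "\<sigma> \<equiv> cmod \<zeta>"

text \<open>Images of infinity and of \<open>u\<close> under x to (x - \<sigma>) / (x + \<sigma>),
  as \<zeta> takes the value \<open>cis (\<alpha>/2)\<close> at infinity. The modulus \<sigma>
  inside this Cayley transform does the work of rescaling \<zeta>.\<close>

definition "disc_pole = (\<xi> - of_real \<sigma>) / (\<xi> + of_real \<sigma>)"
definition "disc_t = Im ((\<zeta> - of_real \<sigma>) / (\<zeta> + of_real \<sigma>))"
text \<open>The inverse map: insert \<zeta> = \<sigma> (1 + z) / (1 - z) into u = (\<zeta>^2 cis
  \<alpha> - 1) / (\<zeta>^2 - cis \<alpha>) and clear (1 - z)^2. Both quadratics are palindromic,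
  so their quotient is invariant under z to 1/z.\<close>

definition "disc_num z = of_real (\<sigma>\<^sup>2) * (1 + z)\<^sup>2 * cis \<alpha> - (1 - z)\<^sup>2"
definition "disc_den z = of_real (\<sigma>\<^sup>2) * (1 + z)\<^sup>2 - cis \<alpha> * (1 - z)\<^sup>2"

lemma sigma_pos: "\<sigma> > 0" and Re_zeta: "Re \<zeta> > 0" and zeta_sq: "\<zeta>\<^sup>2 = arc_moebius \<alpha> u"
proof -
  show R: "Re \<zeta> > 0" unfolding zeta by (rule Re_csqrt_pos[OF arc_moebius_notin_nonpos_Reals[OF al u]])
  show "\<sigma> > 0" using R complex_Re_le_cmod[of \<zeta>] by linarith
  show "\<zeta>\<^sup>2 = arc_moebius \<alpha> u" by (simp add: zeta)
qed

lemma add_sigma_nonzero: "\<zeta> + of_real \<sigma> \<noteq> 0" "\<xi> + of_real \<sigma> \<noteq> 0"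
proof -
  have "Re (\<zeta> + of_real \<sigma>) > 0" "Re (\<xi> + of_real \<sigma>) > 0"
    using add_pos_pos[OF Re_zeta sigma_pos] add_pos_pos[OF Re_cis_half_pos[OF al] sigma_pos] by simp_all
  then show "\<zeta> + of_real \<sigma> \<noteq> 0" "\<xi> + of_real \<sigma> \<noteq> 0" by (metis less_irrefl zero_complex.sel(1))+
qed

text \<open>The Cayley transform takes the circle of radius \<sigma> = |\<zeta>| to the imaginary
  axis.\<close>

lemma disc_point: "(\<zeta> - of_real \<sigma>) / (\<zeta> + of_real \<sigma>) = \<i> * disc_t"
proof -
  have "Re ((\<zeta> - of_real \<sigma>) * cnj (\<zeta> + of_real \<sigma>)) = (Re \<zeta>)\<^sup>2 + (Im \<zeta>)\<^sup>2 - \<sigma>\<^sup>2"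
    by (simp add: power2_eq_square algebra_simps)
  then have "Re ((\<zeta> - of_real \<sigma>) * cnj (\<zeta> + of_real \<sigma>)) = 0"
    by (simp add: cmod_power2)
  then have "Re ((\<zeta> - of_real \<sigma>) / (\<zeta> + of_real \<sigma>)) = 0"
    by (subst complex_div_cnj) (simp only: Re_divide_of_real of_real_power[symmetric] div_0)
  then show ?thesis by (simp add: disc_t_def complex_eq_iff)
qed

lemma one_plus_disc_t_sq: "1 + disc_t\<^sup>2 = 2 * \<sigma> / (\<sigma> + Re \<zeta>)" and disc_t_less: "\<bar>disc_t\<bar> < 1"
proof -
  have p: "(cmod (\<zeta> + of_real \<sigma>))\<^sup>2 = 2 * \<sigma> * (\<sigma> + Re \<zeta>)" "(cmod (\<zeta> - of_real \<sigma>))\<^sup>2 = 2 * \<sigma> * (\<sigma> - Re \<zeta>)"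
    using cmod_power2[of \<zeta>] unfolding cmod_power2[of "\<zeta> + of_real \<sigma>"] cmod_power2[of "\<zeta> - of_real \<sigma>"]
    by (simp_all add: power2_eq_square algebra_simps)
  have "disc_t\<^sup>2 = (cmod ((\<zeta> - of_real \<sigma>) / (\<zeta> + of_real \<sigma>)))\<^sup>2"
    unfolding disc_point by (simp add: norm_mult)
  also have "\<dots> = (\<sigma> - Re \<zeta>) / (\<sigma> + Re \<zeta>)"
    unfolding norm_divide power_divide p using sigma_pos by simp
  finally have t: "disc_t\<^sup>2 = (\<sigma> - Re \<zeta>) / (\<sigma> + Re \<zeta>)" .
  have pos: "\<sigma> + Re \<zeta> > 0" using sigma_pos Re_zeta by linarith
  show "1 + disc_t\<^sup>2 = 2 * \<sigma> / (\<sigma> + Re \<zeta>)"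
    unfolding t using pos by (simp add: field_simps)
  have "disc_t\<^sup>2 < 1" unfolding t using pos Re_zeta by (simp add: field_simps)
  then show "\<bar>disc_t\<bar> < 1" by (simp add: abs_square_less_1)
qed

lemma disc_pole_less: "cmod disc_pole < 1"
proof -
  have "(cmod (\<xi> + of_real \<sigma>))\<^sup>2 = (cmod (\<xi> - of_real \<sigma>))\<^sup>2 + 4 * \<sigma> * Re \<xi>"
    unfolding cmod_power2 by (simp add: power2_eq_square algebra_simps)
  then have "(cmod (\<xi> - of_real \<sigma>))\<^sup>2 < (cmod (\<xi> + of_real \<sigma>))\<^sup>2"
    using sigma_pos Re_cis_half_pos[OF al] by (simp add: mult_pos_pos)
  then have "cmod (\<xi> - of_real \<sigma>) < cmod (\<xi> + of_real \<sigma>)" by (rule power2_less_imp_less) simp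
  then show ?thesis by (simp add: disc_pole_def norm_divide divide_less_eq_1)
qed

text \<open>\<sigma> is real while \<open>cis (\<alpha>/2)\<close> is not, so infinity never goes to
  the centre. The correction \<open>b1\<close> of the near-extremal polynomials divides by the
  conjugate of this point.\<close>

lemma disc_pole_nonzero: "disc_pole \<noteq> 0"
proof -
  have "Im \<xi> > 0" using al by (simp add: sin_gt_zero)
  then have "Im (\<xi> - of_real \<sigma>) \<noteq> 0" by simp
  then have "\<xi> - of_real \<sigma> \<noteq> 0" by (metis zero_complex.sel(2))
  then show ?thesis using add_sigma_nonzero(2) by (simp add: disc_pole_def)
qed

text \<open>The zeros are the two preimages of u = infinity, the pole and its reciprocal. Up to the
  constant this is the clearing factor of the near-extremal construction.\<close>

lemma disc_den_factor: "disc_den z = (\<xi> + of_real \<sigma>)\<^sup>2 * ((z - disc_pole) * (1 - disc_pole * z))"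
proof -
  have "S * (z - x / S) = S * z - x" "S * (1 - x / S * z) = S - x * z" if "S \<noteq> 0" for S x :: complex
    using that by (simp_all add: right_diff_distrib)
  note this[OF add_sigma_nonzero(2), of "\<xi> - of_real \<sigma>", folded disc_pole_def]
  then have "(\<xi> + of_real \<sigma>)\<^sup>2 * ((z - disc_pole) * (1 - disc_pole * z)) =
     ((\<xi> + of_real \<sigma>) * z - (\<xi> - of_real \<sigma>)) * ((\<xi> + of_real \<sigma>) - (\<xi> - of_real \<sigma>) * z)"
    by (simp only: power2_eq_square mult_ac) (metis mult.assoc mult.left_commute)
  also have "\<dots> = of_real (\<sigma>\<^sup>2) * (1 + z)\<^sup>2 - \<xi>\<^sup>2 * (1 - z)\<^sup>2"
    by (simp add: power2_eq_square algebra_simps)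
  finally show ?thesis unfolding disc_den_def cis_half_square[OF al] by (rule sym)
qed

lemma disc_image:
  shows "disc_den (\<i> * disc_t) \<noteq> 0" "disc_num (\<i> * disc_t) / disc_den (\<i> * disc_t) = u"
proof -
  define s where "s = complex_of_real \<sigma>"
  define m where "m = arc_moebius \<alpha> u"
  have zs: "\<zeta> + s \<noteq> 0" using add_sigma_nonzero by (simp add: s_def)
  have s0: "s \<noteq> 0" using sigma_pos unfolding s_def by simp
  have ue: "u - cis \<alpha> \<noteq> 0" using u cis_in_circ_arc[OF al] by auto
  have e: "(1 + \<i> * disc_t) = 2 * \<zeta> / (\<zeta> + s)" "(1 - \<i> * disc_t) = 2 * s / (\<zeta> + s)"
    unfolding disc_point[symmetric] s_def[symmetric] using zs by (simp_all add: field_simps)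
  have N: "disc_num (\<i> * disc_t) = (4 * s\<^sup>2 / (\<zeta> + s)\<^sup>2) * (m * cis \<alpha> - 1)"
    unfolding disc_num_def e power_divide power_mult_distrib of_real_power s_def[symmetric] zeta_sq m_def[symmetric]
    by (simp add: algebra_simps diff_divide_distrib)
  have D: "disc_den (\<i> * disc_t) = (4 * s\<^sup>2 / (\<zeta> + s)\<^sup>2) * (m - cis \<alpha>)"
    unfolding disc_den_def e power_divide power_mult_distrib of_real_power s_def[symmetric] zeta_sq m_def[symmetric]
    by (simp add: algebra_simps diff_divide_distrib)
  have mu: "m * (u - cis \<alpha>) = u * cis \<alpha> - 1" using ue by (simp add: m_def arc_moebius_def)
  have "(m - cis \<alpha>) * (u - cis \<alpha>) = (cis \<alpha>)\<^sup>2 - 1"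
    unfolding left_diff_distrib[of m] mu by (simp add: algebra_simps power2_eq_square)
  then have mne: "m - cis \<alpha> \<noteq> 0" using cis_square_neq_1[OF al] by auto
  have k: "4 * s\<^sup>2 / (\<zeta> + s)\<^sup>2 \<noteq> 0" using zs s0 by simp
  show "disc_den (\<i> * disc_t) \<noteq> 0" unfolding D using mne k by simp
  have "m * cis \<alpha> - 1 = u * (m - cis \<alpha>)"
    using mu by (simp add: algebra_simps)
  then show "disc_num (\<i> * disc_t) / disc_den (\<i> * disc_t) = u"
    unfolding N D using mne k by simp
qed

lemma circle_image:
  assumes z: "cmod z = 1"
  shows "disc_den z \<noteq> 0" "disc_num z / disc_den z \<in> circ_arc \<alpha>"
proof -
  define p q where "p = \<sigma>\<^sup>2 * (2 + 2 * Re z)" and "q = 2 - 2 * Re z"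
  have R: "\<bar>Re z\<bar> \<le> 1" using abs_Re_le_cmod[of z] z by simp
  have pq: "p \<ge> 0" "q \<ge> 0" using R by (auto simp: p_def q_def)
  have "p + q > 0"
  proof (cases "Re z = 1")
    case True
    then show ?thesis using sigma_pos by (simp add: p_def q_def)
  next
    case False
    then show ?thesis using R pq by (simp add: q_def)
  qed
  note pq = pq this
  have N: "disc_num z = z * (of_real p * cis \<alpha> + of_real q)"
    unfolding disc_num_def sym_square_identity[OF z] p_def q_def by (simp add: algebra_simps)
  have D: "disc_den z = z * (of_real p + of_real q * cis \<alpha>)"
    unfolding disc_den_def sym_square_identity[OF z] p_def q_def by (simp add: algebra_simps)
  have z0: "z \<noteq> 0" using z by auto
  show "disc_den z \<noteq> 0" unfolding D using z0 quotient_in_circ_arc(1)[OF al pq] by simp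
  have "disc_num z / disc_den z = (of_real p * cis \<alpha> + of_real q) / (of_real p + of_real q * cis \<alpha>)"
    unfolding N D using z0 by simp
  then show "disc_num z / disc_den z \<in> circ_arc \<alpha>" using quotient_in_circ_arc(2)[OF al pq] by simp
qed

lemma circle_image_surj:
  assumes v: "v \<in> circ_arc \<alpha>"
  obtains z where "cmod z = 1" "v = disc_num z / disc_den z"
proof -
  obtain p q where pq: "p \<ge> 0" "q \<ge> 0" "p + q > 0"
    and vq: "v = (of_real p * cis \<alpha> + of_real q) / (of_real p + of_real q * cis \<alpha>)"
    using circ_arc_conv_quotient[OF al v] .
  define r where "r = \<sigma>\<^sup>2"
  have r: "r > 0" using sigma_pos unfolding r_def by (intro zero_less_power)
  have d: "p + r * q > 0"
  proof (cases "p = 0")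
    case True
    then show ?thesis using pq r by simp
  qed (use pq r in \<open>auto intro: add_pos_nonneg\<close>)
  \<comment> \<open>The solution of r (1 + x) / (1 - x) = p / q, with x = Re z; \<open>k\<close>
    below is the common factor of proportionality.\<close>
  define x where "x = (p - r * q) / (p + r * q)"
  have x: "-1 \<le> x" "x \<le> 1" using d pq r by (auto simp: x_def field_simps)
  obtain z where z: "cmod z = 1" "Re z = x" using cmod_one_Re[OF x] .
  define k where "k = 4 * r / (p + r * q)"
  have k: "k \<noteq> 0" using r d by (simp add: k_def)
  have e1: "r * (2 + 2 * Re z) = k * p" and e2: "2 - 2 * Re z = k * q"
    unfolding z(2) x_def k_def using d by (simp_all add: field_simps)
  have N: "disc_num z = z * of_real k * (of_real p * cis \<alpha> + of_real q)"
  proof -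
    have "disc_num z = z * (of_real (r * (2 + 2 * Re z)) * cis \<alpha> + of_real (2 - 2 * Re z))"
      unfolding disc_num_def sym_square_identity[OF z(1)] r_def[symmetric] by (simp add: algebra_simps)
    then show ?thesis unfolding e1 e2 by (simp add: algebra_simps)
  qed
  have D: "disc_den z = z * of_real k * (of_real p + of_real q * cis \<alpha>)"
  proof -
    have "disc_den z = z * (of_real (r * (2 + 2 * Re z)) + of_real (2 - 2 * Re z) * cis \<alpha>)"
      unfolding disc_den_def sym_square_identity[OF z(1)] r_def[symmetric] by (simp add: algebra_simps)
    then show ?thesis unfolding e1 e2 by (simp add: algebra_simps)
  qed
  have "z \<noteq> 0" using z by auto
  then have "disc_num z / disc_den z = v" unfolding N D vq using k by simp
  then show thesis using that z(1) by simp
qed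

abbreviation (input) "disc_B \<equiv> cmod ((\<i> * disc_t - disc_pole) / (1 - cnj disc_pole * (\<i> * disc_t)))"

text \<open>With s = \<sigma>, the Blaschke factor at the pole is (\<zeta> - \<xi>) / (\<zeta> + cnj
  \<xi>) times the unimodular constant (cnj \<xi> + s) / (\<xi> + s).\<close>

lemma exp_green: "exp (- green_at_infinity (- circ_arc \<alpha>) u) = disc_B" and disc_B_bounds: "0 < disc_B" "disc_B < 1"
proof -
  define s where "s = complex_of_real \<sigma>"
  have cs: "cnj s = s" by (simp add: s_def)
  have zs: "\<zeta> + s \<noteq> 0" and xs: "\<xi> + s \<noteq> 0" using add_sigma_nonzero by (auto simp: s_def)
  have s0: "s \<noteq> 0" using sigma_pos unfolding s_def by simp
  have xs': "cnj \<xi> + s \<noteq> 0" using xs cs by (metis complex_cnj_add complex_cnj_zero_iff)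
  have ne: "\<zeta> - \<xi> \<noteq> 0" using csqrt_arc_moebius_neq[OF al u] by (simp add: zeta)
  have "Re (\<zeta> + cnj \<xi>) > 0"
    using Re_zeta Re_cis_half_pos[OF al] by simp
  then have ne': "\<zeta> + cnj \<xi> \<noteq> 0" by force
  have e1: "\<i> * disc_t - disc_pole = 2 * s * (\<zeta> - \<xi>) / ((\<zeta> + s) * (\<xi> + s))"
  proof -
    have "(\<zeta> - s) / (\<zeta> + s) - (\<xi> - s) / (\<xi> + s) = ((\<zeta> - s) * (\<xi> + s) - (\<xi> - s) * (\<zeta> + s)) / ((\<zeta> + s) * (\<xi> + s))"
      using zs xs by (rule diff_frac_eq)
    also have "(\<zeta> - s) * (\<xi> + s) - (\<xi> - s) * (\<zeta> + s) = 2 * s * (\<zeta> - \<xi>)" by (simp add: algebra_simps)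
    finally show ?thesis unfolding disc_point[symmetric] disc_pole_def s_def[symmetric] .
  qed
  have e2: "1 - cnj disc_pole * (\<i> * disc_t) = 2 * s * (\<zeta> + cnj \<xi>) / ((\<zeta> + s) * (cnj \<xi> + s))"
  proof -
    have "cnj disc_pole = (cnj \<xi> - s) / (cnj \<xi> + s)" by (simp add: disc_pole_def s_def)
    then have "1 - cnj disc_pole * (\<i> * disc_t) = 1 - ((cnj \<xi> - s) * (\<zeta> - s)) / ((cnj \<xi> + s) * (\<zeta> + s))"
      unfolding disc_point[symmetric] s_def[symmetric] by simp
    also have "\<dots> = ((cnj \<xi> + s) * (\<zeta> + s) - (cnj \<xi> - s) * (\<zeta> - s)) / ((cnj \<xi> + s) * (\<zeta> + s))"
      using zs xs' by (simp add: diff_divide_distrib)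
    also have "(cnj \<xi> + s) * (\<zeta> + s) - (cnj \<xi> - s) * (\<zeta> - s) = 2 * s * (\<zeta> + cnj \<xi>)" by (simp add: algebra_simps)
    finally show ?thesis by (simp only: mult.commute)
  qed
  have nx: "cmod (cnj \<xi> + s) = cmod (\<xi> + s)" using cs by (metis complex_cnj_add complex_mod_cnj)
  have B: "disc_B = cmod (\<zeta> - \<xi>) / cmod (\<zeta> + cnj \<xi>)"
    unfolding e1 e2 norm_divide norm_mult nx using zs xs s0 by simp
  have pos: "cmod (\<zeta> - \<xi>) > 0" "cmod (\<zeta> + cnj \<xi>) > 0" using ne ne' by auto
  have "green_at_infinity (- circ_arc \<alpha>) u = ln (cmod (\<zeta> + cnj \<xi>) / cmod (\<zeta> - \<xi>))"
    unfolding green_at_infinity_arc[OF al] arc_green_def norm_divide zeta using u by simp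
  then have "exp (- green_at_infinity (- circ_arc \<alpha>) u) = inverse (cmod (\<zeta> + cnj \<xi>) / cmod (\<zeta> - \<xi>))"
    using pos by (simp add: exp_minus)
  then show "exp (- green_at_infinity (- circ_arc \<alpha>) u) = disc_B" unfolding B by simp
  show "0 < disc_B" unfolding B using pos by simp
  have "(cmod (\<zeta> + cnj \<xi>))\<^sup>2 = (cmod (\<zeta> - \<xi>))\<^sup>2 + 4 * Re \<zeta> * Re \<xi>"
    unfolding cmod_power2 by (simp add: power2_eq_square algebra_simps)
  then have "(cmod (\<zeta> - \<xi>))\<^sup>2 < (cmod (\<zeta> + cnj \<xi>))\<^sup>2"
    using Re_zeta Re_cis_half_pos[OF al] by (simp add: mult_pos_pos)
  then have "cmod (\<zeta> - \<xi>) < cmod (\<zeta> + cnj \<xi>)" by (rule power2_less_imp_less) simp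
  then show "disc_B < 1" unfolding B using pos by (simp add: divide_less_eq_1)
qed

text \<open>For l = \<open>lam \<alpha> u\<close> one has l^2 = \<zeta>, so (l + cnj l)^2 = 2
  (\<sigma> + Re \<zeta>) and the kernel on the diagonal is \<sigma> / (\<sigma> + Re
  \<zeta>).\<close>

lemma k_Omega_eq: "k_Omega \<alpha> u u = of_real ((1 + disc_t\<^sup>2) / 2)"
proof -
  define l where "l = lam \<alpha> u"
  have m0: "arc_moebius \<alpha> u \<noteq> 0" using Re_zeta zeta by auto
  have l2: "l\<^sup>2 = \<zeta>"
  proof -
    have "l = exp (Ln (arc_moebius \<alpha> u) / 4)" using m0 by (simp add: l_def lam_def arc_moebius_def powr_def)
    then have "l\<^sup>2 = exp (Ln (arc_moebius \<alpha> u) / 2)" by (simp flip: exp_of_nat_mult add: power2_eq_square exp_add[symmetric])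
    then show ?thesis using m0 by (simp add: csqrt_exp_Ln zeta)
  qed
  have nl: "(cmod l)\<^sup>2 = \<sigma>" unfolding l2[symmetric] by (simp add: norm_power)
  have "(l + cnj l)\<^sup>2 = of_real (2 * (\<sigma> + Re \<zeta>))"
  proof -
    have "(l + cnj l)\<^sup>2 = (l\<^sup>2 + cnj (l\<^sup>2)) + 2 * (l * cnj l)" by (simp add: power2_eq_square algebra_simps)
    also have "\<dots> = of_real (2 * Re \<zeta>) + 2 * of_real \<sigma>"
      unfolding complex_norm_square[symmetric] nl l2 by (simp only: complex_add_cnj)
    finally show ?thesis by (simp add: algebra_simps)
  qed
  moreover have "2 * l * cnj l = of_real (2 * \<sigma>)"
    unfolding mult.assoc complex_norm_square[symmetric] nl by simp
  ultimately have "k_Omega \<alpha> u u = of_real (2 * \<sigma> / (2 * (\<sigma> + Re \<zeta>)))"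
    unfolding k_Omega_def k_half_plane_def l_def[symmetric] by (simp only: of_real_divide)
  also have "2 * \<sigma> / (2 * (\<sigma> + Re \<zeta>)) = (1 + disc_t\<^sup>2) / 2"
    unfolding one_plus_disc_t_sq by simp
  finally show ?thesis .
qed

end

section \<open>Two-sided bounds at the fixed point and the limit\<close>

context arc_point
begin

text \<open>The pole of order at most n that P has at infinity is cancelled by the n-fold zero of
  the Blaschke power, so \<open>symmetric_point_evaluation_bound\<close> applies to their product.
  \<open>C\<close> may depend on N, but not on n or P.\<close>

lemma poly_class_upper_bound:
  obtains \<rho> :: real where "0 \<le> \<rho>" "\<rho> < 1"
    "\<And>N. N \<ge> 1 \<Longrightarrow> \<exists>C. \<forall>n. \<forall>P\<in>poly_class n \<alpha>.
       cmod (poly P u) * disc_B ^ n * (2 - 1 / real N) \<le> (1 + disc_t\<^sup>2) + C * \<rho> ^ n"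
proof -
  define a where "a = disc_pole"
  have a1: "cmod a < 1" using disc_pole_less by (simp add: a_def)
  have nz: "1 - a * z \<noteq> 0" "1 - cnj a * z \<noteq> 0" if "cmod z \<le> 1" for z
  proof -
    have "cmod (a * z) < 1" "cmod (cnj a * z) < 1"
      using a1 that mult_left_le[of "cmod z" "cmod a"] by (auto simp: norm_mult)
    then show "1 - a * z \<noteq> 0" "1 - cnj a * z \<noteq> 0" by auto
  qed
  \<comment> \<open>This is B(z) / B(1/z) for the Blaschke factor B at \<open>a\<close>, exactly the
    ratio whose n-th power links F(z) to F(1/z).\<close>
  define \<beta> where "\<beta> z = ((z - a) * (z - cnj a)) / ((1 - cnj a * z) * (1 - a * z))" for z
  have \<beta>c: "continuous_on (cball 0 1) \<beta>" unfolding \<beta>_def using nz by (intro continuous_intros) auto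
  have \<beta>h: "\<beta> holomorphic_on ball 0 1" unfolding \<beta>_def using nz by (intro holomorphic_intros) auto
  have \<beta>1: "cmod (\<beta> z) = 1" if "cmod z = 1" for z
    using cmod_blaschke_eq[OF that, of a] cmod_blaschke_eq[OF that, of "cnj a"] nz[of z] that
    by (simp add: \<beta>_def norm_mult norm_divide)
  have \<beta>s: "\<beta> (cnj z) = cnj (\<beta> z)" for z by (simp add: \<beta>_def mult.commute)
  have \<beta>l: "cmod (\<beta> z) < 1" if "cmod z < 1" for z
  proof -
    have "cmod (z - a) * cmod (z - cnj a) < cmod (1 - cnj a * z) * cmod (1 - a * z)"
      using cmod_blaschke_less[OF a1 that] cmod_blaschke_less[of "cnj a" z] a1 that
      by (intro mult_strict_mono') auto
    then show ?thesis using nz[of z] that by (simp add: \<beta>_def norm_mult norm_divide divide_less_eq_1)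
  qed
  have "continuous_on (sphere 0 (1/2)) (\<lambda>z. cmod (\<beta> z))"
    by (intro continuous_intros continuous_on_subset[OF \<beta>c]) auto
  moreover have "complex_of_real (1/2) \<in> sphere 0 (1/2)" by (simp del: of_real_divide)
  ultimately obtain x where x: "x \<in> sphere 0 (1/2)" "\<forall>z\<in>sphere 0 (1/2). cmod (\<beta> z) \<le> cmod (\<beta> x)"
    using continuous_attains_sup[of "sphere (0::complex) (1/2)" "\<lambda>z. cmod (\<beta> z)"] by (metis compact_sphere empty_iff)
  define \<rho> where "\<rho> = cmod (\<beta> x)"
  have \<rho>: "0 \<le> \<rho>" "\<rho> < 1" "\<And>z. cmod z = 1/2 \<Longrightarrow> cmod (\<beta> z) \<le> \<rho>"
    using x \<beta>l[of x] by (auto simp: \<rho>_def)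
  define \<kappa> where "\<kappa> = (\<xi> + of_real \<sigma>)\<^sup>2"
  have \<kappa>: "\<kappa> \<noteq> 0" using add_sigma_nonzero(2) by (simp add: \<kappa>_def)
  have den: "disc_den z = \<kappa> * ((z - a) * (1 - a * z))" for z
    unfolding \<kappa>_def a_def by (rule disc_den_factor)
  have main: "cmod (poly P u) * disc_B ^ n * (2 - 1 / real N)
      \<le> (1 + disc_t\<^sup>2) + 6 * real N * (4 ^ N * (2 / (1 - \<bar>disc_t\<bar>)) ^ (N + 3)) * \<rho> ^ n"
    if N: "N \<ge> 1" and P: "P \<in> poly_class n \<alpha>" for N n P
  proof -
    \<comment> \<open>The homogenised form of P(u(z)) B(z)^n, defined and holomorphic also at z = a,
      where \<open>disc_den\<close> vanishes.\<close>
    define F where "F z = (\<Sum>k\<le>n. coeff P k * disc_num z ^ k * disc_den z ^ (n - k)) /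
        (\<kappa> * ((1 - cnj a * z) * (1 - a * z))) ^ n" for z
    have dP: "degree P \<le> n" using P by (simp add: poly_class_def)
    have F: "F z = poly P (disc_num z / disc_den z) * ((z - a) / (1 - cnj a * z)) ^ n"
      if z: "cmod z \<le> 1" "disc_den z \<noteq> 0" for z
    proof -
      have "F z = poly P (disc_num z / disc_den z) * (disc_den z / (\<kappa> * ((1 - cnj a * z) * (1 - a * z)))) ^ n"
        unfolding F_def poly_homogenization[OF dP z(2)] by (simp add: power_divide)
      also have "disc_den z / (\<kappa> * ((1 - cnj a * z) * (1 - a * z))) = (z - a) / (1 - cnj a * z)"
        unfolding den using \<kappa> nz[OF z(1)] by simp
      finally show ?thesis .
    qed
    have "cmod (F (\<i> * disc_t)) * (2 - 1 / real N) \<le>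
      (1 + disc_t\<^sup>2) + 6 * real N * (4 ^ N * (2 / (1 - \<bar>disc_t\<bar>)) ^ (N + 3)) * \<rho> ^ n"
    proof (rule symmetric_point_evaluation_bound[OF disc_t_less \<beta>c \<beta>h \<beta>1 \<beta>s])
      show "continuous_on (cball 0 1) F"
        unfolding F_def disc_num_def disc_den_def using nz \<kappa> by (intro continuous_intros) auto
      show "F holomorphic_on ball 0 1"
        unfolding F_def disc_num_def disc_den_def using nz \<kappa> by (intro holomorphic_intros) auto
      fix z :: complex assume z: "cmod z = 1"
      have c: "cmod ((z - a) / (1 - cnj a * z)) = 1"
        using cmod_blaschke_eq[OF z, of a] nz[of z] z by (simp add: norm_divide)
      have "cmod (F z) = cmod (poly P (disc_num z / disc_den z))"
        using F[of z] circle_image(1)[OF z] z c by (simp add: norm_mult norm_power)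
      also have "\<dots> \<le> 1" by (rule poly_class_le[OF al P circle_image(2)[OF z]])
      finally show "cmod (F z) \<le> 1" .
      have z0: "z \<noteq> 0" using z by auto
      have zz: "z * cnj z = 1" using z by (metis complex_norm_square of_real_1 one_power2)
      have zc: "cnj z = 1 / z" using zz z0 by (simp add: field_simps)
      have sq: "(1 + cnj z)\<^sup>2 = (1 + z)\<^sup>2 / z\<^sup>2" "(1 - cnj z)\<^sup>2 = (1 - z)\<^sup>2 / z\<^sup>2"
        unfolding zc using z0 by (simp_all add: power2_eq_square field_simps)
      have "disc_num (cnj z) = disc_num z / z\<^sup>2" "disc_den (cnj z) = disc_den z / z\<^sup>2"
        unfolding disc_num_def disc_den_def sq by (simp_all add: diff_divide_distrib)
      then have u: "disc_num (cnj z) / disc_den (cnj z) = disc_num z / disc_den z"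
        using z0 by simp
      have cz: "cmod (cnj z) = 1" using z by simp
      have "(cnj z - a) / (1 - cnj a * cnj z) * \<beta> z = (z - a) / (1 - cnj a * z)"
      proof -
        have e: "cnj z - a = (1 - a * z) / z" "1 - cnj a * cnj z = (z - cnj a) / z"
          unfolding zc using z0 by (simp_all add: field_simps)
        have "z - cnj a \<noteq> 0" using z a1 by auto
        then show ?thesis unfolding e \<beta>_def using z0 nz[of z] z by simp
      qed
      then have "((cnj z - a) / (1 - cnj a * cnj z)) ^ n * \<beta> z ^ n = ((z - a) / (1 - cnj a * z)) ^ n"
        by (metis power_mult_distrib)
      then show "F (cnj z) * \<beta> z ^ n = F z"
        using F[of z] F[of "cnj z"] circle_image(1)[OF z] circle_image(1)[OF cz] z cz unfolding u by simp
    qed (use \<rho> N in auto)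
    moreover have "F (\<i> * disc_t) = poly P u * ((\<i> * disc_t - a) / (1 - cnj a * (\<i> * disc_t))) ^ n"
      using F[of "\<i> * disc_t"] disc_image disc_t_less by (simp add: norm_mult)
    ultimately show ?thesis by (simp add: a_def norm_mult norm_power)
  qed
  show thesis
    by (rule that[OF \<rho>(1,2)]) (use main in blast)
qed

text \<open>A palindromic function divided by the n-th power of \<open>disc_den\<close> is a
  polynomial of degree at most n in u. The factor |(z - a) (1 - a z)|^n in the near-extremal bounds
  then divides out, which leaves 1 + \<epsilon> on the arc.\<close>

lemma poly_class_lower_bound:
  obtains \<epsilon> \<eta> :: "nat \<Rightarrow> real" where "\<epsilon> \<longlonglongrightarrow> 0" "\<eta> \<longlonglongrightarrow> 0" "\<And>n. \<epsilon> n \<ge> 0"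
    "\<And>n. n \<ge> 1 \<Longrightarrow> \<exists>P\<in>poly_class n \<alpha>. ((1 + disc_t\<^sup>2) / 2 / disc_B ^ n - \<eta> n) / (1 + \<epsilon> n) \<le> cmod (poly P u)"
proof -
  define a where "a = disc_pole"
  define w where "w = \<i> * complex_of_real disc_t"
  have a1: "cmod a < 1" "a \<noteq> 0" using disc_pole_less disc_pole_nonzero by (auto simp: a_def)
  obtain \<epsilon> \<eta> :: "nat \<Rightarrow> real" and T where
    eps: "\<epsilon> \<longlonglongrightarrow> 0" "\<eta> \<longlonglongrightarrow> 0" "\<And>n. \<epsilon> n \<ge> 0"
    and T1: "\<And>n z. n \<ge> 1 \<Longrightarrow> cmod z = 1 \<Longrightarrow>
      cmod (palindromic_eval n (T n) z) \<le> (1 + \<epsilon> n) * cmod ((z - a) * (1 - a * z)) ^ n"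
    and T2: "\<And>n. n \<ge> 1 \<Longrightarrow> (1 + disc_t\<^sup>2) / 2 * cmod ((1 - a * w) * (1 - cnj a * w)) ^ n \<le>
       cmod (palindromic_eval n (T n) w) + \<eta> n * cmod ((w - a) * (1 - a * w)) ^ n"
    using near_extremal_sequence[OF a1(2,1), of disc_t] unfolding w_def by metis
  define \<kappa> where "\<kappa> = (\<xi> + of_real \<sigma>)\<^sup>2"
  have \<kappa>: "\<kappa> \<noteq> 0" using add_sigma_nonzero(2) by (simp add: \<kappa>_def)
  have den: "disc_den z = \<kappa> * ((z - a) * (1 - a * z))" for z
    unfolding \<kappa>_def a_def by (rule disc_den_factor)
  show thesis
  proof (rule that[OF eps])
    fix n :: nat assume n: "n \<ge> 1"
    have "is_homogenization disc_num disc_den n (palindromic_eval n (T n))"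
    proof (rule is_homogenization_palindromic)
      show "disc_num z = (of_real (\<sigma>\<^sup>2) * cis \<alpha> - 1) * (z\<^sup>2 + 1) + (2 * (of_real (\<sigma>\<^sup>2) * cis \<alpha> + 1)) * z" for z
        by (simp add: disc_num_def power2_eq_square algebra_simps)
      show "disc_den z = (of_real (\<sigma>\<^sup>2) - cis \<alpha>) * (z\<^sup>2 + 1) + (2 * (of_real (\<sigma>\<^sup>2) + cis \<alpha>)) * z" for z
        by (simp add: disc_den_def power2_eq_square algebra_simps)
      have "(of_real (\<sigma>\<^sup>2) * cis \<alpha> - 1) * (2 * (of_real (\<sigma>\<^sup>2) + cis \<alpha>)) -
          (2 * (of_real (\<sigma>\<^sup>2) * cis \<alpha> + 1)) * (of_real (\<sigma>\<^sup>2) - cis \<alpha>) = 4 * of_real (\<sigma>\<^sup>2) * ((cis \<alpha>)\<^sup>2 - 1)"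
        by (simp add: power2_eq_square algebra_simps)
      also have "\<dots> \<noteq> 0" using cis_square_neq_1[OF al] sigma_pos by simp
      finally show "(of_real (\<sigma>\<^sup>2) * cis \<alpha> - 1) * (2 * (of_real (\<sigma>\<^sup>2) + cis \<alpha>)) -
          (2 * (of_real (\<sigma>\<^sup>2) * cis \<alpha> + 1)) * (of_real (\<sigma>\<^sup>2) - cis \<alpha>) \<noteq> 0" .
    qed
    then obtain Q where Q: "degree Q \<le> n"
      "\<And>z. disc_den z \<noteq> 0 \<Longrightarrow> palindromic_eval n (T n) z = disc_den z ^ n * poly Q (disc_num z / disc_den z)"
      unfolding is_homogenization_def by blast
    have Qn: "cmod (palindromic_eval n (T n) z) =
        cmod ((z - a) * (1 - a * z)) ^ n * cmod (\<kappa> ^ n * poly Q (disc_num z / disc_den z))"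
      if "disc_den z \<noteq> 0" for z
      unfolding Q(2)[OF that] unfolding den by (simp add: norm_mult norm_power power_mult_distrib)
    have Ypos: "cmod ((z - a) * (1 - a * z)) ^ n > 0" if "disc_den z \<noteq> 0" for z
      using that unfolding den by simp
    \<comment> \<open>\<kappa>^n undoes the constant in \<open>disc_den\<close>, and 1 + \<epsilon>
      n brings the supremum on the arc down to at most 1.\<close>
    define P where "P = smult (\<kappa> ^ n / of_real (1 + \<epsilon> n)) Q"
    have e1: "1 + \<epsilon> n > 0" using eps(3)[of n] by linarith
    have nP: "cmod (poly P x) = cmod (\<kappa> ^ n * poly Q x) / (1 + \<epsilon> n)" for x
    proof -
      have "cmod (of_real (1 + \<epsilon> n)) = 1 + \<epsilon> n" using e1 by (simp only: norm_of_real abs_of_pos)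
      then show ?thesis unfolding P_def poly_smult times_divide_eq_left norm_divide by simp
    qed
    have "P \<in> poly_class n \<alpha>"
    proof (rule poly_classI[OF al])
      show "degree P \<le> n" unfolding P_def using Q(1) degree_smult_le order_trans by blast
      fix v assume "v \<in> circ_arc \<alpha>"
      then obtain z where z: "cmod z = 1" "v = disc_num z / disc_den z" by (rule circle_image_surj)
      have d: "disc_den z \<noteq> 0" by (rule circle_image(1)[OF z(1)])
      have "cmod ((z - a) * (1 - a * z)) ^ n * cmod (\<kappa> ^ n * poly Q v) \<le> cmod ((z - a) * (1 - a * z)) ^ n * (1 + \<epsilon> n)"
        using T1[OF n z(1)] unfolding Qn[OF d] z(2) by (simp only: mult.commute)
      then have "cmod (\<kappa> ^ n * poly Q v) \<le> 1 + \<epsilon> n"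
        using Ypos[OF d] by (simp only: mult_le_cancel_left_pos)
      then show "cmod (poly P v) \<le> 1" unfolding nP using e1 by simp
    qed
    moreover have "((1 + disc_t\<^sup>2) / 2 / disc_B ^ n - \<eta> n) / (1 + \<epsilon> n) \<le> cmod (poly P u)"
    proof -
      have d: "disc_den w \<noteq> 0" and uw: "disc_num w / disc_den w = u"
        using disc_image unfolding w_def by auto
      define Y where "Y = cmod ((w - a) * (1 - a * w)) ^ n"
      have Y: "Y > 0" using Ypos[OF d] by (simp add: Y_def)
      have "disc_B ^ n * cmod ((1 - a * w) * (1 - cnj a * w)) ^ n = Y"
      proof -
        have "disc_B = cmod (w - a) / cmod (1 - cnj a * w)" by (simp add: w_def a_def norm_divide)
        moreover have "cmod (1 - cnj a * w) \<noteq> 0" using disc_B_bounds(1) by (auto simp: w_def a_def)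
        ultimately have "disc_B * cmod ((1 - a * w) * (1 - cnj a * w)) = cmod ((w - a) * (1 - a * w))"
          by (simp add: norm_mult)
        then show ?thesis unfolding Y_def by (metis power_mult_distrib)
      qed
      then have "cmod ((1 - a * w) * (1 - cnj a * w)) ^ n = Y / disc_B ^ n"
        using disc_B_bounds(1) by (metis less_irrefl nonzero_mult_div_cancel_left power_not_zero)
      then have "(1 + disc_t\<^sup>2) / 2 * (Y / disc_B ^ n) \<le> Y * cmod (\<kappa> ^ n * poly Q u) + \<eta> n * Y"
        using T2[OF n] unfolding Qn[OF d] uw Y_def[symmetric] by simp
      then have "Y * ((1 + disc_t\<^sup>2) / 2 / disc_B ^ n - \<eta> n) \<le> Y * cmod (\<kappa> ^ n * poly Q u)"
        by (simp add: algebra_simps)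
      then have "(1 + disc_t\<^sup>2) / 2 / disc_B ^ n - \<eta> n \<le> cmod (\<kappa> ^ n * poly Q u)"
        using Y by (simp only: mult_le_cancel_left_pos)
      then show ?thesis unfolding nP using e1 by (intro divide_right_mono) auto
    qed
    ultimately show "\<exists>P\<in>poly_class n \<alpha>. ((1 + disc_t\<^sup>2) / 2 / disc_B ^ n - \<eta> n) / (1 + \<epsilon> n) \<le> cmod (poly P u)"
      by blast
  qed
qed

lemma upper_envelope_asymptotics:
  "(\<lambda>n. upper_envelope n \<alpha> u / (exp (real n * green_at_infinity (- circ_arc \<alpha>) u) * ((1 + disc_t\<^sup>2) / 2))) \<longlonglongrightarrow> 1"
proof -
  define B where "B = disc_B"
  define g where "g = green_at_infinity (- circ_arc \<alpha>) u"
  define k where "k = (1 + disc_t\<^sup>2) / 2"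
  define r where "r n = upper_envelope n \<alpha> u / (exp (real n * g) * k)" for n
  have B: "0 < B" "B < 1" and Bg: "exp (- g) = B"
    using disc_B_bounds exp_green by (auto simp: B_def g_def)
  have k: "k > 0" unfolding k_def by (simp add: add_pos_nonneg)
  have En: "exp (real n * g) = 1 / B ^ n" for n
  proof -
    have "B ^ n = exp (real n * - g)"
      unfolding Bg[symmetric] by (rule exp_of_nat_mult[symmetric])
    then show ?thesis by (simp add: exp_minus inverse_eq_divide)
  qed
  have r: "r n = upper_envelope n \<alpha> u * B ^ n / k" for n
    unfolding r_def En by simp
  obtain \<rho> where \<rho>: "0 \<le> \<rho>" "\<rho> < 1" and up: "\<And>N. N \<ge> 1 \<Longrightarrow> \<exists>C. \<forall>n. \<forall>P\<in>poly_class n \<alpha>.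
       cmod (poly P u) * B ^ n * (2 - 1 / real N) \<le> 2 * k + C * \<rho> ^ n"
    using poly_class_upper_bound unfolding B_def k_def by (metis (no_types, lifting) field_sum_of_halves mult_2)
  obtain \<epsilon> \<eta> where eps: "\<epsilon> \<longlonglongrightarrow> 0" "\<eta> \<longlonglongrightarrow> 0" "\<And>n. \<epsilon> n \<ge> 0"
    and low: "\<And>n. n \<ge> 1 \<Longrightarrow> \<exists>P\<in>poly_class n \<alpha>. (k / B ^ n - \<eta> n) / (1 + \<epsilon> n) \<le> cmod (poly P u)"
    using poly_class_lower_bound unfolding B_def k_def by metis
  have zero: "0 \<in> poly_class n \<alpha>" for n by (rule poly_classI[OF al]) auto
  have env_le: "upper_envelope n \<alpha> u \<le> M" if "\<And>P. P \<in> poly_class n \<alpha> \<Longrightarrow> cmod (poly P u) \<le> M" for n M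
    unfolding upper_envelope_def using zero[of n] that by (intro cSUP_least) auto
  \<comment> \<open>The case N = 1 of the upper bound shows that the values at \<open>u\<close> are
    bounded over the class, so the supremum in \<open>upper_envelope\<close> dominates each of
    them.\<close>
  have le_M: "\<exists>M. \<forall>P\<in>poly_class n \<alpha>. cmod (poly P u) \<le> M" for n
  proof -
    obtain C where "\<forall>n. \<forall>P\<in>poly_class n \<alpha>. cmod (poly P u) * B ^ n * (2 - 1 / real 1) \<le> 2 * k + C * \<rho> ^ n"
      using up[of 1] by auto
    then have "\<forall>P\<in>poly_class n \<alpha>. cmod (poly P u) \<le> (2 * k + C * \<rho> ^ n) / B ^ n"
      using B by (simp add: pos_le_divide_eq)
    then show ?thesis by blast
  qed
  have env_ge: "cmod (poly P u) \<le> upper_envelope n \<alpha> u" if "P \<in> poly_class n \<alpha>" for n P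
    unfolding upper_envelope_def using le_M[of n] that by (intro cSUP_upper) (auto simp: bdd_above_def)
  have "r \<longlonglongrightarrow> 1"
  proof (rule order_tendstoI)
    fix y :: real assume y: "y < 1"
    have "(\<lambda>n. (1 - \<bar>\<eta> n\<bar> / k) / (1 + \<epsilon> n)) \<longlonglongrightarrow> (1 - \<bar>0\<bar> / k) / (1 + 0)"
      using k by (intro tendsto_intros eps) auto
    then have "\<forall>\<^sub>F n in sequentially. y < (1 - \<bar>\<eta> n\<bar> / k) / (1 + \<epsilon> n)"
      using y by (intro order_tendstoD(1)) auto
    with eventually_ge_at_top[of 1] show "\<forall>\<^sub>F n in sequentially. y < r n"
    proof eventually_elim
      case (elim n)
      obtain P where P: "P \<in> poly_class n \<alpha>" "(k / B ^ n - \<eta> n) / (1 + \<epsilon> n) \<le> cmod (poly P u)"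
        using low[OF elim(1)] by blast
      have Bn: "0 < B ^ n" "B ^ n \<le> 1" using B by (auto intro: power_le_one)
      have e: "1 + \<epsilon> n > 0" using eps(3)[of n] by linarith
      have "\<eta> n * B ^ n \<le> \<bar>\<eta> n\<bar> * 1" using Bn by (intro mult_mono) auto
      then have "1 - \<bar>\<eta> n\<bar> / k \<le> 1 - \<eta> n * B ^ n / k" using k by (simp add: divide_right_mono)
      then have "(1 - \<bar>\<eta> n\<bar> / k) / (1 + \<epsilon> n) \<le> (1 - \<eta> n * B ^ n / k) / (1 + \<epsilon> n)"
        using e by (intro divide_right_mono) auto
      also have "\<dots> = (k / B ^ n - \<eta> n) / (1 + \<epsilon> n) * (B ^ n / k)"
      proof -
        have "(k / b - x) * (b / k) = 1 - x * b / k" if "b > 0" for b x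
          using that k by (simp add: left_diff_distrib diff_divide_distrib)
        from this[OF Bn(1), of "\<eta> n", symmetric] show ?thesis
          by (simp only: times_divide_eq_left)
      qed
      also have "\<dots> \<le> upper_envelope n \<alpha> u * (B ^ n / k)"
        using P env_ge[OF P(1)] Bn k by (intro mult_right_mono) auto
      finally show "y < r n" using elim(2) by (simp add: r)
    qed
  next
    fix y :: real assume y: "1 < y"
    \<comment> \<open>N is fixed first, large enough to leave a margin below y; only then does n
      grow, since \<open>C\<close> depends on N.\<close>
    have "(\<lambda>N. 2 / (2 - 1 / real N)) \<longlonglongrightarrow> 2 / (2 - 0)"
      by (intro tendsto_intros lim_1_over_n) auto
    then have "\<forall>\<^sub>F N in sequentially. 2 / (2 - 1 / real N) < y"
      using y by (intro order_tendstoD(2)) auto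
    then obtain N where N: "N \<ge> 1" "2 / (2 - 1 / real N) < y"
      by (metis (mono_tags, lifting) eventually_at_top_linorder linorder_le_cases)
    define c where "c = 2 - 1 / real N"
    have c: "c > 0" using N(1) by (simp add: c_def field_simps)
    obtain C where C: "\<And>n P. P \<in> poly_class n \<alpha> \<Longrightarrow> cmod (poly P u) * B ^ n * c \<le> 2 * k + C * \<rho> ^ n"
      using up[OF N(1)] unfolding c_def by blast
    have "(\<lambda>n. (2 + C * \<rho> ^ n / k) / c) \<longlonglongrightarrow> (2 + C * 0 / k) / c"
      using c k \<rho> by (intro tendsto_intros LIMSEQ_power_zero) auto
    then have "\<forall>\<^sub>F n in sequentially. (2 + C * \<rho> ^ n / k) / c < y"
      using N(2) by (intro order_tendstoD(2)) (auto simp: c_def)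
    then show "\<forall>\<^sub>F n in sequentially. r n < y"
    proof eventually_elim
      case (elim n)
      have Bn: "0 < B ^ n" using B by simp
      have "upper_envelope n \<alpha> u \<le> (2 * k + C * \<rho> ^ n) / (B ^ n * c)"
        using C[of _ n] Bn c by (intro env_le) (simp add: pos_le_divide_eq mult.assoc)
      then have "upper_envelope n \<alpha> u * (B ^ n / k) \<le> (2 * k + C * \<rho> ^ n) / (B ^ n * c) * (B ^ n / k)"
        using Bn k by (intro mult_right_mono) auto
      also have "\<dots> = (2 + C * \<rho> ^ n / k) / c"
      proof -
        have "(2 * k + x) / (b * c) * (b / k) = (2 + x / k) / c" if "b > 0" for b x
          using that k c by (simp add: add_divide_distrib distrib_right)
        from this[OF Bn] show ?thesis .
      qed
      finally show "r n < y" using elim by (simp add: r)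
    qed
  qed
  then show ?thesis unfolding r_def[abs_def] g_def k_def .
qed

end

theorem theorem1p2:
  fixes \<alpha> :: real and u :: complex
  assumes "0 < \<alpha>" and "\<alpha> < pi" and "u \<notin> circ_arc \<alpha>"
  shows "(\<lambda>n. complex_of_real (upper_envelope n \<alpha> u) /
            (exp (complex_of_real (real n * green_at_infinity (- circ_arc \<alpha>) u)) * k_Omega \<alpha> u u))
         \<longlonglongrightarrow> 1"
proof -
  interpret arc_point \<alpha> u "csqrt (arc_moebius \<alpha> u)"
    using assms by unfold_locales auto
  from tendsto_of_real[OF upper_envelope_asymptotics, where ?'a = complex]
  show ?thesis unfolding k_Omega_eq exp_of_real by simp
qed

end
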